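(* Let $m\geq 3$ be an integer and let $\rho$ be a strictly positive, $m$ times continuously differentiable function on $[-1,1]$. Set \[ \varepsilon_n:=\frac{\log n}{n^m}\,\omega\left((1/\rho)^{(m)};1/n\right). \] Then for each $i\in\{1,2,3,4\}$, as $n\to\infty$, \[ P_{n,i}(z)=\left(1+O(\varepsilon_n)\right)\frac{(S_iS)(z)}{(S_iS)(\infty)}\left(\frac{\varphi(z)}{2}\right)^n \] uniformly on closed subsets of $\overline{\mathbb C}\setminus[-1,1]$, and \[ P_{n,i}(x)=\frac{\cos\big(n\arccos(x)+\theta(x)+\theta_i(x)\big)+O(\varepsilon_n)}{2^{n-1}(S_iS)(\infty)\sqrt{\rho(x)|v_i(x)|}} \] uniformly on $[-1,1]$. Moreover, for each $i\in\{1,2,3,4\}$, \[ a_{n,i}=\frac12+O(\varepsilon_n)\quad\text{and}\quad b_{n,i}=O(\varepsilon_n). \]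
   Context: $\overline{\mathbb C}$ is the Riemann sphere. For a continuous function $f$ on $[-1,1]$, $\omega(f;h):=\max_{|x-y|\le h,\ x,y\in[-1,1]}|f(x)-f(y)|$. Polynomials: $v_1(z)\equiv1$, $v_2(z)=z^2-1$, $v_3(z)=z+1$, $v_4(z)=z-1$. For $i\in\{1,2,3,4\}$, $P_{n,i}$ is the monic polynomial of degree $n$ satisfying \[ \int_{-1}^1x^lP_{n,i}(x)\frac{\rho(x)|v_i(x)|\,dx}{\sqrt{1-x^2}}=0,\quad l\in\{0,\ldots,n-1\}. \] The recurrence coefficients $a_{n,i}\in[0,\infty)$ and $b_{n,i}\in(-\infty,\infty)$ are defined by \[ xP_{n,i}(x)=P_{n+1,i}(x)+b_{n,i}P_{n,i}(x)+a_{n,i}^2P_{n-1,i}(x). \] Functions: $w(z):=\sqrt{z^2-1}$ is the branch analytic in $\mathbb C\setminus[-1,1]$ with $w(z)/z\to1$ as $z\to\infty$; $\varphi(z):=z+w(z)$. Subscripts $\pm$ denote boundary values on $[-1,1]$ from the upper ($+$) and lower ($-$) half-planes; in particular $w_\pm(x)=\pm\mathrm i\sqrt{1-x^2}$. The Szegő function of $\rho$ is \[ S(z):=\exp\left\{\frac{w(z)}{2\pi \mathrm i}\int_{-1}^1\frac{\log\rho(x)}{z-x}\frac{dx}{w_+(x)}\right\},\quad z\in\overline{\mathbb C}\setminus[-1,1], \] and \[ \theta(x):=\frac{\sqrt{1-x^2}}{2\pi}\,\mathrm{p.v.}\!\!\int_{-1}^1\frac{\log\rho(t)}{t-x}\frac{dt}{\sqrt{1-t^2}}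 \] (principal value integral), so that $\sqrt{\rho(x)}\,S_\pm(x)=e^{\pm \mathrm i\theta(x)}$; at $x=\pm1$ the function $\theta$ is understood by continuity. Further, \[ S_1(z):\equiv1,\quad S_2(z):=\frac{\varphi(z)}{w(z)},\quad S_3(z):=\left(\frac{\varphi(z)}{z+1}\right)^{1/2},\quad S_4(z):=\left(\frac{\varphi(z)}{z-1}\right)^{1/2} \] with principal square roots, so $S_1(\infty)=1$, $S_2(\infty)=2$, $S_3(\infty)=S_4(\infty)=\sqrt2$, and \[ \theta_1(x):\equiv0,\quad\theta_2(x):=\arccos(x)-\frac\pi2,\quad\theta_3(x):=\frac12\arccos(x),\quad\theta_4(x):=\frac12\arccos(x)-\frac\pi2 . \] Convention: the formula on $[-1,1]$ is understood, at points where $v_i(x)=0$, after multiplication by the denominator of its right-hand side. Constants in $O(\cdot)$ do not depend on $n$ (nor on $z$ or $x$ in the respective sets).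
   Formalization: When (1/ρ)^(m) is constant on [-1,1], ε_n = 0 and the first formula fails as written (ρ=1, i=1: P_n=(φ/2)^n(1+φ^{-2n})); in that case its error O(ε_n) is replaced by O(q^n) for some 0<q<1 depending on the closed set. *)

theory Defs
  imports
    "HOL-Analysis.Analysis"
    "HOL-Computational_Algebra.Polynomial"
    "HOL-Library.Landau_Symbols"
begin

section \<open>Smoothness on \<open>[-1,1]\<close> and the modulus of continuity\<close>

text \<open>Iterated derivatives on \<open>[-1,1]\<close>, one-sided at the endpoints.\<close>

definition nth_deriv :: "nat \<Rightarrow> (real \<Rightarrow> real) \<Rightarrow> real \<Rightarrow> real" where
  "nth_deriv k = (\<lambda>g x. vector_derivative g (at x within {-1..1})) ^^ k"

definition cont_diff :: "nat \<Rightarrow> (real \<Rightarrow> real) \<Rightarrow> bool" where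
  "cont_diff m f \<longleftrightarrow>
     (\<forall>k<m. nth_deriv k f differentiable_on {-1..1}) \<and> continuous_on {-1..1} (nth_deriv m f)"

text \<open>For continuous \<open>f\<close> and \<open>h \<ge> 0\<close> the supremum is attained, so it is the maximum.\<close>

definition modulus :: "(real \<Rightarrow> real) \<Rightarrow> real \<Rightarrow> real" where
  "modulus f h = Sup {\<bar>f x - f y\<bar> | x y. x \<in> {-1..1} \<and> y \<in> {-1..1} \<and> \<bar>x - y\<bar> \<le> h}"

lemma modulus_attained:
  assumes "continuous_on {-1..1} f" "h \<ge> 0"
  shows "\<exists>x\<in>{-1..1}. \<exists>y\<in>{-1..1}. \<bar>x - y\<bar> \<le> h \<and> modulus f h = \<bar>f x - f y\<bar> \<and>
     (\<forall>x'\<in>{-1..1}. \<forall>y'\<in>{-1..1}. \<bar>x' - y'\<bar> \<le> h \<longrightarrow> \<bar>f x' - f y'\<bar> \<le> modulus f h)"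
proof -
  define T where "T = ({-1..1} \<times> {-1..1}) \<inter> {p::real\<times>real. \<bar>fst p - snd p\<bar> \<le> h}"
  define g where "g = (\<lambda>p. \<bar>f (fst p) - f (snd p)\<bar>)"
  have "closed {p::real\<times>real. \<bar>fst p - snd p\<bar> \<le> h}"
    by (intro closed_Collect_le continuous_intros)
  then have T: "compact T"
    unfolding T_def by (intro compact_Int_closed compact_Times) auto
  have ne: "T \<noteq> {}"
  proof -
    have "(0, 0) \<in> T" using assms(2) by (simp add: T_def)
    then show ?thesis by blast
  qed
  have 1: "continuous_on T (\<lambda>p. f (fst p))"
    by (rule continuous_on_compose2[OF assms(1)]) (auto simp: T_def intro!: continuous_intros)
  have 2: "continuous_on T (\<lambda>p. f (snd p))"
    by (rule continuous_on_compose2[OF assms(1)]) (auto simp: T_def intro!: continuous_intros)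
  have "continuous_on T g"
    unfolding g_def by (intro continuous_intros 1 2)
  from continuous_attains_sup[OF T ne this]
  obtain p where p: "p \<in> T" "\<And>q. q \<in> T \<Longrightarrow> g q \<le> g p" by blast
  have "{\<bar>f x - f y\<bar> | x y. x \<in> {-1..1} \<and> y \<in> {-1..1} \<and> \<bar>x - y\<bar> \<le> h} = g ` T"
    (is "?A = _")
  proof (intro equalityI subsetI)
    fix d assume "d \<in> ?A"
    then obtain x y where "d = g (x, y)" "(x, y) \<in> T"
      unfolding g_def T_def by auto
    then show "d \<in> g ` T" by blast
  next
    fix d assume "d \<in> g ` T"
    then show "d \<in> ?A"
      unfolding g_def T_def by fastforce
  qed
  then have "modulus f h = g p"
    unfolding modulus_def using p by (auto intro!: cSup_eq_maximum)
  moreover have "g (x', y') \<le> g p" if "x' \<in> {-1..1}" "y' \<in> {-1..1}" "\<bar>x' - y'\<bar> \<le> h" for x' y'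
    by (rule p(2)) (use that in \<open>auto simp: T_def\<close>)
  ultimately show ?thesis
    using p(1) by (intro bexI[of _ "fst p"] bexI[of _ "snd p"]) (auto simp: T_def g_def)
qed

text \<open>If the \<open>m\<close>-th derivative of \<open>1 / \<rho>\<close> is constant, i.e. \<open>1 / \<rho>\<close> is a polynomial of degree at
  most \<open>m\<close>, then \<open>eps m \<rho>\<close> vanishes identically and \<open>O(eps m \<rho>)\<close> means \<open>0\<close> for all large \<open>n\<close>.\<close>

definition eps :: "nat \<Rightarrow> (real \<Rightarrow> real) \<Rightarrow> nat \<Rightarrow> real" where
  "eps m \<rho> n = ln (real n) / real n ^ m * modulus (nth_deriv m (\<lambda>x. 1 / \<rho> x)) (1 / real n)"

text \<open>\<open>e n = O(r n)\<close> as \<open>n \<rightarrow> \<infinity>\<close>, uniformly on \<open>A\<close>.\<close>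

definition uniform_bigo :: "'a set \<Rightarrow> (nat \<Rightarrow> 'a \<Rightarrow> complex) \<Rightarrow> (nat \<Rightarrow> real) \<Rightarrow> bool" where
  "uniform_bigo A e r \<longleftrightarrow>
     (\<exists>C. eventually (\<lambda>n. \<forall>z\<in>A. cmod (e n z) \<le> C * r n) sequentially)"


section \<open>Orthogonal polynomials\<close>

definition v_poly :: "nat \<Rightarrow> real \<Rightarrow> real" where
  "v_poly i x = (if i = 1 then 1 else if i = 2 then x\<^sup>2 - 1 else if i = 3 then x + 1 else x - 1)"

definition is_monic_OP :: "(real \<Rightarrow> real) \<Rightarrow> nat \<Rightarrow> nat \<Rightarrow> real poly \<Rightarrow> bool" where
  "is_monic_OP \<rho> i n p \<longleftrightarrow> degree p = n \<and> lead_coeff p = 1 \<and>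
     (\<forall>l<n. (LINT x:{-1..1}|lborel.
        x ^ l * poly p x * (\<rho> x * \<bar>v_poly i x\<bar> / sqrt (1 - x\<^sup>2))) = 0)"

text \<open>\<open>P\<^sub>-\<^sub>1\<close> is read as \<open>0\<close>, so \<open>a 0\<close> is unconstrained apart from its sign.\<close>

definition recurrence_coeffs ::
  "(nat \<Rightarrow> real poly) \<Rightarrow> (nat \<Rightarrow> real) \<Rightarrow> (nat \<Rightarrow> real) \<Rightarrow> bool" where
  "recurrence_coeffs p a b \<longleftrightarrow> (\<forall>n. a n \<ge> 0 \<and>
     [:0, 1:] * p n = p (Suc n) + smult (b n) (p n) +
       (if n = 0 then 0 else smult ((a n)\<^sup>2) (p (n - 1))))"


section \<open>The functions on the complement of \<open>[-1,1]\<close>\<close>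

abbreviation slit :: "complex set" where
  "slit \<equiv> complex_of_real ` {-1..1}"

text \<open>The branch of \<open>\<surd>(z\<^sup>2 - 1)\<close> that is analytic off \<open>[-1,1]\<close> and asymptotic to \<open>z\<close>;
  the next three lemmas confirm that this formula selects it. Its values on the slit are not used:
  the boundary values from above are \<open>w_plus\<close>.\<close>

definition w_fun :: "complex \<Rightarrow> complex" where
  "w_fun z = z * csqrt (1 - 1 / z\<^sup>2)"

definition w_plus :: "real \<Rightarrow> complex" where
  "w_plus x = \<i> * complex_of_real (sqrt (1 - x\<^sup>2))"

lemma w_fun_square: "z \<noteq> 0 \<Longrightarrow> (w_fun z)\<^sup>2 = z\<^sup>2 - 1"
  by (simp add: w_fun_def power_mult_distrib field_simps)

lemma w_fun_holomorphic: "w_fun holomorphic_on - slit"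
proof -
  have "1 - 1 / z\<^sup>2 \<notin> \<real>\<^sub>\<le>\<^sub>0" if "z \<notin> slit" for z
  proof
    assume "1 - 1 / z\<^sup>2 \<in> \<real>\<^sub>\<le>\<^sub>0"
    then obtain r where r: "1 - 1 / z\<^sup>2 = complex_of_real r" "r \<le> 0"
      by (auto elim: nonpos_Reals_cases)
    define s where "s = sqrt (1 / (1 - r))"
    have s: "s\<^sup>2 = 1 / (1 - r)" "0 \<le> s" "s \<le> 1"
      using r(2) by (auto simp: s_def real_sqrt_le_1_iff)
    have "1 / z\<^sup>2 = complex_of_real (1 - r)"
      using r(1) by (metis add_diff_cancel_left' diff_diff_eq2 diff_add_cancel of_real_1 of_real_diff)
    then have "z\<^sup>2 = 1 / complex_of_real (1 - r)"
      by (metis inverse_eq_divide inverse_inverse_eq)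
    also have "\<dots> = (complex_of_real s)\<^sup>2"
      by (metis of_real_1 of_real_divide of_real_power s(1))
    finally have "z = complex_of_real s \<or> z = complex_of_real (- s)"
      unfolding power2_eq_iff of_real_minus .
    moreover have "s \<in> {-1..1}" "- s \<in> {-1..1}"
      using s(2,3) by auto
    ultimately show False
      using that by blast
  qed
  moreover have "z \<noteq> 0" if "z \<notin> slit" for z
    using that by (metis atLeastAtMost_iff image_eqI neg_le_0_iff_le of_real_0 zero_le_one)
  ultimately show ?thesis
    unfolding w_fun_def by (intro holomorphic_intros) auto
qed

lemma w_fun_at_infinity: "((\<lambda>z. w_fun z / z) \<longlongrightarrow> 1) at_infinity"
proof -
  have "((\<lambda>z. 1 - inverse z * inverse z) \<longlongrightarrow> 1 - 0 * (0::complex)) at_infinity"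
    by (intro tendsto_intros tendsto_inverse_0)
  then have "((\<lambda>z. csqrt (1 - inverse z * inverse z)) \<longlongrightarrow> csqrt 1) at_infinity"
    by (intro isCont_tendsto_compose[of _ csqrt] continuous_at_csqrt) auto
  moreover have "\<forall>\<^sub>F z in at_infinity. csqrt (1 - inverse z * inverse z) = w_fun z / z"
    using eventually_not_equal_at_infinity[of 0]
    by eventually_elim (auto simp: w_fun_def power2_eq_square divide_inverse)
  ultimately show ?thesis
    by (simp add: tendsto_cong)
qed

definition phi :: "complex \<Rightarrow> complex" where
  "phi z = z + w_fun z"

definition szego :: "(real \<Rightarrow> real) \<Rightarrow> complex \<Rightarrow> complex" where
  "szego \<rho> z = exp (w_fun z / (2 * complex_of_real pi * \<i>) *
     (LINT x:{-1..1}|lborel. complex_of_real (ln (\<rho> x)) / (z - complex_of_real x) / w_plus x))"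

definition szego_factor :: "nat \<Rightarrow> complex \<Rightarrow> complex" where
  "szego_factor i z =
     (if i = 1 then 1 else if i = 2 then phi z / w_fun z
      else if i = 3 then csqrt (phi z / (z + 1)) else csqrt (phi z / (z - 1)))"

definition SS :: "(real \<Rightarrow> real) \<Rightarrow> nat \<Rightarrow> complex \<Rightarrow> complex" where
  "SS \<rho> i z = szego_factor i z * szego \<rho> z"

definition SS_inf :: "(real \<Rightarrow> real) \<Rightarrow> nat \<Rightarrow> complex" where
  "SS_inf \<rho> i = Lim at_infinity (SS \<rho> i)"


section \<open>The phase functions on \<open>[-1,1]\<close>\<close>

definition pv_integral :: "(real \<Rightarrow> real) \<Rightarrow> real \<Rightarrow> real" where
  "pv_integral f x =
     Lim (at_right 0) (\<lambda>d. LINT t:{-1..1} - {x - d<..<x + d}|lborel. f t)"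

definition theta_interior :: "(real \<Rightarrow> real) \<Rightarrow> real \<Rightarrow> real" where
  "theta_interior \<rho> x = sqrt (1 - x\<^sup>2) / (2 * pi) *
     pv_integral (\<lambda>t. ln (\<rho> t) / (t - x) / sqrt (1 - t\<^sup>2)) x"

definition theta :: "(real \<Rightarrow> real) \<Rightarrow> real \<Rightarrow> real" where
  "theta \<rho> x = (if x \<in> {-1<..<1} then theta_interior \<rho> x
     else Lim (at x within {-1<..<1}) (theta_interior \<rho>))"

definition theta_shift :: "nat \<Rightarrow> real \<Rightarrow> real" where
  "theta_shift i x =
     (if i = 1 then 0 else if i = 2 then arccos x - pi / 2
      else if i = 3 then arccos x / 2 else arccos x / 2 - pi / 2)"

end

theory Submission
  imports Defs "HOL-Complex_Analysis.Complex_Analysis"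
    "HOL-Computational_Algebra.Fundamental_Theorem_Algebra"
begin

text \<open>Approximate \<open>1 / \<rho>\<close> by a polynomial \<open>Q\<close> of degree less than \<open>n\<close> (iterated Jackson kernels), with error
  \<open>\<delta> = O(n\<^sup>-\<^sup>m \<omega>(1/n))\<close>; as a function of \<open>t\<close> with \<open>x = cos t\<close> the error is Lipschitz with constant
  \<open>O(n \<delta>)\<close>. If \<open>Q (cos t) = \<bar>A (cis t)\<bar>\<^sup>2\<close> with \<open>A\<close> free of zeros in the closed disc, the orthogonal
  polynomials of the weight \<open>\<bar>v\<^sub>i\<bar> / (Q \<surd>(1 - x\<^sup>2))\<close> of degree at least \<open>n - 1\<close> are explicit combinations of
  Chebyshev polynomials (Bernstein--Szego), and \<open>A\<close> is the Szego function of \<open>1 / Q\<close>.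

  The difference between \<open>P\<^sub>n\<close> and its Bernstein--Szego counterpart has lower degree, hence is
  reproduced by the Christoffel--Darboux kernel of \<open>1 / Q\<close>, and by orthogonality only the difference
  \<open>\<rho> - 1 / Q\<close> of the weights enters. The kernel is \<open>O(n / (1 + n \<bar>s - t\<bar>))\<close>, so its \<open>L\<^sup>1\<close> norm is \<open>O(log n)\<close>:
  this is the logarithm in \<open>\<epsilon>\<^sub>n\<close>. The phase \<open>\<theta>\<close> is a conjugate function, and the bounds \<open>\<delta>\<close> and \<open>n \<delta>\<close> give the
  same \<open>\<delta> log n\<close> for its error. Off the interval the estimate follows from the maximum principle in
  the variable \<open>\<zeta> = 1 / \<phi>(z)\<close>, and the recurrence coefficients are found by integrating the recurrence
  against Bernstein--Szego polynomials, whose own coefficients are exactly \<open>1/2\<close> and \<open>0\<close>.\<close>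

text \<open>Approximation controls the weight, but two singular integrals act on its error. For the
  Christoffel-Darboux kernel a sup bound on the error suffices. The conjugate function is unbounded
  in the sup norm; it loses only a logarithm once the error is also Lipschitz at scale 1/n, which is
  why the approximation has to be good together with its first derivative. The kernel used is that
  of the explicit weight 1 / \<open>Q\<close>, so the unknown orthogonal polynomial remains under
  the integral; its maximum is bounded by absorption, which works because \<epsilon>_n tends to 0.
  Multiplying a polynomial by the square root of \<bar>v_i\<bar> turns all four kinds into plain
  waves in t, and the kernel bound then holds up to the endpoints. A polynomial wave consists of an
  outgoing and a reflected part. On the interval both belong to the main term; off it the reflected
  part is an error r^n that \<epsilon>_n covers only if \<epsilon>_n is not identically zero, hence
  the case distinction in the result.\<close>

section \<open>The change of variable x = cos t for the arcsine weight\<close>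

lemma set_integrable_bounded_Icc:
  fixes f :: "real \<Rightarrow> 'a::euclidean_space"
  assumes "f \<in> borel_measurable borel" "\<And>x. x \<in> {a..b} \<Longrightarrow> norm (f x) \<le> M"
  shows "set_integrable lborel {a..b} f"
  unfolding set_integrable_def
  by (rule integrableI_bounded_set_indicator[where B = M]) (use assms in \<open>auto simp: emeasure_lborel_Icc_eq\<close>)

text \<open>On the open interval the Jacobian sin t cancels the root exactly, so a bounded
  \<open>G\<close> leaves a bounded integrand. The left-hand side is a Lebesgue set integral, the
  form in which orthogonality, the Szego function and the principal value are given.\<close>

lemma arcsine_substitution:
  fixes G :: "real \<Rightarrow> 'a::euclidean_space"
  assumes G: "set_borel_measurable borel {-1..1} G" and M: "\<And>x. x \<in> {-1..1} \<Longrightarrow> norm (G x) \<le> M"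
  shows "set_integrable lborel {-1..1} (\<lambda>x. G x /\<^sub>R sqrt (1 - x\<^sup>2))"
    and "(LINT x:{-1..1}|lborel. G x /\<^sub>R sqrt (1 - x\<^sup>2)) = (LINT t:{0..pi}|lborel. G (cos t))"
    and "set_integrable lborel {0..pi} (\<lambda>t. G (cos t))"
proof -
  define H where "H = (\<lambda>x. indicat_real {-1..1} x *\<^sub>R G x)"
  have H [measurable]: "H \<in> borel_measurable borel"
    using G by (simp add: H_def set_borel_measurable_def)
  have Hb: "norm (H x) \<le> \<bar>M\<bar>" for x
    using M[of x] by (auto simp: H_def indicator_def)
  have HG: "H (cos t) = G (cos t)" for t
    by (simp add: H_def)
  have I0: "set_integrable lborel {0..pi} (\<lambda>t. H (cos t))"
    by (rule set_integrable_bounded_Icc[where M = "\<bar>M\<bar>"]) (use Hb in auto)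
  then show "set_integrable lborel {0..pi} (\<lambda>t. G (cos t))"
    by (simp add: HG)
  let ?S = "{0<..<pi}"
  have I1: "set_integrable lborel ?S (\<lambda>t. H (cos t))"
    by (rule set_integrable_subset[OF I0]) auto
  define f where "f = (\<lambda>x. H x /\<^sub>R sqrt (1 - x\<^sup>2))"
  have [measurable]: "f \<in> borel_measurable borel"
    unfolding f_def by measurable
  have img: "cos ` ?S = {-1<..<1}"
  proof (intro equalityI subsetI)
    fix y :: real assume "y \<in> {-1<..<1}"
    then show "y \<in> cos ` ?S"
      by (intro image_eqI[of _ _ "arccos y"]) (auto simp: arccos_lt_bounded)
  next
    fix y assume "y \<in> cos ` ?S"
    then show "y \<in> {-1<..<1}"
      using cos_monotone_0_pi[of 0] cos_monotone_0_pi[of _ pi] by auto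
  qed
  have eq: "\<bar>- sin t\<bar> *\<^sub>R f (cos t) = H (cos t)" if "t \<in> ?S" for t
  proof -
    have "sin t > 0" using that by (auto intro: sin_gt_zero)
    moreover have "1 - (cos t)\<^sup>2 = (sin t)\<^sup>2" by (simp add: sin_squared_eq)
    ultimately show ?thesis by (simp add: f_def)
  qed
  \<comment> \<open>The substitution theorem speaks of the completed measure; for Borel integrands
    integrability is the same.\<close>
  have A: "(\<lambda>t. H (cos t)) absolutely_integrable_on ?S"
    using I1 unfolding set_integrable_def by (subst integrable_completion) auto
  then have B: "(\<lambda>t. \<bar>- sin t\<bar> *\<^sub>R f (cos t)) absolutely_integrable_on ?S"
    by (rule set_integrable_cong[THEN iffD1, rotated -1]) (use eq in auto)
  have inj: "inj_on cos ?S"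
    by (intro inj_onI) (auto intro: cos_inj_pi)
  have "f absolutely_integrable_on cos ` ?S \<and> integral (cos ` ?S) f = integral ?S (\<lambda>t. \<bar>- sin t\<bar> *\<^sub>R f (cos t))"
    by (rule has_absolute_integral_change_of_variables_real[where h = "\<lambda>t. - sin t", THEN iffD1])
       (use B inj in \<open>auto intro!: derivative_eq_intros DERIV_cos[THEN DERIV_subset]\<close>)
  then have f1: "f absolutely_integrable_on {-1<..<1}"
    and f2: "integral {-1<..<1} f = integral ?S (\<lambda>t. H (cos t))"
    using eq Henstock_Kurzweil_Integration.integral_cong[of ?S "\<lambda>t. \<bar>- sin t\<bar> *\<^sub>R f (cos t)" "\<lambda>t. H (cos t)"]
    unfolding img by auto
  have f3: "set_integrable lborel {-1<..<1} f"
    using f1 unfolding set_integrable_def by (subst (asm) integrable_completion) auto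
  \<comment> \<open>At x = 1 and x = -1 the divisor is 0 and the quotient is 0 by convention, so
    closed and open interval carry the same integrand.\<close>
  have ind: "indicator {-1..1} x *\<^sub>R (G x /\<^sub>R sqrt (1 - x\<^sup>2)) = indicat_real {-1<..<1} x *\<^sub>R f x" for x
    by (cases "x = 1 \<or> x = -1") (auto simp: f_def H_def indicator_def)
  show "set_integrable lborel {-1..1} (\<lambda>x. G x /\<^sub>R sqrt (1 - x\<^sup>2))"
    using f3 unfolding set_integrable_def ind .
  have "(LINT x:{-1..1}|lborel. G x /\<^sub>R sqrt (1 - x\<^sup>2)) = (LINT x:{-1<..<1}|lborel. f x)"
    unfolding set_lebesgue_integral_def ind ..
  also have "\<dots> = integral {-1<..<1} f"
    by (rule set_borel_integral_eq_integral(2)[OF f3])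
  also have "\<dots> = integral ?S (\<lambda>t. H (cos t))" by (rule f2)
  also have "\<dots> = integral {0..pi} (\<lambda>t. H (cos t))"
    by (rule integral_open_interval_real[symmetric])
  also have "\<dots> = (LINT t:{0..pi}|lborel. H (cos t))"
    by (rule set_borel_integral_eq_integral(2)[OF I0, symmetric])
  finally show "(LINT x:{-1..1}|lborel. G x /\<^sub>R sqrt (1 - x\<^sup>2)) = (LINT t:{0..pi}|lborel. G (cos t))"
    by (simp add: HG)
qed

lemma arcsine_substitution_continuous:
  fixes G :: "real \<Rightarrow> 'a::euclidean_space"
  assumes G: "continuous_on {-1..1} G"
  shows "(LINT x:{-1..1}|lborel. G x /\<^sub>R sqrt (1 - x\<^sup>2)) = integral {0..pi} (\<lambda>t. G (cos t))"
proof -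
  have "bounded (G ` {-1..1})"
    by (intro compact_imp_bounded compact_continuous_image G) auto
  then obtain M where M: "norm (G x) \<le> M" if "x \<in> {-1..1}" for x
    unfolding bounded_iff by blast
  have "set_borel_measurable borel {-1..1} G"
    using borel_measurable_continuous_on_indicator[OF _ G] by (simp add: set_borel_measurable_def)
  from arcsine_substitution[OF this M] show ?thesis
    by (simp add: set_borel_integral_eq_integral)
qed

subsection \<open>Integrals over the unit circle\<close>

lemma cis_2pi_minus: "cis (2 * pi - t) = cis (- t)"
  by (simp add: complex_eq_iff cos_diff sin_diff)

text \<open>Cauchy's formula with the lower half circle folded onto the upper one, since the
  interval is parametrized by t in [0, \<pi>] only.\<close>

lemma circle_mean_value:
  fixes H :: "complex \<Rightarrow> complex"
  assumes R: "R > 1" and H: "H holomorphic_on ball 0 R" and \<xi>: "norm \<xi> < 1"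
  shows "((\<lambda>t. H (cis t) * cis t / (cis t - \<xi>) + H (cis (- t)) * cis (- t) / (cis (- t) - \<xi>))
     has_integral 2 * pi * H \<xi>) {0..pi}"
proof -
  define f where "f = (\<lambda>t. H (cis t) * cis t / (cis t - \<xi>))"
  have sub: "cball 0 1 \<subseteq> ball (0::complex) R" using R by auto
  have "((\<lambda>u. H u / (u - \<xi>)) has_contour_integral (2 * of_real pi * \<i> * H \<xi>)) (circlepath 0 1)"
    using holomorphic_on_subset[OF H sub] holomorphic_on_subset[OF H order.trans[OF ball_subset_cball sub]] \<xi>
    by (intro Cauchy_integral_circlepath) (auto intro: holomorphic_on_imp_continuous_on)
  then have "((\<lambda>t. \<i> * f t) has_integral (2 * of_real pi * \<i> * H \<xi>)) {0..2*pi}"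
    unfolding circlepath_def
    by (subst (asm) has_contour_integral_part_circlepath_iff)
       (auto simp: f_def divide_inverse mult_ac)
  from has_integral_mult_right[OF this, of "- \<i>"]
  have f: "(f has_integral (2 * pi * H \<xi>)) {0..2*pi}"
    by (simp add: mult_ac)
  then have i: "f integrable_on {0..2*pi}" by blast
  have i1: "f integrable_on {0..pi}" and i2: "f integrable_on {pi..2*pi}"
    by (rule integrable_subinterval_real[OF i]; simp)+
  have "(f has_integral (integral {pi..2*pi} f)) {pi..2*pi}"
    using i2 by blast
  then have "((\<lambda>t. f (- t)) has_integral (integral {pi..2*pi} f)) {-(2*pi)..-pi}"
    by (simp add: has_integral_reflect_real)
  then have "((\<lambda>t. f (2 * pi - t)) has_integral (integral {pi..2*pi} f)) {0..pi}"
    using has_integral_shift_Icc_real[of "\<lambda>t. f (- t)" "- (2 * pi)" "integral {pi..2*pi} f" 0 pi] by (simp add: o_def)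
  moreover have "(f has_integral (integral {0..pi} f)) {0..pi}"
    using i1 by blast
  ultimately have "((\<lambda>t. f t + f (2 * pi - t)) has_integral (integral {0..pi} f + integral {pi..2*pi} f)) {0..pi}"
    by (intro has_integral_add)
  moreover have "integral {0..pi} f + integral {pi..2*pi} f = 2 * pi * H \<xi>"
    using Henstock_Kurzweil_Integration.integral_combine[of 0 pi "2*pi" f] i f by (auto dest: integral_unique)
  ultimately show ?thesis
    by (simp add: f_def cis_2pi_minus)
qed

subsection \<open>The Joukowski map and the Szego function\<close>

definition joukowski :: "complex \<Rightarrow> complex" where
  "joukowski \<zeta> = (\<zeta> + 1 / \<zeta>) / 2"

lemma joukowski_cis: "joukowski (cis t) = of_real (cos t)" "joukowski (cis (- t)) = of_real (cos t)"
  by (simp_all add: joukowski_def complex_eq_iff Re_divide Im_divide cis.ctr)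

text \<open>The root \<open>u\<close> is a Cayley transform of the point
  \<open>\<zeta>\<^sup>2\<close> of the disc, so its real part is positive; this identifies it as
  the principal square root.\<close>

lemma w_fun_joukowski:
  assumes "\<zeta> \<noteq> 0" "norm \<zeta> < 1"
  shows "w_fun (joukowski \<zeta>) = (1 / \<zeta> - \<zeta>) / 2"
proof -
  have n: "norm (\<zeta>\<^sup>2) < 1"
    using assms(2) by (simp add: norm_power power_less_one_iff)
  have nz: "1 + \<zeta>\<^sup>2 \<noteq> 0"
  proof
    assume "1 + \<zeta>\<^sup>2 = 0"
    then have "\<zeta>\<^sup>2 = -1" by (simp add: eq_neg_iff_add_eq_0 add.commute)
    then show False using n by simp
  qed
  define u where "u = (1 - \<zeta>\<^sup>2) / (1 + \<zeta>\<^sup>2)"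
  have z: "joukowski \<zeta> = (1 + \<zeta>\<^sup>2) / (2 * \<zeta>)"
    using assms(1) by (simp add: joukowski_def field_simps power2_eq_square)
  have "u\<^sup>2 = 1 - 1 / (joukowski \<zeta>)\<^sup>2"
  proof -
    have "(1 - v)\<^sup>2 / (1 + v)\<^sup>2 = 1 - 4 * v / (1 + v)\<^sup>2" if "1 + v \<noteq> 0" for v :: complex
      using that by (simp add: divide_simps) (simp add: algebra_simps power2_eq_square)
    from this[OF nz] show ?thesis
      by (simp add: u_def z power_divide power_mult_distrib)
  qed
  moreover have "0 < Re u"
  proof -
    define v where "v = \<zeta>\<^sup>2"
    have "(norm v)\<^sup>2 < 1" using n by (simp add: v_def power_less_one_iff)
    then have a: "(Re v)\<^sup>2 + (Im v)\<^sup>2 < 1" by (simp add: cmod_power2)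
    have "Re ((1 - v) / (1 + v)) = (1 - ((Re v)\<^sup>2 + (Im v)\<^sup>2)) / ((1 + Re v)\<^sup>2 + (Im v)\<^sup>2)"
      by (simp add: Re_divide power2_eq_square) (simp add: algebra_simps)
    moreover have "(1 + Re v)\<^sup>2 + (Im v)\<^sup>2 > 0"
      using nz by (auto simp: sum_power2_gt_zero_iff v_def[symmetric] complex_eq_iff add.commute)
    ultimately show ?thesis using a by (simp add: u_def v_def)
  qed
  ultimately have "csqrt (1 - 1 / (joukowski \<zeta>)\<^sup>2) = u"
    by (intro csqrt_unique) auto
  then have "w_fun (joukowski \<zeta>) = joukowski \<zeta> * u"
    by (simp add: w_fun_def)
  also have "\<dots> = (1 - \<zeta>\<^sup>2) / (2 * \<zeta>)"
    using nz by (simp add: u_def z)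
  also have "\<dots> = (1 / \<zeta> - \<zeta>) / 2"
    using assms(1) by (simp add: field_simps power2_eq_square)
  finally show ?thesis .
qed

lemma phi_joukowski:
  assumes "\<zeta> \<noteq> 0" "norm \<zeta> < 1"
  shows "phi (joukowski \<zeta>) = 1 / \<zeta>"
  unfolding phi_def w_fun_joukowski[OF assms] by (simp add: joukowski_def field_simps)

text \<open>The two solutions of \<zeta> + 1/\<zeta> = 2 z are reciprocal, and neither has modulus 1
  because the circle is mapped into the slit. One of them therefore lies in the disc.\<close>

lemma joukowski_surj:
  assumes "z \<notin> slit"
  obtains \<zeta> where "\<zeta> \<noteq> 0" "norm \<zeta> < 1" "z = joukowski \<zeta>"
proof -
  define \<zeta> where "\<zeta> = z + csqrt (z\<^sup>2 - 1)"
  define \<zeta>' where "\<zeta>' = z - csqrt (z\<^sup>2 - 1)"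
  have p: "\<zeta> * \<zeta>' = 1"
    by (simp add: \<zeta>_def \<zeta>'_def algebra_simps power2_eq_square[symmetric])
  have s: "\<zeta> + \<zeta>' = 2 * z" by (simp add: \<zeta>_def \<zeta>'_def)
  have nz: "\<zeta> \<noteq> 0" "\<zeta>' \<noteq> 0" using p by auto
  have inv: "1 / \<zeta> = \<zeta>'" "1 / \<zeta>' = \<zeta>" using p nz by (auto simp: field_simps)
  have z: "z = joukowski \<zeta>" "z = joukowski \<zeta>'"
    unfolding joukowski_def inv using s by (simp_all add: add.commute)
  have "norm \<zeta> \<noteq> 1"
  proof
    assume "norm \<zeta> = 1"
    then have "\<zeta> = cis (Arg \<zeta>)" using nz by (metis cis_Arg sgn_div_norm div_by_1 scaleR_one inverse_1)
    then have "z = of_real (cos (Arg \<zeta>))" using z(1) joukowski_cis(1) by metis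
    then show False using assms by (auto intro!: imageI)
  qed
  moreover have "norm \<zeta> * norm \<zeta>' = 1" using p by (metis norm_mult norm_one)
  ultimately have "norm \<zeta> < 1 \<or> norm \<zeta>' < 1"
    by (smt (verit) mult_less_cancel_left1 norm_ge_zero mult_le_cancel_left1)
  then show ?thesis using that z nz by blast
qed
lemma joukowski_kernel_factor:
  fixes \<zeta> :: complex
  shows "1 - 2 * \<zeta> * of_real (cos t) + \<zeta>\<^sup>2 = (1 - \<zeta> * cis t) * (1 - \<zeta> * cis (- t))"
proof -
  have c: "of_real (cos t) = (cis t + cis (- t)) / 2"
    by (simp add: complex_eq_iff)
  have "cis t * cis (- t) = 1" by (simp add: cis_mult)
  then show ?thesis unfolding c by (simp add: algebra_simps power2_eq_square)
qed

lemma norm_mult_cis_less: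
  fixes \<zeta> :: complex
  assumes "norm \<zeta> < 1" shows "norm (\<zeta> * cis t) < 1"
  using assms by (simp add: norm_mult)

lemma one_minus_mult_cis_nonzero: "norm (\<zeta> :: complex) < 1 \<Longrightarrow> 1 - \<zeta> * cis t \<noteq> 0"
  using norm_mult_cis_less[of \<zeta> t] by auto

lemma joukowski_kernel_nonzero:
  fixes \<zeta> :: complex
  assumes "norm \<zeta> < 1" shows "1 - 2 * \<zeta> * of_real (cos t) + \<zeta>\<^sup>2 \<noteq> 0"
  unfolding joukowski_kernel_factor using one_minus_mult_cis_nonzero[OF assms] by simp

text \<open>Each of the two factors has modulus at least 1 - \<bar>\<zeta>\<bar>. Crude near the
  circle, but it is applied with \<zeta> kept away from it.\<close>

lemma joukowski_kernel_norm_ge: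
  fixes \<zeta> :: complex
  assumes "norm \<zeta> \<le> 1"
  shows "(1 - norm \<zeta>)\<^sup>2 \<le> norm (1 - 2 * \<zeta> * of_real (cos t) + \<zeta>\<^sup>2)"
proof -
  have "1 - norm \<zeta> \<le> norm (1 - \<zeta> * cis t)" for t
    using norm_triangle_ineq2[of 1 "\<zeta> * cis t"] by (simp add: norm_mult)
  then show ?thesis
    unfolding joukowski_kernel_factor norm_mult power2_eq_square[of "1 - norm \<zeta>"]
    using assms by (intro mult_mono) auto
qed

lemma joukowski_minus_cos:
  assumes "\<zeta> \<noteq> 0"
  shows "joukowski \<zeta> - of_real (cos t) = (1 - 2 * \<zeta> * of_real (cos t) + \<zeta>\<^sup>2) / (2 * \<zeta>)"
  using assms by (simp add: joukowski_def field_simps power2_eq_square)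

lemma joukowski_notin_slit:
  assumes "\<zeta> \<noteq> 0" "norm \<zeta> < 1"
  shows "joukowski \<zeta> \<notin> slit"
proof
  assume "joukowski \<zeta> \<in> slit"
  then obtain x where x: "x \<in> {-1..1}" "joukowski \<zeta> = of_real (cos (arccos x))"
    by auto
  then show False
    using joukowski_minus_cos[OF assms(1), of "arccos x"] joukowski_kernel_nonzero[OF assms(2), of "arccos x"] assms(1)
    by auto
qed

text \<open>In the variable \<open>\<zeta> = 1 / \<phi>(z)\<close> and with \<open>x = cos t\<close> the Szego function of \<open>\<rho>\<close> is the
  exponential of minus the Poisson-type integral of \<open>ln \<rho>\<close>.\<close>

definition outer :: "(real \<Rightarrow> real) \<Rightarrow> complex \<Rightarrow> complex" where
  "outer F \<zeta> = integral {0..pi}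
     (\<lambda>t. of_real (F t) * ((1 - \<zeta>\<^sup>2) / (1 - 2 * \<zeta> * of_real (cos t) + \<zeta>\<^sup>2))) / (2 * pi)"

lemma continuous_on_outer_integrand:
  fixes \<zeta> :: complex
  assumes "continuous_on {0..pi} F" "norm \<zeta> < 1"
  shows "continuous_on {0..pi} (\<lambda>t. of_real (F t) * ((1 - \<zeta>\<^sup>2) / (1 - 2 * \<zeta> * of_real (cos t) + \<zeta>\<^sup>2)))"
  using joukowski_kernel_nonzero[OF assms(2)] assms(1)
  by (intro continuous_intros) auto

lemma continuous_on_comp_cos:
  "continuous_on {-1..1} g \<Longrightarrow> continuous_on A (\<lambda>t::real. g (cos t))"
  by (rule continuous_on_compose2[of "{-1..1}" g]) (auto intro: continuous_intros)

text \<open>The factor 1/(2 \<zeta>) of z - cos t cancels against that of w. The two imaginary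
  units, one from the prefactor and one from \<open>w_plus\<close>, produce the minus sign.\<close>

lemma szego_joukowski:
  assumes \<rho>: "continuous_on {-1..1} \<rho>" "\<And>x. x \<in> {-1..1} \<Longrightarrow> \<rho> x > 0"
    and \<zeta>: "\<zeta> \<noteq> 0" "norm \<zeta> < 1"
  shows "szego \<rho> (joukowski \<zeta>) = exp (- outer (\<lambda>t. ln (\<rho> (cos t))) \<zeta>)"
proof -
  let ?z = "joukowski \<zeta>"
  define G where "G = (\<lambda>x. complex_of_real (ln (\<rho> x)) / (?z - of_real x) / \<i>)"
  have ne: "?z - of_real x \<noteq> 0" if "x \<in> {-1..1}" for x
    using joukowski_notin_slit[OF \<zeta>] that by auto
  have G: "continuous_on {-1..1} G"
    unfolding G_def using \<rho> ne by (intro continuous_intros) (auto simp: less_imp_neq[symmetric])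
  have "(LINT x:{-1..1}|lborel. complex_of_real (ln (\<rho> x)) / (?z - complex_of_real x) / w_plus x)
      = (LINT x:{-1..1}|lborel. G x /\<^sub>R sqrt (1 - x\<^sup>2))"
    by (simp add: G_def w_plus_def scaleR_conv_of_real divide_inverse mult_ac)
  also have "\<dots> = integral {0..pi} (\<lambda>t. G (cos t))"
    by (rule arcsine_substitution_continuous[OF G])
  finally have *: "w_fun ?z / (2 * complex_of_real pi * \<i>) *
     (LINT x:{-1..1}|lborel. complex_of_real (ln (\<rho> x)) / (?z - complex_of_real x) / w_plus x)
    = integral {0..pi} (\<lambda>t. w_fun ?z / (2 * complex_of_real pi * \<i>) * G (cos t))"
    by (simp add: integral_mult_right)
  have "w_fun ?z / (2 * complex_of_real pi * \<i>) * G (cos t) =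
      - (of_real (ln (\<rho> (cos t))) * ((1 - \<zeta>\<^sup>2) / (1 - 2 * \<zeta> * of_real (cos t) + \<zeta>\<^sup>2)) / (2 * pi))" for t
  proof -
    define D where "D = 1 - 2 * \<zeta> * of_real (cos t) + \<zeta>\<^sup>2"
    have D: "D \<noteq> 0" using joukowski_kernel_nonzero[OF \<zeta>(2)] by (simp add: D_def)
    have w: "w_fun ?z = (1 - \<zeta>\<^sup>2) / (2 * \<zeta>)"
      using \<zeta>(1) w_fun_joukowski[OF \<zeta>] by (simp add: field_simps power2_eq_square)
    show ?thesis
      unfolding G_def joukowski_minus_cos[OF \<zeta>(1)] D_def[symmetric] w
      using D \<zeta>(1) by (simp add: field_simps)
  qed
  then show ?thesis
    unfolding szego_def * outer_def by (simp only: integral_neg integral_divide)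
qed

lemma norm_outer_le:
  assumes F: "continuous_on {0..pi} F" "\<And>t. t \<in> {0..pi} \<Longrightarrow> \<bar>F t\<bar> \<le> M" and \<zeta>: "norm \<zeta> < 1"
  shows "norm (outer F \<zeta>) \<le> M / (1 - norm \<zeta>)\<^sup>2"
proof -
  have M: "M \<ge> 0" using F(2)[of 0] by auto
  have pos: "(1 - norm \<zeta>)\<^sup>2 > 0" using \<zeta> by simp
  have "norm (integral {0..pi} (\<lambda>t. of_real (F t) * ((1 - \<zeta>\<^sup>2) / (1 - 2 * \<zeta> * of_real (cos t) + \<zeta>\<^sup>2))))
      \<le> M * (2 / (1 - norm \<zeta>)\<^sup>2) * (pi - 0)"
  proof (rule integral_bound[OF _ continuous_on_outer_integrand[OF F(1) \<zeta>]])
    fix t :: real assume t: "t \<in> {0..pi}"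
    have "norm (1 - \<zeta>\<^sup>2) \<le> 2"
      using norm_triangle_ineq4[of 1 "\<zeta>\<^sup>2"] \<zeta> power_le_one[of "norm \<zeta>" 2] by (simp add: norm_power)
    then show "norm (of_real (F t) * ((1 - \<zeta>\<^sup>2) / (1 - 2 * \<zeta> * of_real (cos t) + \<zeta>\<^sup>2))) \<le> M * (2 / (1 - norm \<zeta>)\<^sup>2)"
      unfolding norm_mult norm_divide
      using F(2)[OF t] joukowski_kernel_norm_ge[of \<zeta> t] \<zeta> pos M
      by (intro mult_mono frac_le) auto
  qed auto
  moreover have n2: "norm (complex_of_real (2 * pi)) = 2 * pi" by (simp add: norm_mult)
  ultimately have "norm (outer F \<zeta>) \<le> M * (2 / (1 - norm \<zeta>)\<^sup>2) * pi / (2 * pi)"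
    unfolding outer_def norm_divide n2 by (intro divide_right_mono) auto
  also have "\<dots> = M / (1 - norm \<zeta>)\<^sup>2" by simp
  finally show ?thesis .
qed

lemma outer_diff:
  assumes "continuous_on {0..pi} F" "continuous_on {0..pi} G" "norm \<zeta> < 1"
  shows "outer (\<lambda>t. F t - G t) \<zeta> = outer F \<zeta> - outer G \<zeta>"
  unfolding outer_def diff_divide_distrib[symmetric]
  unfolding of_real_diff left_diff_distrib
  by (subst integral_diff) (use continuous_on_outer_integrand assms in \<open>auto intro!: integrable_continuous_real\<close>)

text \<open>The point \<zeta> = 0 stands for z = \<infinity>, so this gives the limit that defines
  \<open>SS_inf\<close>. The kernel equals 1 at 0, and what is left after subtracting 1 carries a
  factor \<zeta>.\<close>

lemma isCont_outer_0:
  assumes F: "continuous_on {0..pi} F"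
  shows "isCont (outer F) 0"
proof -
  have "bounded (F ` {0..pi})"
    by (intro compact_imp_bounded compact_continuous_image F) auto
  then obtain M where "\<forall>t\<in>{0..pi}. \<bar>F t\<bar> \<le> M"
    unfolding bounded_iff by auto
  then have M: "\<bar>F t\<bar> \<le> M" if "t \<in> {0..pi}" for t
    using that by blast
  have M0: "M \<ge> 0" using M[of 0] by auto
  have "norm (outer F \<zeta> - outer F 0) \<le> 8 * M * norm \<zeta>" if "norm \<zeta> < 1/2" for \<zeta>
  proof -
    let ?D = "\<lambda>t. 1 - 2 * \<zeta> * complex_of_real (cos t) + \<zeta>\<^sup>2"
    have lt: "norm \<zeta> < 1" using that by simp
    have c: "continuous_on {0..pi} (\<lambda>t. of_real (F t) * (2 * \<zeta> * (of_real (cos t) - \<zeta>) / ?D t))"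
      using joukowski_kernel_nonzero[OF lt] by (intro continuous_intros F) auto
    have "outer F \<zeta> - outer F 0 = integral {0..pi} (\<lambda>t. of_real (F t) * (2 * \<zeta> * (of_real (cos t) - \<zeta>) / ?D t)) / (2 * pi)"
      unfolding outer_def diff_divide_distrib[symmetric]
    proof (subst integral_diff[symmetric])
      have "(1 - \<zeta>\<^sup>2) / ?D t = 1 + 2 * \<zeta> * (of_real (cos t) - \<zeta>) / ?D t" for t
        using joukowski_kernel_nonzero[OF lt, of t] by (simp add: field_simps power2_eq_square)
      then show "integral {0..pi} (\<lambda>x. of_real (F x) * ((1 - \<zeta>\<^sup>2) / ?D x) -
          of_real (F x) * ((1 - 0\<^sup>2) / (1 - 2 * 0 * of_real (cos x) + 0\<^sup>2))) / (2 * pi) =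
          integral {0..pi} (\<lambda>t. of_real (F t) * (2 * \<zeta> * (of_real (cos t) - \<zeta>) / ?D t)) / (2 * pi)"
        by (simp add: algebra_simps)
    qed (use continuous_on_outer_integrand[OF F lt] continuous_on_outer_integrand[OF F, of 0]
          in \<open>auto intro!: integrable_continuous_real\<close>)
    moreover have "norm (integral {0..pi} (\<lambda>t. of_real (F t) * (2 * \<zeta> * (of_real (cos t) - \<zeta>) / ?D t)))
       \<le> M * (2 * norm \<zeta> * 2 / (1/4)) * (pi - 0)"
    proof (rule integral_bound[OF _ c])
      fix t :: real assume t: "t \<in> {0..pi}"
      have "(1/2)\<^sup>2 \<le> (1 - norm \<zeta>)\<^sup>2" using that by (intro power_mono) auto
      then have D: "1/4 \<le> norm (?D t)"
        using joukowski_kernel_norm_ge[of \<zeta> t] lt by (simp add: power2_eq_square)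
      have "norm (of_real (cos t) - \<zeta>) \<le> 2"
        using norm_triangle_ineq4[of "of_real (cos t)" \<zeta>] abs_cos_le_one[of t] lt
        unfolding norm_of_real by linarith
      then show "norm (of_real (F t) * (2 * \<zeta> * (of_real (cos t) - \<zeta>) / ?D t)) \<le> M * (2 * norm \<zeta> * 2 / (1/4))"
        unfolding norm_mult norm_divide using M[OF t] D M0
        by (intro mult_mono frac_le) auto
    qed auto
    moreover have "norm (complex_of_real (2 * pi)) = 2 * pi" by (simp add: norm_mult)
    ultimately have "norm (outer F \<zeta> - outer F 0) \<le> M * (2 * norm \<zeta> * 2 / (1/4)) * (pi - 0) / (2 * pi)"
      by (simp only: norm_divide) (intro divide_right_mono, auto)
    also have "\<dots> = 8 * M * norm \<zeta>" by simp
    finally have "norm (outer F \<zeta> - outer F 0) \<le> 8 * M * norm \<zeta>" .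
    then show ?thesis by simp
  qed
  note bound = this
  have "((\<lambda>\<zeta>::complex. 8 * M * norm \<zeta>) \<longlongrightarrow> 8 * M * norm (0::complex)) (at 0)"
    by (intro tendsto_intros)
  moreover have "\<forall>\<^sub>F \<zeta>::complex in at 0. norm \<zeta> < 1/2"
    unfolding eventually_at by (intro exI[of _ "1/2"]) (auto simp: dist_norm)
  then have "\<forall>\<^sub>F \<zeta> in at 0. norm (outer F \<zeta> - outer F 0) \<le> 8 * M * norm \<zeta>"
    by (rule eventually_mono) (rule bound)
  ultimately have "((\<lambda>\<zeta>. outer F \<zeta> - outer F 0) \<longlongrightarrow> 0) (at 0)"
    using Lim_null_comparison[of "\<lambda>\<zeta>. outer F \<zeta> - outer F 0" "\<lambda>\<zeta>. 8 * M * norm \<zeta>"] by simp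
  then show ?thesis
    unfolding isCont_def by (rule LIM_zero_cancel)
qed

text \<open>The denominator of the Szego factor in the variable \<zeta>: entire, without zeros in
  the open disc, and on the circle of modulus proportional to the square root of
  \<bar>v_i\<bar>.\<close>

definition szego_den :: "nat \<Rightarrow> complex \<Rightarrow> complex" where
  "szego_den i \<zeta> = (if i = 1 then 2 else if i = 2 then 1 - \<zeta>\<^sup>2 else if i = 3 then 1 + \<zeta> else 1 - \<zeta>)"

text \<open>The value sqrt 2 for kinds 3 and 4 arises because \<phi> / (z + 1) and \<phi> / (z - 1)
  become 2 over the square of \<open>szego_den\<close>.\<close>

definition wscale :: "nat \<Rightarrow> real" where
  "wscale i = (if i = 1 \<or> i = 2 then 1 else sqrt 2)"

lemma wscale_bounds: "1 \<le> wscale i" "wscale i \<le> 2" "(wscale i)\<^sup>2 \<le> 2"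
  by (auto simp: wscale_def real_le_lsqrt)

lemma szego_den_nonzero:
  assumes "norm \<zeta> < 1" shows "szego_den i \<zeta> \<noteq> 0"
proof -
  have "norm (\<zeta>\<^sup>2) < 1"
    using assms by (simp add: norm_power power_less_one_iff)
  then have "\<zeta>\<^sup>2 \<noteq> 1" by auto
  moreover have "\<zeta> \<noteq> 1" "\<zeta> \<noteq> -1" using assms by auto
  ultimately show ?thesis
    by (auto simp: szego_den_def add_eq_0_iff)
qed

lemma Re_pos_divide:
  assumes "0 < Re w" "0 < r" shows "0 < Re (complex_of_real r / w)"
proof -
  have "w \<noteq> 0" using assms by auto
  then have "(Re w)\<^sup>2 + (Im w)\<^sup>2 > 0" by (simp add: sum_power2_gt_zero_iff complex_eq_iff)
  then show ?thesis using assms by (simp add: Re_divide)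
qed

text \<open>For kinds 3 and 4 the radicand is a perfect square in \<zeta>; the principal root is the
  one with 1 + \<zeta> or 1 - \<zeta> in the denominator, since both have positive real part in the
  disc.\<close>

lemma szego_factor_joukowski:
  assumes "i \<in> {1,2,3,4}" "\<zeta> \<noteq> 0" "norm \<zeta> < 1"
  shows "szego_factor i (joukowski \<zeta>) = 2 / (wscale i * szego_den i \<zeta>)"
proof -
  have nz: "szego_den i \<zeta> \<noteq> 0" by (rule szego_den_nonzero[OF assms(3)])
  have r: "\<bar>Re \<zeta>\<bar> < 1" using assms(3) abs_Re_le_cmod[of \<zeta>] by linarith
  have s2: "complex_of_real (sqrt 2) * complex_of_real (sqrt 2) = 2"
    by (simp flip: of_real_mult)
  consider "i = 1" | "i = 2" | "i = 3" | "i = 4" using assms(1) by auto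
  then show ?thesis
  proof cases
    case 1 then show ?thesis by (simp add: szego_factor_def wscale_def szego_den_def)
  next
    case 2
    then have "1 - \<zeta>\<^sup>2 \<noteq> 0" using nz by (simp add: szego_den_def)
    then show ?thesis using assms(2) 2
      by (simp add: szego_factor_def wscale_def szego_den_def phi_joukowski[OF assms(2,3)]
          w_fun_joukowski[OF assms(2,3)] field_simps power2_eq_square)
  next
    case 3
    then have n: "1 + \<zeta> \<noteq> 0" using nz by (simp add: szego_den_def)
    have "joukowski \<zeta> + 1 = (1 + \<zeta>)\<^sup>2 / (2 * \<zeta>)"
      using assms(2) by (simp add: joukowski_def field_simps power2_eq_square)
    then have "phi (joukowski \<zeta>) / (joukowski \<zeta> + 1) = 2 / (1 + \<zeta>)\<^sup>2"
      using assms(2) n by (simp add: phi_joukowski[OF assms(2,3)])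
    moreover have "csqrt (2 / (1 + \<zeta>)\<^sup>2) = of_real (sqrt 2) / (1 + \<zeta>)"
      by (rule csqrt_unique) (use r s2 Re_pos_divide[of "1 + \<zeta>" "sqrt 2"] in \<open>auto simp: power_divide power2_eq_square\<close>)
    ultimately have "szego_factor i (joukowski \<zeta>) = of_real (sqrt 2) / (1 + \<zeta>)"
      using 3 by (simp add: szego_factor_def)
    also have "\<dots> = 2 / (of_real (sqrt 2) * (1 + \<zeta>))"
      using n s2 by (simp add: divide_simps)
    finally show ?thesis using 3 by (simp add: wscale_def szego_den_def)
  next
    case 4
    then have n: "1 - \<zeta> \<noteq> 0" using nz by (simp add: szego_den_def)
    have "joukowski \<zeta> - 1 = (1 - \<zeta>)\<^sup>2 / (2 * \<zeta>)"
      using assms(2) by (simp add: joukowski_def field_simps power2_eq_square)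
    then have "phi (joukowski \<zeta>) / (joukowski \<zeta> - 1) = 2 / (1 - \<zeta>)\<^sup>2"
      using assms(2) n by (simp add: phi_joukowski[OF assms(2,3)])
    moreover have "csqrt (2 / (1 - \<zeta>)\<^sup>2) = of_real (sqrt 2) / (1 - \<zeta>)"
      by (rule csqrt_unique) (use r s2 Re_pos_divide[of "1 - \<zeta>" "sqrt 2"] in \<open>auto simp: power_divide power2_eq_square\<close>)
    ultimately have "szego_factor i (joukowski \<zeta>) = of_real (sqrt 2) / (1 - \<zeta>)"
      using 4 by (simp add: szego_factor_def)
    also have "\<dots> = 2 / (of_real (sqrt 2) * (1 - \<zeta>))"
      using n s2 by (simp add: divide_simps)
    finally show ?thesis using 4 by (simp add: wscale_def szego_den_def)
  qed
qed

lemma SS_joukowski: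
  assumes "continuous_on {-1..1} \<rho>" "\<And>x. x \<in> {-1..1} \<Longrightarrow> \<rho> x > 0"
    and "i \<in> {1,2,3,4}" "\<zeta> \<noteq> 0" "norm \<zeta> < 1"
  shows "SS \<rho> i (joukowski \<zeta>) = 2 / (wscale i * szego_den i \<zeta>) * exp (- outer (\<lambda>t. ln (\<rho> (cos t))) \<zeta>)"
proof -
  have "szego \<rho> (joukowski \<zeta>) = exp (- outer (\<lambda>t. ln (\<rho> (cos t))) \<zeta>)"
    by (rule szego_joukowski) fact+
  then show ?thesis
    unfolding SS_def szego_factor_joukowski[OF assms(3-5)] by (rule arg_cong)
qed

lemma inverse_phi_tendsto_0: "((\<lambda>z. 1 / phi z) \<longlongrightarrow> 0) at_infinity"
proof (rule Lim_null_comparison[where g = "\<lambda>z. inverse (norm z)"])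
  have "norm (1 / phi z) \<le> inverse (norm z)" if "norm z \<ge> 2" for z
  proof -
    have "z \<notin> slit" using that by auto
    then obtain \<zeta> where \<zeta>: "\<zeta> \<noteq> 0" "norm \<zeta> < 1" "z = joukowski \<zeta>" by (rule joukowski_surj)
    \<comment> \<open>This gives \<bar>z\<bar> \<bar>\<zeta>\<bar> \<le> 1, so 1/\<phi> decays at
      least like 1/\<bar>z\<bar>.\<close>
    have "z * \<zeta> = (1 + \<zeta>\<^sup>2) / 2" using \<zeta>(1) by (simp add: \<zeta>(3) joukowski_def field_simps power2_eq_square)
    then have "norm z * norm \<zeta> = norm (1 + \<zeta>\<^sup>2) / 2" by (metis norm_mult norm_divide norm_numeral)
    moreover have "norm (1 + \<zeta>\<^sup>2) \<le> 2"
      using norm_triangle_ineq[of 1 "\<zeta>\<^sup>2"] \<zeta>(2) power_le_one[of "norm \<zeta>" 2] by (simp add: norm_power)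
    ultimately have "norm z * norm \<zeta> \<le> 1" by simp
    then have "norm \<zeta> \<le> inverse (norm z)"
      using that by (subst inverse_eq_divide, subst pos_le_divide_eq) (auto simp: mult.commute)
    then show ?thesis using \<zeta> by (simp add: phi_joukowski)
  qed
  then show "\<forall>\<^sub>F z in at_infinity. norm (1 / phi z) \<le> inverse (norm z)"
    unfolding eventually_at_infinity by blast
  show "((\<lambda>z::complex. inverse (norm z)) \<longlongrightarrow> 0) at_infinity"
    using tendsto_norm[OF tendsto_inverse_0[where 'a = complex]] by (simp add: norm_inverse)
qed

text \<open>In the variable \<zeta> = 1/\<phi>(z) the product extends continuously to \<zeta> = 0,
  so the limit at infinity exists and is the value there.\<close>

lemma SS_inf_eq:
  assumes \<rho>: "continuous_on {-1..1} \<rho>" "\<And>x. x \<in> {-1..1} \<Longrightarrow> \<rho> x > 0"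
    and i: "i \<in> {1,2,3,4}"
  shows "SS_inf \<rho> i = 2 / (wscale i * szego_den i 0) * exp (- outer (\<lambda>t. ln (\<rho> (cos t))) 0)"
proof -
  let ?F = "\<lambda>t. ln (\<rho> (cos t))"
  define g where "g = (\<lambda>\<zeta>. 2 / (wscale i * szego_den i \<zeta>) * exp (- outer ?F \<zeta>))"
  have "continuous_on {-1..1} (\<lambda>x. ln (\<rho> x))"
    using \<rho> by (intro continuous_intros) (auto simp: less_imp_neq[symmetric])
  then have F: "continuous_on {0..pi} ?F"
    by (rule continuous_on_comp_cos)
  have d0: "szego_den i 0 \<noteq> 0" by (rule szego_den_nonzero) simp
  have w0: "wscale i \<noteq> 0" using wscale_bounds(1)[of i] by simp
  have "isCont (szego_den i) 0"
    unfolding szego_den_def[abs_def] using i by (auto intro!: continuous_intros)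
  then have "isCont g 0"
    unfolding g_def using isCont_outer_0[OF F] d0 w0 by (intro continuous_intros) auto
  then have "((\<lambda>z. g (1 / phi z)) \<longlongrightarrow> g 0) at_infinity"
    by (rule isCont_tendsto_compose[OF _ inverse_phi_tendsto_0])
  moreover have "\<forall>\<^sub>F z in at_infinity. g (1 / phi z) = SS \<rho> i z"
  proof -
    have "g (1 / phi z) = SS \<rho> i z" if "norm z \<ge> 2" for z
    proof -
      have "z \<notin> slit" using that by auto
      then obtain \<zeta> where \<zeta>: "\<zeta> \<noteq> 0" "norm \<zeta> < 1" "z = joukowski \<zeta>" by (rule joukowski_surj)
      have "SS \<rho> i (joukowski \<zeta>) = g \<zeta>"
        unfolding g_def by (rule SS_joukowski) (use \<rho> i \<zeta> in auto)
      then show ?thesis by (simp add: \<zeta> phi_joukowski)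
    qed
    then show ?thesis unfolding eventually_at_infinity by blast
  qed
  ultimately have "(SS \<rho> i \<longlongrightarrow> g 0) at_infinity"
    by (rule Lim_transform_eventually)
  then show ?thesis
    unfolding SS_inf_def g_def by (intro tendsto_Lim trivial_limit_at_infinity)
qed

text \<open>Move \<zeta> radially to the point u of the circle. Its image lies in the slit, and the
  image of \<zeta> is within (1/s - s)/2 of it, where s = \<bar>\<zeta>\<bar>; a positive distance
  from the compact slit thus keeps s away from 1. \<open>K\<close> may be unbounded.\<close>

lemma joukowski_separated:
  assumes "closed K" "K \<inter> slit = {}"
  obtains r where "0 < r" "r < 1" "\<And>\<zeta>. \<zeta> \<noteq> 0 \<Longrightarrow> norm \<zeta> < 1 \<Longrightarrow> joukowski \<zeta> \<in> K \<Longrightarrow> norm \<zeta> \<le> r"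
proof -
  have "compact slit"
    by (intro compact_continuous_image) (auto intro: continuous_intros)
  then obtain d where d: "d > 0" "\<And>x y. x \<in> slit \<Longrightarrow> y \<in> K \<Longrightarrow> d \<le> dist x y"
    using separate_compact_closed[of slit K] assms by (metis Int_commute)
  \<comment> \<open>For s > 1/2 the inequality d \<le> (1/s - s)/2 \<le> 2 (1 - s) yields s \<le> 1
    - d/2; the value 1/2 covers the other s.\<close>
  define r where "r = max (1/2) (1 - d / 2)"
  show ?thesis
  proof
    show "0 < r" "r < 1" using d(1) by (auto simp: r_def)
    fix \<zeta> assume \<zeta>: "\<zeta> \<noteq> 0" "norm \<zeta> < 1" "joukowski \<zeta> \<in> K"
    define s where "s = norm \<zeta>"
    have s: "0 < s" "s < 1" using \<zeta> by (auto simp: s_def)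
    define u where "u = cis (Arg \<zeta>)"
    have \<zeta>u: "\<zeta> = of_real s * u" using rcis_cmod_Arg[of \<zeta>] by (simp add: rcis_def s_def u_def)
    have u: "norm u = 1" "u \<noteq> 0" by (auto simp: u_def)
    have "joukowski \<zeta> - joukowski u = (of_real (s - 1) * u + of_real (1 / s - 1) * (1 / u)) / 2"
      using s u by (simp add: \<zeta>u joukowski_def field_simps)
    then have "norm (joukowski \<zeta> - joukowski u) = norm (of_real (s - 1) * u + of_real (1 / s - 1) * (1 / u)) / 2"
      by (simp only: norm_divide norm_numeral)
    also have "\<dots> \<le> (norm (of_real (s - 1) * u) + norm (of_real (1 / s - 1) * (1 / u))) / 2"
      by (intro divide_right_mono norm_triangle_ineq) simp
    also have "\<dots> = ((1 - s) + (1 / s - 1)) / 2"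
      using s by (simp add: norm_mult norm_divide u(1) del: of_real_diff of_real_divide)
    finally have 1: "norm (joukowski \<zeta> - joukowski u) \<le> (1 / s - s) / 2" by simp
    have "joukowski u \<in> slit" by (auto simp: u_def joukowski_cis)
    from d(2)[OF this \<zeta>(3)] 1 have 2: "d \<le> (1 / s - s) / 2" by (simp add: dist_norm norm_minus_commute)
    show "norm \<zeta> \<le> r"
    proof (cases "s \<le> 1/2")
      case False
      then have "(1 / s - s) / 2 \<le> 2 * (1 - s)"
      proof -
        have "1 - s\<^sup>2 \<le> 4 * s * (1 - s)"
          using s False mult_left_mono[of "1 + s" "4 * s" "1 - s"] by (simp add: algebra_simps power2_eq_square)
        then show ?thesis using s by (simp add: field_simps power2_eq_square)
      qed
      then show ?thesis using 2 by (simp add: r_def s_def[symmetric])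
    qed (simp add: r_def s_def)
  qed
qed

text \<open>For the discontinuous integrands that occur when a principal value integral is
  truncated.\<close>

lemma arcsine_substitution_measurable:
  fixes G :: "real \<Rightarrow> real"
  assumes "G \<in> borel_measurable borel" "\<And>x. x \<in> {-1..1} \<Longrightarrow> \<bar>G x\<bar> \<le> M"
  shows "(LINT x:{-1..1}|lborel. G x / sqrt (1 - x\<^sup>2)) = integral {0..pi} (\<lambda>t. G (cos t))"
    and "(\<lambda>t. G (cos t)) integrable_on {0..pi}"
proof -
  have m: "set_borel_measurable borel {-1..1} G"
    using assms(1) by (simp add: set_borel_measurable_def)
  have M: "norm (G x) \<le> M" if "x \<in> {-1..1}" for x using assms(2)[OF that] by simp
  note * = arcsine_substitution[OF m M]
  show "(LINT x:{-1..1}|lborel. G x / sqrt (1 - x\<^sup>2)) = integral {0..pi} (\<lambda>t. G (cos t))"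
    using *(2) set_borel_integral_eq_integral(2)[OF *(3)] by (simp add: divide_inverse mult.commute)
  show "(\<lambda>t. G (cos t)) integrable_on {0..pi}"
    by (rule set_borel_integral_eq_integral(1)[OF *(3)])
qed

subsection \<open>The phase as a conjugate function\<close>

text \<open>The principal value of \<open>\<integral> d\<tau> / (cos \<tau> - cos t)\<close> over \<open>[0, \<pi>]\<close> vanishes; the exact value of the
  truncated integral follows from an explicit primitive.\<close>

lemma truncated_kernel_integral:
  assumes t: "0 < t" "t < pi" and d: "0 < d" "cos t + d \<le> 1" "-1 \<le> cos t - d"
  shows "((\<lambda>\<tau>. if \<bar>cos \<tau> - cos t\<bar> < d then 0 else 1 / (cos \<tau> - cos t)) has_integral
      (2 * ln (sin ((t + arccos (cos t + d)) / 2)) - 2 * ln (sin ((t + arccos (cos t - d)) / 2))) / sin t) {0..pi}"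
proof -
  let ?k = "\<lambda>\<tau>. if \<bar>cos \<tau> - cos t\<bar> < d then 0 else 1 / (cos \<tau> - cos t)"
  define a where "a = arccos (cos t + d)"
  define b where "b = arccos (cos t - d)"
  have c1: "-1 \<le> cos t" "cos t \<le> 1" by auto
  have ca: "cos a = cos t + d" and cb: "cos b = cos t - d"
    unfolding a_def b_def using d c1 by (intro cos_arccos; linarith)+
  have a: "0 \<le> a" "a \<le> pi" and b: "0 \<le> b" "b \<le> pi"
    unfolding a_def b_def using d c1 by (intro arccos_lbound arccos_ubound; linarith)+
  have at: "a < t"
  proof (rule ccontr)
    assume "\<not> a < t"
    then have "cos a \<le> cos t" using a t by (intro cos_monotone_0_pi_le) auto
    then show False using ca d(1) by simp
  qed
  have tb: "t < b"
  proof (rule ccontr)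
    assume "\<not> t < b"
    then have "cos t \<le> cos b" using b t by (intro cos_monotone_0_pi_le) auto
    then show False using cb d(1) by simp
  qed
  have st: "sin t > 0" using t by (rule sin_gt_zero)
  have der: "(1/2 * cos ((t + \<tau>) / 2) / sin ((t + \<tau>) / 2) + 1/2 * cos ((t - \<tau>) / 2) / sin ((t - \<tau>) / 2)) / sin t
      = 1 / (cos \<tau> - cos t)" if "sin ((t + \<tau>) / 2) \<noteq> 0" "sin ((t - \<tau>) / 2) \<noteq> 0" for \<tau>
  proof -
    let ?u = "(t + \<tau>) / 2" and ?v = "(t - \<tau>) / 2"
    have "sin t = sin (?u + ?v)" by (simp add: field_simps)
    then have s: "sin t = sin ?u * cos ?v + cos ?u * sin ?v" by (simp add: sin_add)
    have c: "cos \<tau> - cos t = 2 * sin ?u * sin ?v" using cos_diff_cos[of \<tau> t] by (simp add: add.commute)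
    have "1/2 * cos ?u / sin ?u + 1/2 * cos ?v / sin ?v = sin t / (2 * sin ?u * sin ?v)"
      unfolding s using that by (simp add: field_simps)
    then show ?thesis unfolding c using st by simp
  qed
  define \<Psi>1 where "\<Psi>1 = (\<lambda>\<tau>. (ln (sin ((t + \<tau>) / 2)) - ln (sin ((t - \<tau>) / 2))) / sin t)"
  define \<Psi>2 where "\<Psi>2 = (\<lambda>\<tau>. (ln (sin ((t + \<tau>) / 2)) - ln (sin ((\<tau> - t) / 2))) / sin t)"
  have "((\<lambda>\<tau>. 1 / (cos \<tau> - cos t)) has_integral (\<Psi>1 a - \<Psi>1 0)) {0..a}"
  proof (rule fundamental_theorem_of_calculus[OF a(1)])
    fix \<tau> assume \<tau>: "\<tau> \<in> {0..a}"
    have p: "0 < sin ((t + \<tau>) / 2)" "0 < sin ((t - \<tau>) / 2)"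
      using \<tau> at t by (intro sin_gt_zero; force)+
    have "(\<Psi>1 has_real_derivative (1/2 * cos ((t + \<tau>) / 2) / sin ((t + \<tau>) / 2) + 1/2 * cos ((t - \<tau>) / 2) / sin ((t - \<tau>) / 2)) / sin t) (at \<tau>)"
      unfolding \<Psi>1_def using p st by (auto intro!: derivative_eq_intros simp: field_simps)
    then show "(\<Psi>1 has_vector_derivative 1 / (cos \<tau> - cos t)) (at \<tau> within {0..a})"
      using der[of \<tau>] p by (simp add: has_real_derivative_iff_has_vector_derivative has_vector_derivative_at_within)
  qed
  then have 1: "(?k has_integral (\<Psi>1 a - \<Psi>1 0)) {0..a}"
  proof (rule has_integral_eq[rotated])
    fix \<tau> assume "\<tau> \<in> {0..a}"
    then have "cos a \<le> cos \<tau>" using a by (intro cos_monotone_0_pi_le) auto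
    then show "1 / (cos \<tau> - cos t) = ?k \<tau>" using ca by auto
  qed
  have "((\<lambda>\<tau>. 1 / (cos \<tau> - cos t)) has_integral (\<Psi>2 pi - \<Psi>2 b)) {b..pi}"
  proof (rule fundamental_theorem_of_calculus[OF b(2)])
    fix \<tau> assume \<tau>: "\<tau> \<in> {b..pi}"
    have p: "0 < sin ((t + \<tau>) / 2)" "0 < sin ((\<tau> - t) / 2)"
      using \<tau> tb t by (intro sin_gt_zero; force)+
    have m: "sin ((t - \<tau>) / 2) = - sin ((\<tau> - t) / 2)" "cos ((t - \<tau>) / 2) = cos ((\<tau> - t) / 2)"
      using sin_minus[of "(\<tau> - t) / 2"] cos_minus[of "(\<tau> - t) / 2"] by (simp_all add: minus_divide_left)
    have "(\<Psi>2 has_real_derivative (1/2 * cos ((t + \<tau>) / 2) / sin ((t + \<tau>) / 2) + 1/2 * cos ((t - \<tau>) / 2) / sin ((t - \<tau>) / 2)) / sin t) (at \<tau>)"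
      unfolding \<Psi>2_def m using p st by (auto intro!: derivative_eq_intros simp: field_simps)
    then show "(\<Psi>2 has_vector_derivative 1 / (cos \<tau> - cos t)) (at \<tau> within {b..pi})"
      using der[of \<tau>] p m by (simp add: has_real_derivative_iff_has_vector_derivative has_vector_derivative_at_within)
  qed
  then have 2: "(?k has_integral (\<Psi>2 pi - \<Psi>2 b)) {b..pi}"
  proof (rule has_integral_eq[rotated])
    fix \<tau> assume "\<tau> \<in> {b..pi}"
    then have "cos \<tau> \<le> cos b" using b by (intro cos_monotone_0_pi_le) auto
    then show "1 / (cos \<tau> - cos t) = ?k \<tau>" using cb by auto
  qed
  \<comment> \<open>Here the kernel is cut off except at the two endpoints, where its argument is
    exactly at distance d.\<close>
  have 3: "(?k has_integral 0) {a..b}"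
  proof (rule has_integral_spike_finite[of "{a, b}" _ ?k "\<lambda>_. 0"])
    fix \<tau> assume "\<tau> \<in> {a..b} - {a, b}"
    then have "cos \<tau> < cos a" "cos b < cos \<tau>" using a b by (auto intro!: cos_monotone_0_pi)
    then show "?k \<tau> = 0" using ca cb by auto
  qed auto
  have "(?k has_integral (\<Psi>1 a - \<Psi>1 0 + 0 + (\<Psi>2 pi - \<Psi>2 b))) {0..pi}"
    by (rule has_integral_combine[OF _ _ has_integral_combine[OF _ _ 1 3] 2]) (use a b at tb in auto)
  moreover have "\<Psi>1 a - \<Psi>1 0 + 0 + (\<Psi>2 pi - \<Psi>2 b) = (2 * ln (sin ((t + a) / 2)) - 2 * ln (sin ((t + b) / 2))) / sin t"
  proof -
    have p1: "0 < sin ((t + a) / 2)" "0 < sin ((t - a) / 2)"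
      using at t a by (intro sin_gt_zero; force)+
    have p2: "0 < sin ((t + b) / 2)" "0 < sin ((b - t) / 2)"
      using tb t b by (intro sin_gt_zero; force)+
    \<comment> \<open>The product of the two sines is d/2 on the left and, further down, also on the
      right of the window, so the divergent terms ln (d/2) cancel between the two sides.\<close>
    have "sin ((t + a) / 2) * sin ((t - a) / 2) = d / 2"
      using cos_diff_cos[of a t] ca by (simp add: add.commute)
    then have e1: "ln (sin ((t - a) / 2)) = ln (d / 2) - ln (sin ((t + a) / 2))"
      using p1 by (metis add_diff_cancel_left' ln_mult_pos)
    have "sin ((t + b) / 2) * sin ((b - t) / 2) = d / 2"
      using cos_diff_cos[of t b] cb by (simp add: add.commute)
    then have e2: "ln (sin ((b - t) / 2)) = ln (d / 2) - ln (sin ((t + b) / 2))"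
      using p2 by (metis add_diff_cancel_left' ln_mult_pos)
    have "(t + pi) / 2 = pi - (pi - t) / 2" by (simp add: field_simps)
    then have e3: "sin ((t + pi) / 2) = sin ((pi - t) / 2)" by (metis sin_pi_minus)
    show ?thesis
      unfolding \<Psi>1_def \<Psi>2_def e1 e2 e3 by (simp add: diff_divide_distrib add_divide_distrib)
  qed
  ultimately show ?thesis by (simp add: a_def b_def)
qed

text \<open>Because the principal value of the bare kernel vanishes, F t may be subtracted. The
  integrand is then bounded when F is a Lipschitz function of cos \<tau>, and no principal value is
  needed.\<close>

definition conj_fun :: "(real \<Rightarrow> real) \<Rightarrow> real \<Rightarrow> real" where
  "conj_fun F t = sin t / (2 * pi) * integral {0..pi} (\<lambda>\<tau>. (F \<tau> - F t) / (cos \<tau> - cos t))"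

context
  fixes g :: "real \<Rightarrow> real" and L :: real
  assumes lip: "\<And>x y. x \<in> {-1..1} \<Longrightarrow> y \<in> {-1..1} \<Longrightarrow> \<bar>g x - g y\<bar> \<le> L * \<bar>x - y\<bar>"
begin

private lemma cont: "continuous_on {-1..1} g"
proof -
  have "\<bar>L\<bar>-lipschitz_on {-1..1} g"
  proof (rule lipschitz_onI)
    fix x y :: real assume "x \<in> {-1..1}" "y \<in> {-1..1}"
    then have "\<bar>g x - g y\<bar> \<le> L * \<bar>x - y\<bar>" by (rule lip)
    also have "\<dots> \<le> \<bar>L\<bar> * \<bar>x - y\<bar>" by (intro mult_right_mono) auto
    finally show "dist (g x) (g y) \<le> \<bar>L\<bar> * dist x y" by (simp add: dist_real_def)
  qed simp
  then show ?thesis by (rule lipschitz_on_continuous_on)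
qed

private lemma L_nonneg: "L \<ge> 0"
  using lip[of 0 1] by auto

lemma difference_quotient_bound:
  assumes "x \<in> {-1..1}" "y \<in> {-1..1}" shows "\<bar>(g y - g x) / (y - x)\<bar> \<le> L"
  using lip[OF assms(2,1)] L_nonneg by (cases "x = y") (auto simp: abs_divide divide_simps)

text \<open>The bounded factor \<open>P\<close> allows a truncation of the quotient near x.
  Integrability holds because the quotient is bounded by L and measurable; it is not continuous in
  general.\<close>

lemma difference_quotient_integrable:
  assumes P: "P \<in> borel_measurable borel" "\<And>x. \<bar>P x\<bar> \<le> (1::real)" and x: "x \<in> {-1..1}"
  shows "(\<lambda>\<tau>. P (cos \<tau>) * ((g (cos \<tau>) - g x) / (cos \<tau> - x))) integrable_on {0..pi}"
proof -
  define g' where "g' = (\<lambda>y. indicat_real {-1..1} y *\<^sub>R g y)"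
  have [measurable]: "g' \<in> borel_measurable borel"
    unfolding g'_def by (rule borel_measurable_continuous_on_indicator[OF _ cont]) simp
  note P(1)[measurable]
  have "\<bar>P y * ((g' y - g x) / (y - x))\<bar> \<le> L" if "y \<in> {-1..1}" for y
    using mult_mono[OF P(2)[of y] difference_quotient_bound[OF x that]] that
    by (simp add: abs_mult g'_def)
  then have "(\<lambda>\<tau>. P (cos \<tau>) * ((g' (cos \<tau>) - g x) / (cos \<tau> - x))) integrable_on {0..pi}"
    by (intro arcsine_substitution_measurable(2)[where G = "\<lambda>y. P y * ((g' y - g x) / (y - x))"]) auto
  then show ?thesis
    by (simp add: g'_def)
qed

lemma norm_difference_quotient_integral:
  assumes x: "x \<in> {-1..1}"
  shows "\<bar>integral {0..pi} (\<lambda>\<tau>. (g (cos \<tau>) - g x) / (cos \<tau> - x))\<bar> \<le> L * pi"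
proof -
  have "(\<lambda>\<tau>. (g (cos \<tau>) - g x) / (cos \<tau> - x)) integrable_on {0..pi}"
    using difference_quotient_integrable[OF _ _ x, of "\<lambda>_. 1"] by simp
  then have "norm (integral {0..pi} (\<lambda>\<tau>. (g (cos \<tau>) - g x) / (cos \<tau> - x))) \<le> integral {0..pi} (\<lambda>_. L)"
    using difference_quotient_bound[OF x] by (intro integral_norm_bound_integral) auto
  then show ?thesis by (simp add: mult.commute)
qed

text \<open>The truncated integral is the full difference quotient, minus its part inside the
  window, plus g(x) times the truncated kernel. The part inside tends to 0 by dominated convergence
  with bound L, and the kernel part by continuity of its closed form.\<close>

lemma pv_integral_eq:
  assumes t: "0 < t" "t < pi"
  shows "pv_integral (\<lambda>y. g y / (y - cos t) / sqrt (1 - y\<^sup>2)) (cos t)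
    = integral {0..pi} (\<lambda>\<tau>. (g (cos \<tau>) - g (cos t)) / (cos \<tau> - cos t))"
proof -
  let ?x = "cos t"
  let ?q = "\<lambda>\<tau>. (g (cos \<tau>) - g ?x) / (cos \<tau> - ?x)"
  let ?k = "\<lambda>d \<tau>. if \<bar>cos \<tau> - ?x\<bar> < d then 0 else 1 / (cos \<tau> - ?x)"
  let ?r = "\<lambda>d \<tau>. if \<bar>cos \<tau> - ?x\<bar> < d then ?q \<tau> else 0"
  let ?V = "\<lambda>d. (2 * ln (sin ((t + arccos (cos t + d)) / 2)) - 2 * ln (sin ((t + arccos (cos t - d)) / 2))) / sin t"
  have x: "?x \<in> {-1..1}" by simp
  have xs: "-1 < ?x" "?x < 1" using t cos_monotone_0_pi[of 0 t] cos_monotone_0_pi[of t pi] by auto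
  have cb: "bounded (g ` {-1..1})"
    by (intro compact_imp_bounded compact_continuous_image cont) auto
  then obtain M where "\<forall>y\<in>{-1..1}. \<bar>g y\<bar> \<le> M" unfolding bounded_iff by auto
  then have M: "\<bar>g y\<bar> \<le> M" if "y \<in> {-1..1}" for y using that by blast
  have M0: "M \<ge> 0" using M[of 0] by auto
  define g' where "g' = (\<lambda>y. indicat_real {-1..1} y *\<^sub>R g y)"
  have [measurable]: "g' \<in> borel_measurable borel"
    unfolding g'_def by (rule borel_measurable_continuous_on_indicator[OF _ cont]) simp
  have r_int: "?r d integrable_on {0..pi}" for d
  proof -
    have "(\<lambda>\<tau>. (if \<bar>cos \<tau> - ?x\<bar> < d then 1 else 0) * ?q \<tau>) integrable_on {0..pi}"
      by (rule difference_quotient_integrable[of "\<lambda>y. if \<bar>y - ?x\<bar> < d then 1 else 0"]) (use x in auto)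
    then show ?thesis by (rule integrable_eq) auto
  qed
  have q_int: "?q integrable_on {0..pi}"
    using difference_quotient_integrable[OF _ _ x, of "\<lambda>_. 1"] by simp
  \<comment> \<open>The restriction on d keeps the window inside the interval, as the closed form of
    the truncated kernel requires.\<close>
  have trunc: "(LINT y:{-1..1} - {?x - d<..<?x + d}|lborel. g y / (y - ?x) / sqrt (1 - y\<^sup>2))
     = integral {0..pi} ?q - integral {0..pi} (?r d) + g ?x * ?V d"
    if d: "0 < d" "d < min (1 - ?x) (1 + ?x)" for d
  proof -
    define G where "G = (\<lambda>y. if \<bar>y - ?x\<bar> < d then 0 else g' y / (y - ?x))"
    have [measurable]: "G \<in> borel_measurable borel" unfolding G_def by measurable
    have Gb: "\<bar>G y\<bar> \<le> M / d" if "y \<in> {-1..1}" for y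
      using M[OF that] d M0 that by (auto simp: G_def g'_def abs_divide intro!: frac_le)
    have "indicat_real ({-1..1} - {?x - d<..<?x + d}) y *\<^sub>R (g y / (y - ?x) / sqrt (1 - y\<^sup>2))
       = indicat_real {-1..1} y *\<^sub>R (G y / sqrt (1 - y\<^sup>2))" for y
      by (auto simp: G_def g'_def indicator_def)
    then have "(LINT y:{-1..1} - {?x - d<..<?x + d}|lborel. g y / (y - ?x) / sqrt (1 - y\<^sup>2))
       = (LINT y:{-1..1}|lborel. G y / sqrt (1 - y\<^sup>2))"
      unfolding set_lebesgue_integral_def by simp
    also have "\<dots> = integral {0..pi} (\<lambda>\<tau>. G (cos \<tau>))"
      by (rule arcsine_substitution_measurable(1)[OF _ Gb]) auto
    also have "\<dots> = integral {0..pi} (\<lambda>\<tau>. ?q \<tau> - ?r d \<tau> + g ?x * ?k d \<tau>)"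
      by (intro Henstock_Kurzweil_Integration.integral_cong) (auto simp: G_def g'_def diff_divide_distrib)
    also have "\<dots> = integral {0..pi} ?q - integral {0..pi} (?r d) + g ?x * ?V d"
    proof (rule integral_unique, intro has_integral_add has_integral_diff has_integral_mult_right)
      show "(?k d has_integral ?V d) {0..pi}"
        by (rule truncated_kernel_integral) (use t d in auto)
    qed (use q_int r_int in \<open>auto intro: integrable_integral\<close>)
    finally show ?thesis .
  qed
  have "((\<lambda>d. LINT y:{-1..1} - {?x - d<..<?x + d}|lborel. g y / (y - ?x) / sqrt (1 - y\<^sup>2)) \<longlongrightarrow> integral {0..pi} ?q) (at_right 0)"
  proof (rule tendsto_at_right_sequentially[where b = "min (1 - ?x) (1 + ?x)"])
    show "0 < min (1 - ?x) (1 + ?x)" using xs by auto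
    fix S :: "nat \<Rightarrow> real" assume S: "\<And>n. 0 < S n" "\<And>n. S n < min (1 - ?x) (1 + ?x)" "S \<longlonglongrightarrow> 0"
    have "(\<lambda>n. integral {0..pi} (?r (S n))) \<longlonglongrightarrow> integral {0..pi} (\<lambda>_. 0::real)"
    proof (rule dominated_convergence(2)[where h = "\<lambda>_. L"])
      fix n \<tau> show "norm (?r (S n) \<tau>) \<le> L"
        using difference_quotient_bound[OF x, of "cos \<tau>"] L_nonneg by auto
    next
      fix \<tau> :: real
      show "(\<lambda>n. ?r (S n) \<tau>) \<longlonglongrightarrow> 0"
      proof (cases "cos \<tau> = ?x")
        case False
        then have "\<forall>\<^sub>F n in sequentially. S n < \<bar>cos \<tau> - ?x\<bar>"
          using S(3) by (intro order_tendstoD(2)) auto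
        then have "\<forall>\<^sub>F n in sequentially. ?r (S n) \<tau> = 0"
          by eventually_elim auto
        then show ?thesis by (rule tendsto_eventually)
      next
        case True
        then show ?thesis by (intro tendsto_eventually always_eventually) auto
      qed
    qed (use r_int in auto)
    then have l1: "(\<lambda>n. integral {0..pi} (?r (S n))) \<longlonglongrightarrow> 0" by simp
    have s: "sin t > 0" using t by (rule sin_gt_zero)
    have "isCont ?V 0"
      using s xs t arccos_cos[of t]
      by (intro continuous_intros isCont_o2[OF _ isCont_arccos]) auto
    then have "(\<lambda>n. ?V (S n)) \<longlonglongrightarrow> ?V 0"
      by (rule isCont_tendsto_compose[OF _ S(3)])
    then have l2: "(\<lambda>n. ?V (S n)) \<longlonglongrightarrow> 0" by simp
    have "(\<lambda>n. integral {0..pi} ?q - integral {0..pi} (?r (S n)) + g ?x * ?V (S n)) \<longlonglongrightarrow> integral {0..pi} ?q - 0 + g ?x * 0"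
      by (intro tendsto_intros l1 l2)
    then show "(\<lambda>n. LINT y:{-1..1} - {?x - S n<..<?x + S n}|lborel. g y / (y - ?x) / sqrt (1 - y\<^sup>2)) \<longlonglongrightarrow> integral {0..pi} ?q"
      using trunc S(1,2) by simp
  qed
  then show ?thesis
    unfolding pv_integral_def by (intro tendsto_Lim) auto
qed

end

text \<open>At an endpoint \<theta> is defined as a limit. The Lipschitz bound makes it 0, since the
  factor sqrt (1 - x^2) tends to 0 while the integral stays bounded, and \<open>conj_fun\<close>
  vanishes there through sin t.\<close>

lemma theta_eq_conj_fun:
  assumes lip: "\<And>x y. x \<in> {-1..1} \<Longrightarrow> y \<in> {-1..1} \<Longrightarrow> \<bar>ln (\<rho> x) - ln (\<rho> y)\<bar> \<le> L * \<bar>x - y\<bar>"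
    and t: "t \<in> {0..pi}"
  shows "theta \<rho> (cos t) = conj_fun (\<lambda>\<tau>. ln (\<rho> (cos \<tau>))) t"
proof -
  have int: "theta_interior \<rho> (cos s) = conj_fun (\<lambda>\<tau>. ln (\<rho> (cos \<tau>))) s" if s: "0 < s" "s < pi" for s
  proof -
    have "sqrt (1 - (cos s)\<^sup>2) = sin s"
      using sin_gt_zero[OF s] by (simp add: sin_squared_eq[symmetric])
    then show ?thesis
      unfolding theta_interior_def conj_fun_def using pv_integral_eq[of "\<lambda>x. ln (\<rho> x)", OF lip s] by simp
  qed
  show ?thesis
  proof (cases "0 < t \<and> t < pi")
    case True
    then have "cos t \<in> {-1<..<1}" using cos_monotone_0_pi[of 0 t] cos_monotone_0_pi[of t pi] by auto
    then show ?thesis unfolding theta_def using int True by simp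
  next
    case False
    then have tt: "t = 0 \<or> t = pi" using t by auto
    then have c: "cos t = 1 \<or> cos t = -1" by auto
    have L: "L \<ge> 0" using lip[of 0 1] by auto
    have "(theta_interior \<rho> \<longlongrightarrow> 0) (at (cos t) within {-1<..<1})"
    proof (rule Lim_null_comparison[where g = "\<lambda>x. sqrt (1 - x\<^sup>2) * L"])
      have "norm (theta_interior \<rho> x) \<le> sqrt (1 - x\<^sup>2) * L" if x: "x \<in> {-1<..<1}" for x
      proof -
        have xc: "cos (arccos x) = x" "0 < arccos x" "arccos x < pi"
          using x arccos_lt_bounded[of x] by auto
        have x2: "x\<^sup>2 \<le> 1" using x by (auto simp: abs_square_le_1 abs_le_iff)
        have s: "sin (arccos x) = sqrt (1 - x\<^sup>2)" using x by (intro sin_arccos) auto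
        have "norm (theta_interior \<rho> x) = \<bar>conj_fun (\<lambda>\<tau>. ln (\<rho> (cos \<tau>))) (arccos x)\<bar>"
          using int[OF xc(2,3)] xc by simp
        also have "\<dots> \<le> sqrt (1 - x\<^sup>2) / (2 * pi) * (L * pi)"
          using x2
          unfolding conj_fun_def abs_mult s xc
          using norm_difference_quotient_integral[of "\<lambda>x. ln (\<rho> x)", OF lip, of x] x
          by (intro mult_mono) (auto simp: abs_le_iff)
        also have "\<dots> = (sqrt (1 - x\<^sup>2) * L) / 2" by simp
        also have "\<dots> \<le> sqrt (1 - x\<^sup>2) * L"
          using L x2 by simp
        finally show ?thesis .
      qed
      then show "\<forall>\<^sub>F x in at (cos t) within {-1<..<1}. norm (theta_interior \<rho> x) \<le> sqrt (1 - x\<^sup>2) * L"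
        by (auto simp: eventually_at_filter)
      have "((\<lambda>x::real. sqrt (1 - x\<^sup>2) * L) \<longlongrightarrow> sqrt (1 - (cos t)\<^sup>2) * L) (at (cos t) within {-1<..<1})"
        by (intro tendsto_intros)
      then show "((\<lambda>x::real. sqrt (1 - x\<^sup>2) * L) \<longlongrightarrow> 0) (at (cos t) within {-1<..<1})"
        using c by auto
    qed
    moreover have "at (cos t) within {-1<..<1} \<noteq> bot"
      using c islimpt_greaterThanLessThan1[of "-1::real" 1] islimpt_greaterThanLessThan2[of "-1::real" 1]
      by (auto simp: trivial_limit_within)
    ultimately have "Lim (at (cos t) within {-1<..<1}) (theta_interior \<rho>) = 0"
      by (intro tendsto_Lim)
    then show ?thesis
      using tt c by (auto simp: theta_def conj_fun_def)
  qed
qed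

section \<open>The logarithmic bound for the conjugate function\<close>

text \<open>With y = \<bar>u\<bar>/4 \<le> \<pi>/4 the double angle formula gives sin (2 y) \<ge> 2
  y (cos y)^2 \<ge> y. The constant 1/4 is not sharp.\<close>

lemma abs_sin_half_ge:
  fixes u :: real
  assumes "\<bar>u\<bar> \<le> pi"
  shows "\<bar>u\<bar> / 4 \<le> \<bar>sin (u / 2)\<bar>"
proof -
  define y where "y = \<bar>u\<bar> / 4"
  have y: "0 \<le> y" "y \<le> pi / 4" using assms by (auto simp: y_def)
  have "y * cos y \<le> sin y"
  proof (cases "y = 0")
    case False
    then have "\<exists>z>0. z < y \<and> sin y - sin 0 = (y - 0) * cos z"
      using y by (intro MVT2) (auto intro!: DERIV_sin)
    then obtain z where z: "0 < z" "z < y" "sin y = y * cos z" by auto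
    have "cos y \<le> cos z" using z y by (intro cos_monotone_0_pi_le) auto
    then show ?thesis using z(3) y(1) mult_left_mono by auto
  qed simp
  moreover have c0: "0 \<le> cos y" using y pi_ge_zero by (intro cos_ge_zero) linarith+
  have "cos (pi / 4) \<le> cos y" using y by (intro cos_monotone_0_pi_le) auto
  then have "sqrt 2 / 2 \<le> cos y" by (simp add: cos_45)
  then have "(sqrt 2 / 2) * (sqrt 2 / 2) \<le> cos y * cos y" using c0 by (intro mult_mono) auto
  then have "1 / 2 \<le> cos y * cos y" by simp
  then have "y * (1 / 2) \<le> y * (cos y * cos y)" using y(1) by (intro mult_left_mono)
  ultimately have "y \<le> 2 * sin y * cos y"
    using mult_right_mono[of "y * cos y" "sin y" "cos y"] c0 by (simp add: mult_ac)
  also have "\<dots> = sin (2 * y)" by (simp add: sin_double)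
  also have "2 * y = \<bar>u\<bar> / 2" by (simp add: y_def)
  also have "sin (\<bar>u\<bar> / 2) \<le> \<bar>sin (u / 2)\<bar>"
    by (cases "u \<ge> 0") (auto simp: abs_if)
  finally show ?thesis by (simp add: y_def)
qed

text \<open>The source of both logarithms: the conjugate function and the Christoffel-Darboux kernel
  are both reduced to this integrand, with \<open>a\<close> proportional to n.\<close>

lemma reciprocal_kernel_integral:
  fixes a s :: real
  assumes a: "a > 0" and s: "s \<in> {0..pi}"
  shows "(\<lambda>\<tau>. a / (1 + a * \<bar>s - \<tau>\<bar>)) integrable_on {0..pi}"
    and "integral {0..pi} (\<lambda>\<tau>. a / (1 + a * \<bar>s - \<tau>\<bar>)) \<le> 2 * ln (1 + a * pi)"
proof -
  let ?f = "\<lambda>\<tau>. a / (1 + a * \<bar>s - \<tau>\<bar>)"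
  have 1: "(?f has_integral (- ln (1 + a * (s - s)) - (- ln (1 + a * (s - 0))))) {0..s}"
  proof (rule fundamental_theorem_of_calculus)
    fix x assume x: "x \<in> {0..s}"
    then have "0 < 1 + a * (s - x)" using a by (intro add_pos_nonneg mult_nonneg_nonneg) auto
    then have "((\<lambda>x. - ln (1 + a * (s - x))) has_real_derivative ?f x) (at x within {0..s})"
      using x by (auto intro!: derivative_eq_intros simp: field_simps)
    then show "((\<lambda>x. - ln (1 + a * (s - x))) has_vector_derivative ?f x) (at x within {0..s})"
      by (simp add: has_real_derivative_iff_has_vector_derivative)
  qed (use s in auto)
  have 2: "(?f has_integral (ln (1 + a * (pi - s)) - (ln (1 + a * (s - s))))) {s..pi}"
  proof (rule fundamental_theorem_of_calculus)
    fix x assume x: "x \<in> {s..pi}"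
    then have "0 < 1 + a * (x - s)" using a by (intro add_pos_nonneg mult_nonneg_nonneg) auto
    then have "((\<lambda>x. ln (1 + a * (x - s))) has_real_derivative ?f x) (at x within {s..pi})"
      using x by (auto intro!: derivative_eq_intros simp: field_simps)
    then show "((\<lambda>x. ln (1 + a * (x - s))) has_vector_derivative ?f x) (at x within {s..pi})"
      by (simp add: has_real_derivative_iff_has_vector_derivative)
  qed (use s in auto)
  have 3: "(?f has_integral (ln (1 + a * s) + ln (1 + a * (pi - s)))) {0..pi}"
    using has_integral_combine[OF _ _ 1 2] s by simp
  then show "?f integrable_on {0..pi}" by blast
  have "ln (1 + a * s) \<le> ln (1 + a * pi)" "ln (1 + a * (pi - s)) \<le> ln (1 + a * pi)"
    using a s by (subst ln_le_cancel_iff; auto intro!: add_pos_nonneg)+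
  then show "integral {0..pi} ?f \<le> 2 * ln (1 + a * pi)"
    using integral_unique[OF 3] by simp
qed

text \<open>Since sin t \<le> sin s + sin t \<le> 2 sin ((s + t)/2), the factor sin t of
  \<open>conj_fun\<close> absorbs the second zero of cos s - cos t. This keeps the estimates uniform
  up to the endpoints.\<close>

lemma cos_diff_lower_bound:
  assumes "s \<in> {0..pi}" "t \<in> {0..pi}"
  shows "sin t * \<bar>t - s\<bar> \<le> 4 * \<bar>cos s - cos t\<bar>"
proof -
  have s1: "0 \<le> sin ((s + t) / 2)" using assms by (intro sin_ge_zero) auto
  have s2: "sin t \<le> 2 * sin ((s + t) / 2)"
  proof -
    have "sin t \<le> sin s + sin t" using assms sin_ge_zero by auto
    also have "\<dots> = 2 * sin ((s + t) / 2) * cos ((s - t) / 2)" by (rule sin_plus_sin)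
    also have "\<dots> \<le> 2 * sin ((s + t) / 2) * 1" using s1 by (intro mult_left_mono) auto
    finally show ?thesis by simp
  qed
  have "sin t * (\<bar>t - s\<bar> / 4) \<le> (2 * sin ((s + t) / 2)) * \<bar>sin ((t - s) / 2)\<bar>"
    using s2 s1 assms by (intro mult_mono abs_sin_half_ge) auto
  also have "\<dots> = \<bar>cos s - cos t\<bar>"
    using s1 by (simp add: cos_diff_cos abs_mult)
  finally show ?thesis by simp
qed

text \<open>Away from t the sup bound \<delta> controls the quotient, within distance 1/a of t the
  Lipschitz bound \<delta> a does. The constant \<open>L\<close> only guarantees integrability and
  is absent from the result, so it may depend on n without control. The factor 3 dominates 16/(2
  \<pi>).\<close>

lemma conj_fun_bound:
  assumes lip: "\<And>x y. x \<in> {-1..1} \<Longrightarrow> y \<in> {-1..1} \<Longrightarrow> \<bar>g x - g y\<bar> \<le> L * \<bar>x - y\<bar>"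
    and t: "t \<in> {0..pi}" and a: "a > 0"
    and b1: "\<And>\<tau>. \<tau> \<in> {0..pi} \<Longrightarrow> \<bar>g (cos \<tau>) - g (cos t)\<bar> \<le> \<delta>"
    and b2: "\<And>\<tau>. \<tau> \<in> {0..pi} \<Longrightarrow> \<bar>g (cos \<tau>) - g (cos t)\<bar> \<le> \<delta> * a * \<bar>\<tau> - t\<bar>"
  shows "\<bar>conj_fun (\<lambda>\<tau>. g (cos \<tau>)) t\<bar> \<le> 3 * \<delta> * ln (1 + a * pi)"
proof -
  let ?q = "\<lambda>\<tau>. (g (cos \<tau>) - g (cos t)) / (cos \<tau> - cos t)"
  let ?f = "\<lambda>\<tau>. a / (1 + a * \<bar>t - \<tau>\<bar>)"
  have d: "\<delta> \<ge> 0" using b1[OF t] by simp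
  have st: "sin t \<ge> 0" using t by (intro sin_ge_zero) auto
  have q: "?q integrable_on {0..pi}"
    using difference_quotient_integrable[of g L "\<lambda>_. 1" "cos t", OF lip] by simp
  have "norm (integral {0..pi} (\<lambda>\<tau>. sin t * ?q \<tau>)) \<le> integral {0..pi} (\<lambda>\<tau>. 8 * \<delta> * ?f \<tau>)"
  proof (rule integral_norm_bound_integral)
    fix \<tau> assume \<tau>: "\<tau> \<in> {0..pi}"
    let ?u = "\<bar>t - \<tau>\<bar>"
    show "norm (sin t * ?q \<tau>) \<le> 8 * \<delta> * ?f \<tau>"
    proof (cases "cos \<tau> = cos t")
      case True then show ?thesis using d a by (auto intro!: divide_nonneg_nonneg)
    next
      case False
      then have u: "?u > 0" by auto
      have c: "\<bar>cos \<tau> - cos t\<bar> > 0" using False by simp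
      have p: "0 < 1 + a * ?u" using a by (intro add_pos_nonneg) auto
      have "\<bar>g (cos \<tau>) - g (cos t)\<bar> \<le> \<delta> * a * ?u"
        using b2[OF \<tau>] by (simp add: abs_minus_commute)
      moreover have "\<bar>g (cos \<tau>) - g (cos t)\<bar> * (a * ?u) \<le> \<delta> * (a * ?u)"
        using b1[OF \<tau>] a by (intro mult_right_mono) auto
      \<comment> \<open>Adding the two bounds replaces a case distinction between near and far
        points.\<close>
      ultimately have "\<bar>g (cos \<tau>) - g (cos t)\<bar> * (1 + a * ?u) \<le> 2 * (\<delta> * a * ?u)"
        by (simp only: ring_distribs mult_1_right mult.assoc)
      then have 1: "\<bar>g (cos \<tau>) - g (cos t)\<bar> \<le> 2 * \<delta> * ?u * ?f \<tau>"
        using p by (simp add: field_simps)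
      have "norm (sin t * ?q \<tau>) = sin t * \<bar>g (cos \<tau>) - g (cos t)\<bar> / \<bar>cos \<tau> - cos t\<bar>"
        using st by (simp add: abs_mult abs_divide)
      also have "\<dots> \<le> sin t * (2 * \<delta> * ?u * ?f \<tau>) / \<bar>cos \<tau> - cos t\<bar>"
        using 1 st by (intro divide_right_mono mult_left_mono) auto
      also have "\<dots> = (sin t * ?u) * (2 * \<delta> * ?f \<tau>) / \<bar>cos \<tau> - cos t\<bar>" by (simp add: mult_ac)
      also have "\<dots> \<le> (4 * \<bar>cos \<tau> - cos t\<bar>) * (2 * \<delta> * ?f \<tau>) / \<bar>cos \<tau> - cos t\<bar>"
        using cos_diff_lower_bound[OF \<tau> t] d a p by (intro divide_right_mono mult_right_mono) auto
      also have "\<dots> = 8 * \<delta> * ?f \<tau>" using c by simp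
      finally show ?thesis .
    qed
  next
    show "(\<lambda>\<tau>. sin t * ?q \<tau>) integrable_on {0..pi}"
      by (rule has_integral_integrable[OF has_integral_mult_right[OF integrable_integral[OF q]]])
    show "(\<lambda>\<tau>. 8 * \<delta> * ?f \<tau>) integrable_on {0..pi}"
      by (rule has_integral_integrable[OF has_integral_mult_right[OF integrable_integral[OF reciprocal_kernel_integral(1)[OF a t]]]])
  qed
  also have "\<dots> \<le> 8 * \<delta> * (2 * ln (1 + a * pi))"
    unfolding integral_mult_right using reciprocal_kernel_integral(2)[OF a t] d by (intro mult_left_mono) auto
  finally have "\<bar>sin t * integral {0..pi} ?q\<bar> \<le> 16 * \<delta> * ln (1 + a * pi)"
    unfolding integral_mult_right real_norm_def by linarith
  then have "\<bar>conj_fun (\<lambda>\<tau>. g (cos \<tau>)) t\<bar> \<le> 16 * \<delta> * ln (1 + a * pi) / (2 * pi)"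
  proof -
    have "\<bar>conj_fun (\<lambda>\<tau>. g (cos \<tau>)) t\<bar> = \<bar>sin t * integral {0..pi} ?q\<bar> / (2 * pi)"
      by (simp add: conj_fun_def abs_mult)
    then show ?thesis using \<open>\<bar>sin t * integral {0..pi} ?q\<bar> \<le> _\<close> by (simp only:) (intro divide_right_mono, auto)
  qed
  also have "\<dots> \<le> 16 * \<delta> * ln (1 + a * pi) / (2 * 3)"
    using pi_gt3 d a by (intro divide_left_mono mult_nonneg_nonneg) auto
  also have "\<dots> \<le> 3 * \<delta> * ln (1 + a * pi)"
    using d a by (simp add: mult_right_mono)
  finally show ?thesis .
qed

lemma conj_fun_diff:
  assumes "\<And>x y. x \<in> {-1..1} \<Longrightarrow> y \<in> {-1..1} \<Longrightarrow> \<bar>f x - f y\<bar> \<le> K * \<bar>x - y\<bar>"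
    and "\<And>x y. x \<in> {-1..1} \<Longrightarrow> y \<in> {-1..1} \<Longrightarrow> \<bar>g x - g y\<bar> \<le> L * \<bar>x - y\<bar>"
  shows "conj_fun (\<lambda>\<tau>. f (cos \<tau>) - g (cos \<tau>)) t = conj_fun (\<lambda>\<tau>. f (cos \<tau>)) t - conj_fun (\<lambda>\<tau>. g (cos \<tau>)) t"
proof -
  have "(\<lambda>\<tau>. (f (cos \<tau>) - f (cos t)) / (cos \<tau> - cos t)) integrable_on {0..pi}"
    using difference_quotient_integrable[of f K "\<lambda>_. 1" "cos t", OF assms(1)] by simp
  moreover have "(\<lambda>\<tau>. (g (cos \<tau>) - g (cos t)) / (cos \<tau> - cos t)) integrable_on {0..pi}"
    using difference_quotient_integrable[of g L "\<lambda>_. 1" "cos t", OF assms(2)] by simp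
  ultimately have "integral {0..pi} (\<lambda>\<tau>. (f (cos \<tau>) - f (cos t)) / (cos \<tau> - cos t) - (g (cos \<tau>) - g (cos t)) / (cos \<tau> - cos t))
    = integral {0..pi} (\<lambda>\<tau>. (f (cos \<tau>) - f (cos t)) / (cos \<tau> - cos t)) - integral {0..pi} (\<lambda>\<tau>. (g (cos \<tau>) - g (cos t)) / (cos \<tau> - cos t))"
    by (rule integral_diff)
  then show ?thesis
    unfolding conj_fun_def right_diff_distrib[symmetric]
    by (simp only: diff_divide_distrib[symmetric]) (simp only: diff_diff_eq2 diff_diff_eq add_diff_eq add.commute diff_add_eq)
qed

section \<open>Recovering a holomorphic function and its boundary values from its real boundary
  sum\<close>

text \<open>The mean value formula is applied to H(z) (1 - \<xi>^2) / (1 - \<xi> z), whose value at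
  \<xi> is H(\<xi>). With this auxiliary factor the kernel becomes symmetric under t to -t, so only
  the sum of the two boundary values of H enters.\<close>

lemma outer_eq_of_boundary:
  assumes R: "R > 1" and H: "H holomorphic_on ball 0 R"
    and F: "\<And>t. t \<in> {0..pi} \<Longrightarrow> H (cis t) + H (cis (- t)) = of_real (F t)" and \<xi>: "norm \<xi> < 1"
  shows "outer F \<xi> = H \<xi>"
proof -
  \<comment> \<open>A radius between 1 and 1/\<bar>\<xi>\<bar>, in a form that also makes sense for
    \<xi> = 0.\<close>
  define r where "r = min R (2 / (1 + norm \<xi>))"
  have np: "0 < 1 + norm \<xi>" by (smt (verit) norm_ge_zero)
  have r: "r > 1" using R \<xi> np by (auto simp: r_def less_divide_eq)
  have nz: "1 - \<xi> * z \<noteq> 0" if "z \<in> ball 0 r" for z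
  proof
    assume "1 - \<xi> * z = 0"
    then have "norm \<xi> * norm z = 1" by (metis eq_iff_diff_eq_0 norm_mult norm_one)
    moreover have "norm z < 2 / (1 + norm \<xi>)" using that by (auto simp: r_def)
    then have "norm z * (1 + norm \<xi>) < 2" using np by (simp add: less_divide_eq)
    then have "norm z + norm \<xi> * norm z < 2" by (simp add: algebra_simps)
    ultimately have "norm z < 1" by simp
    then have "norm \<xi> * norm z < 1"
      using \<xi> mult_left_le_one_le[of "norm z" "norm \<xi>"] by simp
    then show False using \<open>norm \<xi> * norm z = 1\<close> by simp
  qed
  have "(\<lambda>z. H z * (1 - \<xi>\<^sup>2) / (1 - \<xi> * z)) holomorphic_on ball 0 r"
    using nz by (intro holomorphic_intros holomorphic_on_subset[OF H]) (auto simp: r_def)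
  from circle_mean_value[OF r this \<xi>]
  have "((\<lambda>t. of_real (F t) * ((1 - \<xi>\<^sup>2) / (1 - 2 * \<xi> * of_real (cos t) + \<xi>\<^sup>2))) has_integral
     2 * pi * (H \<xi> * (1 - \<xi>\<^sup>2) / (1 - \<xi> * \<xi>))) {0..pi}"
  proof (rule has_integral_eq[rotated])
    fix t assume t: "t \<in> {0..pi}"
    have frac: "h * n / X * c / (c * Y) = h * (n / (X * Y))" if "c \<noteq> 0" for h n X Y c :: complex
      using that by (simp add: field_simps)
    have e: "H (cis s) * (1 - \<xi>\<^sup>2) / (1 - \<xi> * cis s) * cis s / (cis s - \<xi>)
       = H (cis s) * ((1 - \<xi>\<^sup>2) / (1 - 2 * \<xi> * of_real (cos s) + \<xi>\<^sup>2))" for s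
    proof -
      have "cis s - \<xi> = cis s * (1 - \<xi> * cis (- s))"
        by (simp add: algebra_simps cis_mult)
      then show ?thesis
        unfolding joukowski_kernel_factor by (simp only: frac[OF cis_neq_zero])
    qed
    show "H (cis t) * (1 - \<xi>\<^sup>2) / (1 - \<xi> * cis t) * cis t / (cis t - \<xi>) +
         H (cis (- t)) * (1 - \<xi>\<^sup>2) / (1 - \<xi> * cis (- t)) * cis (- t) / (cis (- t) - \<xi>) =
         of_real (F t) * ((1 - \<xi>\<^sup>2) / (1 - 2 * \<xi> * of_real (cos t) + \<xi>\<^sup>2))"
      unfolding e F[OF t, symmetric] cos_minus by (rule distrib_right[symmetric])
  qed
  moreover have "1 - \<xi> * \<xi> \<noteq> 0" using nz[of \<xi>] \<xi> r by auto
  ultimately show ?thesis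
    unfolding outer_def by (simp add: integral_unique power2_eq_square)
qed

text \<open>Compares a point of the circle with a point on the same ray, uniformly in the radius:
  the radial distance 1 - r is itself at most \<bar>1 - r cis u\<bar>.\<close>

lemma one_minus_cis_bound:
  assumes "0 \<le> r" "r \<le> 1"
  shows "norm (1 - cis u) \<le> 2 * norm (1 - of_real r * cis u)"
proof -
  have "norm (1 - cis u) \<le> norm (1 - of_real r * cis u) + norm (of_real (1 - r) * cis u)"
    using norm_triangle_ineq4[of "1 - of_real r * cis u" "of_real (1 - r) * cis u"]
    by (simp add: algebra_simps)
  moreover have "norm (of_real (1 - r) * cis u) = 1 - r"
    using assms by (simp add: norm_mult del: of_real_diff)
  moreover have "1 - r \<le> norm (1 - of_real r * cis u)"
    using norm_triangle_ineq2[of 1 "of_real r * cis u"] assms by (simp add: norm_mult)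
  ultimately show ?thesis by linarith
qed

text \<open>A Sokhotski-Plemelj formula. The constant c = g (cos t) contributes c/2 inside the disc;
  after subtracting it the integrands for radii r < 1 are dominated by 4 L, so the radial limit
  passes under the integral.\<close>

lemma boundary_value:
  assumes R: "R > 1" and H: "H holomorphic_on ball 0 R"
    and lip: "\<And>x y. x \<in> {-1..1} \<Longrightarrow> y \<in> {-1..1} \<Longrightarrow> \<bar>g x - g y\<bar> \<le> L * \<bar>x - y\<bar>"
    and F: "\<And>t. t \<in> {0..pi} \<Longrightarrow> H (cis t) + H (cis (- t)) = of_real (g (cos t))"
    and t: "t \<in> {0..pi}"
  shows "H (cis (- t)) = of_real (g (cos t) / 2) - \<i> * of_real (conj_fun (\<lambda>\<tau>. g (cos \<tau>)) t)"
proof -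
  define c where "c = g (cos t)"
  define r where "r = (\<lambda>k::nat. 1 - 1 / (real k + 2))"
  define \<xi> where "\<xi> = (\<lambda>k. of_real (r k) * cis (- t))"
  have r: "0 \<le> r k" "r k < 1" for k by (auto simp: r_def field_simps)
  have "(\<lambda>k. r k) \<longlonglongrightarrow> 1 - 0"
    unfolding r_def using LIMSEQ_ignore_initial_segment[OF lim_1_over_n, of 2]
    by (intro tendsto_intros) (simp add: add.commute)
  then have rl: "r \<longlonglongrightarrow> 1" by simp
  have \<xi>n: "norm (\<xi> k) < 1" for k using r[of k] by (simp add: \<xi>_def norm_mult)
  have "(\<lambda>k. \<xi> k) \<longlonglongrightarrow> of_real 1 * cis (- t)"
    unfolding \<xi>_def by (intro tendsto_intros rl)
  then have \<xi>l: "\<xi> \<longlonglongrightarrow> cis (- t)" by simp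
  have cont: "continuous_on {0..pi} (\<lambda>\<tau>. g (cos \<tau>))"
  proof (rule continuous_on_comp_cos)
    have "L-lipschitz_on {-1..1} g"
      using lip lip[of 0 1] by (intro lipschitz_onI) (auto simp: dist_real_def)
    then show "continuous_on {-1..1} g" by (rule lipschitz_on_continuous_on)
  qed
  let ?K = "\<lambda>\<xi> \<tau>. (1 - \<xi>\<^sup>2) / (1 - 2 * \<xi> * complex_of_real (cos \<tau>) + \<xi>\<^sup>2)"
  let ?f = "\<lambda>k \<tau>. complex_of_real (g (cos \<tau>) - c) * ?K (\<xi> k) \<tau>"
  have eq: "H (\<xi> k) = integral {0..pi} (?f k) / (2 * pi) + of_real (c / 2)" for k
  proof -
    have "H (\<xi> k) = outer (\<lambda>\<tau>. g (cos \<tau>)) (\<xi> k)"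
      by (rule outer_eq_of_boundary[OF R H _ \<xi>n, symmetric]) (use F in auto)
    moreover have "outer (\<lambda>_. c) (\<xi> k) = of_real (c / 2)"
      by (rule outer_eq_of_boundary[where R = 2, OF _ _ _ \<xi>n]) auto
    moreover have "outer (\<lambda>\<tau>. g (cos \<tau>) - c) (\<xi> k) = outer (\<lambda>\<tau>. g (cos \<tau>)) (\<xi> k) - outer (\<lambda>_. c) (\<xi> k)"
      by (rule outer_diff[OF cont _ \<xi>n]) auto
    ultimately show ?thesis by (simp add: outer_def)
  qed
  have d: "1 - 2 * cis (- t) * complex_of_real (cos \<tau>) + (cis (- t))\<^sup>2 = 2 * cis (- t) * of_real (cos t - cos \<tau>)" for \<tau>
    by (simp add: complex_eq_iff power2_eq_square algebra_simps)
  let ?q = "\<lambda>\<tau>. (g (cos \<tau>) - g (cos t)) / (cos \<tau> - cos t)"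
  have L: "L \<ge> 0" using lip[of 0 1] by auto
  have "(\<lambda>k. integral {0..pi} (?f k)) \<longlonglongrightarrow> integral {0..pi} (\<lambda>\<tau>. - \<i> * of_real (sin t) * of_real (?q \<tau>))"
  proof (rule dominated_convergence(2)[where h = "\<lambda>_. 4 * L"])
    show "?f k integrable_on {0..pi}" for k
      by (intro integrable_continuous_real continuous_on_outer_integrand \<xi>n continuous_intros cont)
  next
    fix k \<tau>
    \<comment> \<open>Both factors of the kernel at radius \<open>r k\<close> are compared with
      those at radius 1, where their product is 2 \<bar>cos \<tau> - cos t\<bar>; each comparison
      costs a factor 2.\<close>
    have D: "\<bar>cos \<tau> - cos t\<bar> \<le> 2 * norm (1 - 2 * \<xi> k * complex_of_real (cos \<tau>) + (\<xi> k)\<^sup>2)"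
    proof -
      have e: "\<xi> k * cis s = of_real (r k) * cis (s - t)" for s
        by (simp add: \<xi>_def cis_mult)
      have "2 * cis (- t) * of_real (cos t - cos \<tau>) = (1 - cis (\<tau> - t)) * (1 - cis (- \<tau> - t))"
        unfolding d[symmetric] joukowski_kernel_factor by (simp add: cis_mult minus_diff_commute)
      then have "norm (2 * cis (- t) * complex_of_real (cos t - cos \<tau>)) = norm (1 - cis (\<tau> - t)) * norm (1 - cis (- \<tau> - t))"
        by (simp only: norm_mult)
      then have "2 * \<bar>cos \<tau> - cos t\<bar> = norm (1 - cis (\<tau> - t)) * norm (1 - cis (- \<tau> - t))"
        by (simp add: norm_mult abs_minus_commute del: of_real_diff)
      also have "\<dots> \<le> (2 * norm (1 - of_real (r k) * cis (\<tau> - t))) * (2 * norm (1 - of_real (r k) * cis (- \<tau> - t)))"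
        using r[of k] by (intro mult_mono one_minus_cis_bound) auto
      also have "\<dots> = 4 * norm (1 - 2 * \<xi> k * complex_of_real (cos \<tau>) + (\<xi> k)\<^sup>2)"
        unfolding joukowski_kernel_factor e norm_mult by simp
      finally show ?thesis by simp
    qed
    have n2: "norm (1 - (\<xi> k)\<^sup>2) \<le> 2"
      using norm_triangle_ineq4[of 1 "(\<xi> k)\<^sup>2"] \<xi>n[of k] power_le_one[of "norm (\<xi> k)" 2] by (simp add: norm_power)
    have pos: "0 < norm (1 - 2 * \<xi> k * complex_of_real (cos \<tau>) + (\<xi> k)\<^sup>2)"
      using joukowski_kernel_nonzero[OF \<xi>n] by simp
    have "norm (?f k \<tau>) = \<bar>g (cos \<tau>) - c\<bar> * norm (1 - (\<xi> k)\<^sup>2) / norm (1 - 2 * \<xi> k * complex_of_real (cos \<tau>) + (\<xi> k)\<^sup>2)"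
      by (simp add: norm_mult norm_divide del: of_real_diff)
    also have "\<dots> \<le> (L * (2 * norm (1 - 2 * \<xi> k * complex_of_real (cos \<tau>) + (\<xi> k)\<^sup>2))) * 2 / norm (1 - 2 * \<xi> k * complex_of_real (cos \<tau>) + (\<xi> k)\<^sup>2)"
      using lip[of "cos \<tau>" "cos t"] mult_left_mono[OF D L] n2 L
      by (intro divide_right_mono mult_mono) (auto simp: c_def)
    also have "\<dots> = 4 * L" using pos by simp
    finally show "norm (?f k \<tau>) \<le> 4 * L" .
  next
    fix \<tau> assume \<tau>: "\<tau> \<in> {0..pi}"
    show "(\<lambda>k. ?f k \<tau>) \<longlonglongrightarrow> - \<i> * of_real (sin t) * of_real (?q \<tau>)"
    proof (cases "cos \<tau> = cos t")
      case True then show ?thesis by (simp add: c_def)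
    next
      case False
      have n: "1 - (cis (- t))\<^sup>2 = 2 * cis (- t) * (\<i> * of_real (sin t))"
        by (simp add: complex_eq_iff power2_eq_square algebra_simps)
      have dn: "2 * cis (- t) * of_real (cos t - cos \<tau>) \<noteq> 0"
        using False by (metis cis_neq_zero mult_eq_0_iff of_real_eq_0_iff eq_iff_diff_eq_0 zero_neq_numeral)
      have "(\<lambda>k. ?f k \<tau>) \<longlonglongrightarrow> of_real (g (cos \<tau>) - c) * ?K (cis (- t)) \<tau>"
        by (intro tendsto_intros \<xi>l) (use dn d in auto)
      moreover have "of_real (g (cos \<tau>) - c) * ?K (cis (- t)) \<tau> = - \<i> * of_real (sin t) * of_real (?q \<tau>)"
      proof -
        have "?K (cis (- t)) \<tau> = \<i> * of_real (sin t) / of_real (cos t - cos \<tau>)"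
          unfolding d n using dn by simp
        also have "\<dots> = - \<i> * of_real (sin t) / of_real (cos \<tau> - cos t)"
          by (metis minus_diff_eq minus_divide_left minus_divide_right mult_minus_left of_real_minus)
        finally show ?thesis by (simp add: c_def)
      qed
      ultimately show ?thesis by simp
    qed
  qed auto
  then have l1: "(\<lambda>k. H (\<xi> k)) \<longlonglongrightarrow> integral {0..pi} (\<lambda>\<tau>. - \<i> * of_real (sin t) * of_real (?q \<tau>)) / (2 * pi) + of_real (c / 2)"
    unfolding eq by (intro tendsto_intros) auto
  have l2: "(\<lambda>k. H (\<xi> k)) \<longlonglongrightarrow> H (cis (- t))"
  proof (rule isCont_tendsto_compose[OF _ \<xi>l])
    show "isCont H (cis (- t))"
      using holomorphic_on_imp_continuous_on[OF H] R by (simp add: continuous_on_eq_continuous_at)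
  qed
  have l3: "integral {0..pi} (\<lambda>\<tau>. - \<i> * of_real (sin t) * of_real (?q \<tau>)) = - \<i> * of_real (sin t) * of_real (integral {0..pi} ?q)"
  proof -
    have "?q integrable_on {0..pi}"
      using difference_quotient_integrable[of g L "\<lambda>_. 1" "cos t", OF lip] by simp
    then have "(?q has_integral integral {0..pi} ?q) {0..pi}" by blast
    then have "((\<lambda>\<tau>. complex_of_real (?q \<tau>)) has_integral of_real (integral {0..pi} ?q)) {0..pi}"
      by (rule has_integral_of_real)
    then show ?thesis by (intro integral_unique has_integral_mult_right)
  qed
  show ?thesis
    unfolding LIMSEQ_unique[OF l2 l1] l3 by (simp add: conj_fun_def c_def)
qed

subsection \<open>Fejer--Riesz factorization\<close>

lemma complex_linear_factor_joukowski:
  assumes "b \<noteq> 0" "\<zeta> \<noteq> 0"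
  shows "joukowski \<zeta> - joukowski b = - 1 / (2 * b) * ((1 - b * \<zeta>) * (1 - b * (1 / \<zeta>)))"
  using assms by (simp add: joukowski_def field_simps power2_eq_square)

text \<open>Each root of p is off the slit, hence the Joukowski image of some b in the disc. The
  linear factor splits into 1 - b \<zeta> and its reflection, and the zero 1/b of the former lies
  outside the closed disc.\<close>

lemma fejer_riesz_complex:
  fixes p :: "complex poly"
  assumes "\<And>z. z \<in> slit \<Longrightarrow> poly p z \<noteq> 0"
  shows "\<exists>A R. degree A \<le> degree p \<and> R > 1 \<and> (\<forall>\<zeta>\<in>ball 0 R. poly A \<zeta> \<noteq> 0) \<and>
    (\<forall>\<zeta>. \<zeta> \<noteq> 0 \<longrightarrow> poly p (joukowski \<zeta>) = poly A \<zeta> * poly A (1 / \<zeta>))"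
  using assms
proof (induction "degree p" arbitrary: p)
  case 0
  then obtain c where c: "p = [:c:]" by (metis degree_eq_zeroE)
  have "c \<noteq> 0" using "0.prems"[of 0] by (auto simp: c intro!: image_eqI[of _ _ 0])
  then show ?case
    by (intro exI[of _ "[:csqrt c:]"] exI[of _ 2]) (auto simp: c power2_eq_square[symmetric])
next
  case (Suc n)
  have "\<not> constant (poly p)" using Suc.hyps(2) by (simp add: constant_degree)
  then obtain a where a: "poly p a = 0" using fundamental_theorem_of_algebra by blast
  then obtain p' where p': "p = [:- a, 1:] * p'" using poly_eq_0_iff_dvd by (metis dvdE)
  have "p' \<noteq> 0" using Suc.hyps(2) p' by auto
  then have deg: "degree p = Suc (degree p')" unfolding p' by (subst degree_mult_eq) auto
  have "a \<notin> slit" using a Suc.prems by blast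
  then obtain b where b: "b \<noteq> 0" "norm b < 1" "a = joukowski b" by (rule joukowski_surj)
  have "poly p' z \<noteq> 0" if "z \<in> slit" for z
    using Suc.prems[OF that] by (auto simp: p')
  with Suc.hyps deg obtain A R where A: "degree A \<le> degree p'" "R > 1" "\<And>\<zeta>. \<zeta> \<in> ball 0 R \<Longrightarrow> poly A \<zeta> \<noteq> 0"
    "\<And>\<zeta>. \<zeta> \<noteq> 0 \<Longrightarrow> poly p' (joukowski \<zeta>) = poly A \<zeta> * poly A (1 / \<zeta>)"
    by (metis Suc_inject)
  \<comment> \<open>A square root of the constant from the linear factor, so that it is shared
    equally by the two reflected halves.\<close>
  define c where "c = csqrt (- 1 / (2 * b))"
  have c: "c * c = - 1 / (2 * b)" by (simp add: c_def power2_eq_square[symmetric])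
  have c0: "c \<noteq> 0" using b(1) by (auto simp: c_def)
  define A' where "A' = [:c, - (c * b):] * A"
  show ?case
  proof (intro exI[of _ A'] exI[of _ "min R (1 / norm b)"] conjI ballI allI impI)
    show "degree A' \<le> degree p"
      unfolding A'_def deg using degree_mult_le[of "[:c, - (c * b):]" A] A(1) b(1) c0 by simp
    show "1 < min R (1 / norm b)" using A(2) b by simp
  next
    fix \<zeta> :: complex assume \<zeta>: "\<zeta> \<in> ball 0 (min R (1 / norm b))"
    then have "norm (b * \<zeta>) < 1" using b by (simp add: norm_mult field_simps)
    then have "1 - b * \<zeta> \<noteq> 0" by auto
    then have "c * (1 - b * \<zeta>) \<noteq> 0" using c0 by simp
    then show "poly A' \<zeta> \<noteq> 0" using A(3)[of \<zeta>] \<zeta> by (simp add: A'_def algebra_simps)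
  next
    fix \<zeta> :: complex assume \<zeta>: "\<zeta> \<noteq> 0"
    have "poly A' \<zeta> * poly A' (1 / \<zeta>) = (c * c) * ((1 - b * \<zeta>) * (1 - b * (1 / \<zeta>))) * (poly A \<zeta> * poly A (1 / \<zeta>))"
      by (simp add: A'_def algebra_simps)
    also have "(c * c) * ((1 - b * \<zeta>) * (1 - b * (1 / \<zeta>))) = joukowski \<zeta> - a"
      unfolding c b(3) complex_linear_factor_joukowski[OF b(1) \<zeta>] ..
    finally show "poly p (joukowski \<zeta>) = poly A' \<zeta> * poly A' (1 / \<zeta>)"
      using A(4)[OF \<zeta>] by (simp add: p' left_diff_distrib)
  qed
qed

lemma abs_ln_diff_le:
  assumes c: "0 < (c::real)" and xy: "c \<le> x" "c \<le> y"
  shows "\<bar>ln x - ln y\<bar> \<le> \<bar>x - y\<bar> / c"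
proof -
  have "ln x - ln y \<le> \<bar>x - y\<bar> / c" if "c \<le> x" "c \<le> y" for x y
  proof -
    have p: "0 < x" "0 < y" using that c by auto
    have "ln x - ln y = ln (x / y)" using p by (simp add: ln_div)
    also have "\<dots> \<le> x / y - 1" using p by (intro ln_le_minus_one) auto
    also have "\<dots> = (x - y) / y" using p by (simp add: field_simps)
    also have "\<dots> \<le> \<bar>x - y\<bar> / y" using p by (intro divide_right_mono) auto
    also have "\<dots> \<le> \<bar>x - y\<bar> / c" using that c p by (intro divide_left_mono mult_pos_pos) auto
    finally show ?thesis .
  qed
  from this[OF xy] this[OF xy(2,1)] show ?thesis by (simp add: abs_minus_commute abs_le_iff)
qed

lemma poly_lipschitz_Icc:
  fixes q :: "real poly"
  obtains L where "\<And>x y. x \<in> {-1..1} \<Longrightarrow> y \<in> {-1..1} \<Longrightarrow> \<bar>poly q x - poly q y\<bar> \<le> L * \<bar>x - y\<bar>"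
proof -
  have "bounded (poly (pderiv q) ` {-1..1})"
    by (intro compact_imp_bounded compact_continuous_image continuous_intros) auto
  then obtain L where L: "\<forall>x\<in>{-1..1}. \<bar>poly (pderiv q) x\<bar> \<le> L" unfolding bounded_iff by auto
  show ?thesis
  proof (rule that)
    fix x y :: real assume xy: "x \<in> {-1..1}" "y \<in> {-1..1}"
    have "norm (poly q x - poly q y) \<le> L * norm (x - y)"
      by (rule field_differentiable_bound[of "{-1..1}" _ "poly (pderiv q)"])
         (use L xy in \<open>auto intro: DERIV_subset[OF poly_DERIV]\<close>)
    then show "\<bar>poly q x - poly q y\<bar> \<le> L * \<bar>x - y\<bar>" by simp
  qed
qed

abbreviation cpoly :: "real poly \<Rightarrow> complex poly" where
  "cpoly p \<equiv> map_poly complex_of_real p"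

lemma cpoly_of_real [simp]: "poly (cpoly p) (of_real x) = of_real (poly p x)"
  by (induction p) (auto simp: map_poly_pCons)

lemma cnj_cpoly: "cnj (poly (cpoly p) z) = poly (cpoly p) (cnj z)"
  by (induction p) (auto simp: map_poly_pCons)

text \<open>The difference of A and its conjugate has infinitely many roots, hence vanishes.\<close>

lemma real_coeffs_of_real_values:
  fixes A :: "complex poly"
  assumes "infinite X" "\<And>x. x \<in> X \<Longrightarrow> poly A (of_real x) \<in> \<real>"
  obtains B where "A = cpoly B"
proof -
  have "poly (A - map_poly cnj A) (of_real x) = 0" if "x \<in> X" for x
    using poly_cnj[of A "of_real x"] assms(2)[OF that] by (simp add: Reals_cnj_iff)
  then have "of_real ` X \<subseteq> {z. poly (A - map_poly cnj A) z = 0}" by blast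
  moreover have "infinite (complex_of_real ` X)"
    using assms(1) by (subst finite_image_iff) (auto intro: inj_onI)
  ultimately have "A - map_poly cnj A = 0"
    using poly_roots_finite finite_subset by blast
  then have "coeff A n = cnj (coeff A n)" for n
    by (metis coeff_map_poly complex_cnj_zero eq_iff_diff_eq_0)
  then have "A = cpoly (map_poly Re A)"
    by (intro poly_eqI) (simp add: coeff_map_poly complex_eq_iff)
  then show ?thesis by (rule that)
qed

lemma cnj_outer_of_real: "cnj (outer F (of_real x)) = outer F (of_real x)"
  by (simp add: outer_def integral_cnj)

text \<open>Fejer--Riesz: the factor without zeros in the disc is the exponential of half the log-modulus
  and its conjugate, i.e. the Szego function of the weight \<open>1 / q\<close>.\<close>

lemma fejer_riesz:
  fixes q :: "real poly"
  assumes q: "\<And>x. x \<in> {-1..1} \<Longrightarrow> poly q x > 0"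
  obtains A R where "degree A \<le> degree q" "R > 1" "\<And>\<zeta>. \<zeta> \<in> ball 0 R \<Longrightarrow> poly (cpoly A) \<zeta> \<noteq> 0"
    "\<And>t. poly (cpoly A) (cis t) * poly (cpoly A) (cis (- t)) = of_real (poly q (cos t))"
    "\<And>\<xi>. norm \<xi> < 1 \<Longrightarrow> poly (cpoly A) \<xi> = exp (outer (\<lambda>t. ln (poly q (cos t))) \<xi>)"
    "\<And>t. t \<in> {0..pi} \<Longrightarrow> poly (cpoly A) (cis (- t)) =
        of_real (sqrt (poly q (cos t))) * cis (- conj_fun (\<lambda>t. ln (poly q (cos t))) t)"
proof -
  have ql: "poly (cpoly q) z \<noteq> 0" if "z \<in> slit" for z
    using that q by fastforce
  from fejer_riesz_complex[of "cpoly q", OF ql] obtain A R where A: "degree A \<le> degree (cpoly q)" "R > 1"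
    "\<And>\<zeta>. \<zeta> \<in> ball 0 R \<Longrightarrow> poly A \<zeta> \<noteq> 0"
    "\<And>\<zeta>. \<zeta> \<noteq> 0 \<Longrightarrow> poly (cpoly q) (joukowski \<zeta>) = poly A \<zeta> * poly A (1 / \<zeta>)" by blast
  have "(\<lambda>z. poly A z) holomorphic_on ball 0 R" by (intro holomorphic_intros)
  then obtain L where L: "L holomorphic_on ball 0 R" "\<And>z. z \<in> ball 0 R \<Longrightarrow> exp (L z) = poly A z"
    using holomorphic_logarithm_exists[of "ball 0 R" "poly A" 0] A(2,3) by auto
  have inR: "cis t \<in> ball 0 R" for t using A(2) by simp
  have pq: "poly A (cis t) * poly A (cis (- t)) = of_real (poly q (cos t))" for t
    using A(4)[of "cis t"] by (simp add: joukowski_cis cis_divide[symmetric] flip: cis_inverse inverse_eq_divide)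
  \<comment> \<open>exp (D t) = 1, so D takes values in the discrete set of multiples of 2 \<pi>
    \<i>; being continuous it is constant.\<close>
  define D where "D = (\<lambda>t. L (cis t) + L (cis (- t)) - of_real (ln (poly q (cos t))))"
  have qc: "poly q (cos t) > 0" for t by (rule q) auto
  have eD: "exp (D t) = 1" for t
    using pq[of t] qc[of t] by (simp add: D_def exp_add exp_diff L(2)[OF inR] exp_of_real)
  have Lc: "continuous_on UNIV (\<lambda>t. L (cis (s * t)))" for s :: real
    by (rule continuous_on_compose2[OF holomorphic_on_imp_continuous_on[OF L(1)]])
       (use inR in \<open>auto intro!: continuous_intros\<close>)
  have "D constant_on UNIV"
  proof (rule continuous_discrete_range_constant)
    show "continuous_on UNIV D"
      unfolding D_def using Lc[of 1] Lc[of "-1"] qc by (intro continuous_intros) (auto simp: less_imp_neq[symmetric])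
    fix x :: real
    show "\<exists>e>0. \<forall>y. y \<in> UNIV \<and> D y \<noteq> D x \<longrightarrow> e \<le> norm (D y - D x)"
    proof (intro exI[of _ "2 * pi"] conjI allI impI)
      fix y assume y: "y \<in> UNIV \<and> D y \<noteq> D x"
      have "exp (D y - D x) = 1" by (simp add: exp_diff eD)
      then obtain n :: int where n: "Re (D y - D x) = 0" "Im (D y - D x) = of_int (2 * n) * pi"
        using exp_eq_1 by blast
      then have "n \<noteq> 0" using y by (auto simp: complex_eq_iff)
      then have "1 \<le> \<bar>real_of_int n\<bar>" by linarith
      then have "2 * pi \<le> \<bar>Im (D y - D x)\<bar>" unfolding n(2) by (simp add: abs_mult)
      also have "\<dots> \<le> norm (D y - D x)" by (rule abs_Im_le_cmod)
      finally show "2 * pi \<le> norm (D y - D x)" .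
    qed auto
  qed auto
  then obtain c where c: "D t = c" for t unfolding constant_on_def by auto
  \<comment> \<open>Shifting the logarithm by half the constant makes the boundary sum exactly ln q.
    For A this is at most a change of sign.\<close>
  define L' where "L' = (\<lambda>z. L z + (- c / 2))"
  define A' where "A' = smult (exp (- c / 2)) A"
  have L': "L' holomorphic_on ball 0 R" unfolding L'_def by (intro holomorphic_intros L)
  have eL': "poly A' z = exp (L' z)" if "z \<in> ball 0 R" for z
    unfolding A'_def L'_def exp_add L(2)[OF that] by simp
  have sum: "L' (cis t) + L' (cis (- t)) = of_real (ln (poly q (cos t)))" for t
  proof -
    have "L' (cis t) + L' (cis (- t)) = D t + of_real (ln (poly q (cos t))) - (c / 2 + c / 2)"
      unfolding D_def L'_def by simp
    then show ?thesis unfolding c by simp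
  qed
  have A'out: "poly A' \<xi> = exp (outer (\<lambda>t. ln (poly q (cos t))) \<xi>)" if "norm \<xi> < 1" for \<xi>
  proof -
    have "outer (\<lambda>t. ln (poly q (cos t))) \<xi> = L' \<xi>"
      by (rule outer_eq_of_boundary[OF A(2) L' sum that])
    then show ?thesis using eL'[of \<xi>] that A(2) by simp
  qed
  \<comment> \<open>\<open>outer\<close> is real at real points, so A' is real on (0, 1) and
    therefore has real coefficients.\<close>
  have "poly A' (of_real x) \<in> \<real>" if "x \<in> {0<..<1}" for x :: real
    using A'out[of "of_real x"] that
    by (simp add: Reals_cnj_iff exp_cnj cnj_outer_of_real)
  then obtain B where B: "A' = cpoly B"
    using real_coeffs_of_real_values[of "{0<..<1}" A'] by auto
  obtain c' where c': "c' > 0" "\<And>x. x \<in> {-1..1} \<Longrightarrow> c' \<le> poly q x"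
  proof -
    have "\<exists>x\<in>{-1..1::real}. \<forall>y\<in>{-1..1}. poly q x \<le> poly q y"
      by (rule continuous_attains_inf) (auto intro!: continuous_intros)
    then show ?thesis using that q by metis
  qed
  obtain K where K: "\<And>x y. x \<in> {-1..1} \<Longrightarrow> y \<in> {-1..1} \<Longrightarrow> \<bar>poly q x - poly q y\<bar> \<le> K * \<bar>x - y\<bar>"
    using poly_lipschitz_Icc by blast
  have lip: "\<bar>ln (poly q x) - ln (poly q y)\<bar> \<le> K / c' * \<bar>x - y\<bar>" if "x \<in> {-1..1}" "y \<in> {-1..1}" for x y
  proof -
    have "\<bar>ln (poly q x) - ln (poly q y)\<bar> \<le> \<bar>poly q x - poly q y\<bar> / c'"
      by (rule abs_ln_diff_le) (use c' that in auto)
    also have "\<dots> \<le> K * \<bar>x - y\<bar> / c'" using K[OF that] c'(1) by (intro divide_right_mono) auto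
    finally show ?thesis by simp
  qed
  show ?thesis
  proof (rule that[of B R])
    show "degree B \<le> degree q"
    proof -
      have "degree A' \<le> degree A" by (simp add: A'_def degree_smult_le)
      then show ?thesis using A(1) by (simp add: B degree_map_poly)
    qed
    show "poly (cpoly B) \<zeta> \<noteq> 0" if "\<zeta> \<in> ball 0 R" for \<zeta>
      using eL'[OF that] by (simp add: B[symmetric])
    show "poly (cpoly B) (cis t) * poly (cpoly B) (cis (- t)) = of_real (poly q (cos t))" for t
      unfolding B[symmetric] eL'[OF inR] exp_add[symmetric] sum using qc by (simp add: exp_of_real)
    show "poly (cpoly B) \<xi> = exp (outer (\<lambda>t. ln (poly q (cos t))) \<xi>)" if "norm \<xi> < 1" for \<xi>
      using A'out[OF that] by (simp add: B)
    fix t assume t: "t \<in> {0..pi}"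
    have "L' (cis (- t)) = of_real (ln (poly q (cos t)) / 2) - \<i> * of_real (conj_fun (\<lambda>t. ln (poly q (cos t))) t)"
      by (rule boundary_value[OF A(2) L' lip sum t])
    moreover have "exp (complex_of_real x - \<i> * of_real y) = of_real (exp x) * cis (- y)" for x y :: real
      unfolding cis_conv_exp exp_of_real[symmetric] exp_add[symmetric] by simp
    moreover have "exp (ln (poly q (cos t)) / 2) = sqrt (poly q (cos t))"
    proof -
      have "ln (poly q (cos t)) / 2 = ln (sqrt (poly q (cos t)))"
        using qc[of t] by (simp add: ln_sqrt)
      then show ?thesis using qc[of t] by simp
    qed
    ultimately show "poly (cpoly B) (cis (- t)) =
        of_real (sqrt (poly q (cos t))) * cis (- conj_fun (\<lambda>t. ln (poly q (cos t))) t)"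
      unfolding B[symmetric] eL'[OF inR] by (simp only:)
  qed (rule A(2))
qed

subsection \<open>The Jackson kernel\<close>

lemma chebyshev_poly_exists:
  "\<exists>p::real poly. degree p \<le> k \<and> (\<forall>t. poly p (cos t) = cos (real k * t))"
proof (induction k rule: less_induct)
  case (less k)
  show ?case
  proof (cases "k \<le> 1")
    case True
    then consider "k = 0" | "k = 1" by linarith
    then show ?thesis
    proof cases
      case 1 then show ?thesis by (intro exI[of _ 1]) auto
    next
      case 2 then show ?thesis by (intro exI[of _ "[:0, 1:]"]) auto
    qed
  next
    case False
    then obtain j where k: "k = Suc (Suc j)" by (metis One_nat_def not0_implies_Suc not_less_eq_eq le0)
    from less[of "Suc j"] less[of j] obtain p r where p: "degree p \<le> Suc j" "\<And>t. poly p (cos t) = cos (real (Suc j) * t)"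
      and r: "degree r \<le> j" "\<And>t. poly r (cos t) = cos (real j * t)" unfolding k by auto
    show ?thesis
    proof (intro exI[of _ "[:0, 2:] * p - r"] conjI allI)
      have "degree ([:0, 2:] * p) \<le> 1 + degree p" using degree_mult_le[of "[:0, 2:]" p] by simp
      then show "degree ([:0, 2:] * p - r) \<le> k" using p r k by (intro degree_diff_le) auto
      fix t
      have "real k * t = real (Suc j) * t + t" "real j * t = real (Suc j) * t - t"
        unfolding k by (simp_all add: algebra_simps)
      then have "cos (real k * t) + cos (real j * t) = 2 * cos (real (Suc j) * t) * cos t"
        by (simp only: cos_add cos_diff)
      then show "poly ([:0, 2:] * p - r) (cos t) = cos (real k * t)"
        by (simp add: p r algebra_simps)
    qed
  qed
qed

lemma chebyshev_poly_int:
  obtains p :: "real poly" where "degree p \<le> nat \<bar>a\<bar>" "\<And>t. poly p (cos t) = cos (of_int a * t)"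
proof -
  obtain p :: "real poly" where p: "degree p \<le> nat \<bar>a\<bar>" "\<And>t. poly p (cos t) = cos (real (nat \<bar>a\<bar>) * t)"
    using chebyshev_poly_exists by blast
  have "cos (real (nat \<bar>a\<bar>) * t) = cos (of_int a * t)" for t
    by (cases "a \<ge> 0") (auto simp: abs_if)
  then show ?thesis using that[of p] p by simp
qed

lemma abs_cos_diff_le:
  fixes a b :: real
  shows "\<bar>cos a - cos b\<bar> \<le> \<bar>a - b\<bar>"
proof -
  have "\<bar>cos a - cos b\<bar> = 2 * (\<bar>sin ((a + b) / 2)\<bar> * \<bar>sin ((b - a) / 2)\<bar>)"
    by (simp add: cos_diff_cos abs_mult)
  also have "\<dots> \<le> 2 * (1 * \<bar>(b - a) / 2\<bar>)"
    by (intro mult_left_mono mult_mono abs_sin_x_le_abs_x) auto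
  finally show ?thesis by simp
qed

definition dirichlet_sum :: "nat \<Rightarrow> real \<Rightarrow> complex" where
  "dirichlet_sum n u = (\<Sum>k<n. cis (real k * u))"

text \<open>The fourth power of sin (n u/2) / sin (u/2), not normalized. For the square, the Fejer
  kernel, the first moment would carry a logarithm.\<close>

definition jackson_kernel :: "nat \<Rightarrow> real \<Rightarrow> real" where
  "jackson_kernel n u = norm (dirichlet_sum n u) ^ 4"

lemma norm_one_minus_cis: "norm (1 - cis u) = 2 * \<bar>sin (u / 2)\<bar>"
proof -
  have "1 - cis u = cis (u / 2) * (- 2 * \<i> * of_real (sin (u / 2)))"
  proof -
    have "- 2 * \<i> * of_real (sin (u / 2)) = cis (- (u / 2)) - cis (u / 2)"
      by (simp add: complex_eq_iff)
    then show ?thesis by (simp add: right_diff_distrib cis_mult)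
  qed
  then show ?thesis by (simp add: norm_mult)
qed

lemma dirichlet_sum_bounds:
  shows "norm (dirichlet_sum n u) \<le> real n"
    and "norm (dirichlet_sum n u) * \<bar>sin (u / 2)\<bar> \<le> 1"
proof -
  have "norm (dirichlet_sum n u) \<le> (\<Sum>k<n. norm (cis (real k * u)))"
    unfolding dirichlet_sum_def by (rule norm_sum)
  then show "norm (dirichlet_sum n u) \<le> real n" by simp
  have "dirichlet_sum n u = (\<Sum>k<n. cis u ^ k)" unfolding dirichlet_sum_def by (intro sum.cong refl) (rule Complex.DeMoivre[symmetric])
  then have "(1 - cis u) * dirichlet_sum n u = 1 - cis u ^ n"
    by (simp only: one_diff_power_eq)
  then have "(1 - cis u) * dirichlet_sum n u = 1 - cis (real n * u)"
    by (simp only: Complex.DeMoivre)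
  then have "norm (1 - cis u) * norm (dirichlet_sum n u) = norm (1 - cis (real n * u))"
    by (metis norm_mult)
  also have "\<dots> \<le> 2" using norm_triangle_ineq4[of 1 "cis (real n * u)"] by simp
  finally show "norm (dirichlet_sum n u) * \<bar>sin (u / 2)\<bar> \<le> 1"
    unfolding norm_one_minus_cis by (simp add: mult_ac)
qed

lemma continuous_on_jackson_kernel: "continuous_on A (jackson_kernel n)"
  unfolding jackson_kernel_def dirichlet_sum_def by (intro continuous_intros)

lemma jackson_kernel_nonneg: "jackson_kernel n u \<ge> 0"
  by (simp add: jackson_kernel_def)

text \<open>The bounds n and 4/\<bar>u\<bar> for the sum add up to norm times (1 + n \<bar>u\<bar>)
  \<le> 5 n, whence 625 = 5^4. One of the four factors 1 + n \<bar>u\<bar> stays on the left for the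
  first moment.\<close>

lemma jackson_kernel_upper:
  assumes "\<bar>u\<bar> \<le> pi"
  shows "(1 + real n * \<bar>u\<bar>) * jackson_kernel n u \<le> 625 * real n ^ 4 / (1 + real n * \<bar>u\<bar>) ^ 3"
proof -
  let ?d = "norm (dirichlet_sum n u)" and ?y = "1 + real n * \<bar>u\<bar>"
  have y: "?y > 0" by (intro add_pos_nonneg) auto
  have "?d * (\<bar>u\<bar> / 4) \<le> ?d * \<bar>sin (u / 2)\<bar>"
    using abs_sin_half_ge[OF assms] by (intro mult_left_mono) auto
  then have "?d * \<bar>u\<bar> \<le> 4" using dirichlet_sum_bounds(2)[of n u] by simp
  then have "real n * (?d * \<bar>u\<bar>) \<le> real n * 4" by (intro mult_left_mono) auto
  then have "?d * ?y \<le> 5 * real n"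
    using dirichlet_sum_bounds(1)[of n u] by (simp add: algebra_simps)
  then have "(?d * ?y) ^ 4 \<le> (5 * real n) ^ 4" using y by (intro power_mono) auto
  then have "(?y * jackson_kernel n u) * ?y ^ 3 \<le> 625 * real n ^ 4"
    by (simp add: jackson_kernel_def power_mult_distrib power_numeral_reduce mult_ac)
  then show ?thesis using y by (simp add: pos_le_divide_eq)
qed

lemma jackson_moment:
  assumes n: "n \<ge> 1"
  shows "integral {-pi..pi} (\<lambda>u. (1 + real n * \<bar>u\<bar>) * jackson_kernel n u) \<le> 625 * real n ^ 3"
proof -
  let ?f = "\<lambda>u. 625 * real n ^ 4 / (1 + real n * \<bar>u\<bar>) ^ 3"
  let ?\<Psi> = "\<lambda>u::real. (625/2) * real n ^ 3 / (1 + real n * u)\<^sup>2"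
  have p: "0 < 1 + real n * u" if "0 \<le> u" for u using that by (intro add_pos_nonneg) auto
  have 1: "(?f has_integral (- ?\<Psi> pi - (- ?\<Psi> 0))) {0..pi}"
  proof (rule fundamental_theorem_of_calculus)
    fix u assume u: "u \<in> {0..pi}"
    have d1: "((\<lambda>Y. - (a / Y\<^sup>2)) has_real_derivative 2 * a / Y ^ 3) (at Y)" if "Y \<noteq> 0" for a Y :: real
      using that by (auto intro!: derivative_eq_intros simp: field_simps power_numeral_reduce)
    have d2: "((\<lambda>u. 1 + real n * u) has_real_derivative real n) (at u within {0..pi})"
      by (auto intro!: derivative_eq_intros)
    have "((\<lambda>u. - ?\<Psi> u) has_real_derivative 2 * (625/2 * real n ^ 3) / (1 + real n * u) ^ 3 * real n) (at u within {0..pi})"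
      by (rule DERIV_chain2[OF d1 d2]) (use u p[of u] in auto)
    moreover have "2 * (625/2 * real n ^ 3) / (1 + real n * u) ^ 3 * real n = ?f u"
      using u by (simp add: power_numeral_reduce)
    ultimately have "((\<lambda>u. - ?\<Psi> u) has_real_derivative ?f u) (at u within {0..pi})" by simp
    then show "((\<lambda>u. - ?\<Psi> u) has_vector_derivative ?f u) (at u within {0..pi})"
      by (simp add: has_real_derivative_iff_has_vector_derivative)
  qed simp
  have "((\<lambda>u. ?f (- u)) has_integral (- ?\<Psi> pi - (- ?\<Psi> 0))) {-pi..-0}"
    using 1 has_integral_reflect_real by fastforce
  then have 2: "(?f has_integral (- ?\<Psi> pi - (- ?\<Psi> 0))) {-pi..0}" by simp
  have 3: "(?f has_integral 2 * (?\<Psi> 0 - ?\<Psi> pi)) {-pi..pi}"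
    using has_integral_combine[OF _ _ 2 1] by simp
  have "integral {-pi..pi} (\<lambda>u. (1 + real n * \<bar>u\<bar>) * jackson_kernel n u) \<le> integral {-pi..pi} ?f"
    by (rule integral_le)
       (use 3 jackson_kernel_upper p[of "\<bar>_\<bar>"] in \<open>auto simp: less_imp_neq[symmetric] intro!: integrable_continuous_real continuous_intros continuous_on_jackson_kernel\<close>)
  also have "\<dots> = 2 * (?\<Psi> 0 - ?\<Psi> pi)" by (rule integral_unique[OF 3])
  also have "\<dots> \<le> 2 * ?\<Psi> 0" by simp
  also have "\<dots> = 625 * real n ^ 3" by simp
  finally show ?thesis .
qed

text \<open>For u in [0, 1/n] all frequencies satisfy k u \<le> 1 < \<pi>/3, so every cosine is at
  least 1/2 and the sum at least n/2. An interval of length 1/n already gives the bound.\<close>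

lemma jackson_mass:
  assumes n: "n \<ge> 1"
  shows "real n ^ 3 / 16 \<le> integral {-pi..pi} (jackson_kernel n)"
proof -
  have "1 / real n \<le> 1" using n by simp
  then have sub: "1 / real n \<le> pi" using pi_gt3 by linarith
  have "integral {0..1 / real n} (\<lambda>_. (real n / 2) ^ 4) \<le> integral {0..1 / real n} (jackson_kernel n)"
  proof (rule integral_le)
    fix u assume u: "u \<in> {0..1 / real n}"
    have "real n / 2 = (\<Sum>k<n. 1 / 2 :: real)" by simp
    also have "\<dots> \<le> (\<Sum>k<n. cos (real k * u))"
    proof (rule sum_mono)
      fix k assume "k \<in> {..<n}"
      then have "real k * u \<le> real n * (1 / real n)" using u by (intro mult_mono) auto
      then have "real k * u \<le> pi / 3" using n pi_gt3 by simp
      then have "cos (pi / 3) \<le> cos (real k * u)" using u by (intro cos_monotone_0_pi_le) auto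
      then show "1 / 2 \<le> cos (real k * u)" by (simp add: cos_60)
    qed
    also have "\<dots> = Re (dirichlet_sum n u)" by (simp add: dirichlet_sum_def)
    also have "\<dots> \<le> norm (dirichlet_sum n u)" by (rule complex_Re_le_cmod)
    finally show "(real n / 2) ^ 4 \<le> jackson_kernel n u"
      unfolding jackson_kernel_def by (intro power_mono) auto
  qed (auto intro!: integrable_continuous_real continuous_on_jackson_kernel)
  also have "\<dots> \<le> integral {-pi..pi} (jackson_kernel n)"
    using sub by (intro integral_subset_le integrable_continuous_real continuous_on_jackson_kernel)
      (auto simp: jackson_kernel_nonneg)
  finally show ?thesis using n by (simp add: power_numeral_reduce)
qed

lemma sum_prod_distrib_pairs:
  "(\<Sum>x\<in>A. f x) * (\<Sum>y\<in>B. g y) = (\<Sum>p\<in>A \<times> B. f (fst p) * g (snd p) :: real)"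
  by (simp add: sum_product sum.cartesian_product case_prod_beta)

text \<open>The squared modulus of the sum is a double sum of cosines of frequency below n in
  absolute value; squaring again and using the product formula at most doubles the
  frequencies.\<close>

lemma jackson_kernel_fourier:
  obtains P :: "(nat \<times> nat) set" and \<alpha> :: "(nat \<times> nat) \<times> (nat \<times> nat) \<Rightarrow> int" and \<beta>
    where "finite P" "\<And>x. x \<in> P \<times> P \<Longrightarrow> \<bar>\<alpha> x\<bar> \<le> 2 * int n \<and> \<bar>\<beta> x\<bar> \<le> 2 * int n"
    "\<And>u. jackson_kernel n u = (\<Sum>x\<in>P \<times> P. cos (of_int (\<alpha> x) * u) / 2 + cos (of_int (\<beta> x) * u) / 2)"
proof -
  define P where "P = {..<n} \<times> {..<n}"
  define \<delta> where "\<delta> = (\<lambda>p. int (fst p) - int (snd p))"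
  have sq: "(norm (dirichlet_sum n u))\<^sup>2 = (\<Sum>p\<in>P. cos (of_int (\<delta> p) * u))" for u
  proof -
    have "complex_of_real ((norm (dirichlet_sum n u))\<^sup>2) = dirichlet_sum n u * cnj (dirichlet_sum n u)"
      by (rule complex_norm_square)
    also have "\<dots> = (\<Sum>p\<in>P. cis (real (fst p) * u) * cis (- (real (snd p) * u)))"
      by (simp add: dirichlet_sum_def P_def cis_cnj sum_product sum.cartesian_product case_prod_beta)
    also have "\<dots> = (\<Sum>p\<in>P. cis (of_int (\<delta> p) * u))"
      by (simp add: cis_mult \<delta>_def algebra_simps)
    finally have "Re (complex_of_real ((norm (dirichlet_sum n u))\<^sup>2)) = Re (\<Sum>p\<in>P. cis (of_int (\<delta> p) * u))" by simp
    then show ?thesis by simp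
  qed
  show ?thesis
  proof (rule that[of P "\<lambda>x. \<delta> (fst x) - \<delta> (snd x)" "\<lambda>x. \<delta> (fst x) + \<delta> (snd x)"])
    show "finite P" by (simp add: P_def)
    show "\<bar>\<delta> (fst x) - \<delta> (snd x)\<bar> \<le> 2 * int n \<and> \<bar>\<delta> (fst x) + \<delta> (snd x)\<bar> \<le> 2 * int n" if "x \<in> P \<times> P" for x
      using that by (auto simp: P_def \<delta>_def)
    fix u
    have "jackson_kernel n u = (norm (dirichlet_sum n u))\<^sup>2 * (norm (dirichlet_sum n u))\<^sup>2"
      by (simp add: jackson_kernel_def flip: power_add)
    also have "\<dots> = (\<Sum>x\<in>P \<times> P. cos (of_int (\<delta> (fst x)) * u) * cos (of_int (\<delta> (snd x)) * u))"
      unfolding sq by (rule sum_prod_distrib_pairs)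
    also have "\<dots> = (\<Sum>x\<in>P \<times> P. cos (of_int (\<delta> (fst x) - \<delta> (snd x)) * u) / 2 + cos (of_int (\<delta> (fst x) + \<delta> (snd x)) * u) / 2)"
      by (intro sum.cong) (auto simp: cos_times_cos algebra_simps add_divide_distrib)
    finally show "jackson_kernel n u = \<dots>" .
  qed
qed

lemma integral_periodic_shift:
  fixes f :: "real \<Rightarrow> real"
  assumes f: "continuous_on UNIV f" "\<And>x. f (x + p) = f x" and ab: "a \<le> b" "b \<le> a + p"
  shows "integral {a..a + p} f = integral {b..b + p} f"
proof -
  have i: "f integrable_on {x..y}" for x y
    by (intro integrable_continuous_real continuous_on_subset[OF f(1)]) auto
  have "integral {a..a + p} f = integral {a..b} f + integral {b..a + p} f"
    using ab i by (intro Henstock_Kurzweil_Integration.integral_combine[symmetric]) auto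
  moreover have "integral {b..b + p} f = integral {b..a + p} f + integral {a + p..b + p} f"
    using ab i by (intro Henstock_Kurzweil_Integration.integral_combine[symmetric]) auto
  moreover have "integral {a + p..b + p} f = integral {a..b} f"
    using integral_shift_Icc_real[of a b f p] f(2) by (simp add: o_def add.commute)
  ultimately show ?thesis by simp
qed

text \<open>By periodicity the integral runs over a fixed period, and g (cos s) is even, so the sine
  part drops out. Convolving with a cosine polynomial therefore yields a polynomial in cos
  t.\<close>

lemma convolution_cos:
  fixes g :: "real \<Rightarrow> real"
  assumes g: "continuous_on {-1..1} g" and t: "t \<in> {0..pi}"
  shows "integral {-pi..pi} (\<lambda>u. g (cos (t - u)) * cos (of_int a * u))
    = cos (of_int a * t) * integral {-pi..pi} (\<lambda>s. g (cos s) * cos (of_int a * s))"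
proof -
  let ?h = "\<lambda>s. g (cos s) * cos (of_int a * (t - s))"
  have c: "continuous_on A (\<lambda>s. g (cos s))" for A by (rule continuous_on_comp_cos[OF g])
  have hc: "continuous_on A ?h" for A by (intro continuous_intros c)
  have per: "?h (s + 2 * pi) = ?h s" for s
  proof -
    have "of_int a * (t - (s + 2 * pi)) = of_int a * (t - s) - 2 * pi * of_int a" by (simp add: algebra_simps)
    then show ?thesis using cos_int_2pin[of a] sin_int_2pin[of a] by (simp add: cos_diff)
  qed
  have "((\<lambda>u. ?h (t - u)) has_integral integral {t - pi..t + pi} ?h) {-pi..pi}"
  proof -
    have "(?h has_integral integral {t - pi..t + pi} ?h) {t - pi..t + pi}"
      by (intro integrable_integral integrable_continuous_real hc)
    then have "((\<lambda>s. ?h (t + s)) has_integral integral {t - pi..t + pi} ?h) {-pi..pi}"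
      using has_integral_shift_Icc_real[of ?h t _ "-pi" pi] by (simp add: o_def add.commute)
    then have "((\<lambda>s. ?h (t + (- s))) has_integral integral {t - pi..t + pi} ?h) {-pi..- (-pi)}"
      by (subst has_integral_reflect_real) simp
    then show ?thesis by simp
  qed
  then have "integral {-pi..pi} (\<lambda>u. g (cos (t - u)) * cos (of_int a * u)) = integral {t - pi..t + pi} ?h"
    by (intro integral_unique) (simp add: algebra_simps)
  also have "\<dots> = integral {-pi..pi} ?h"
    using integral_periodic_shift[OF hc per, of "-pi" "t - pi"] t by (simp add: algebra_simps)
  also have "\<dots> = integral {-pi..pi} (\<lambda>s. cos (of_int a * t) * (g (cos s) * cos (of_int a * s)) + sin (of_int a * t) * (g (cos s) * sin (of_int a * s)))"
    by (intro Henstock_Kurzweil_Integration.integral_cong) (simp add: right_diff_distrib cos_diff algebra_simps)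
  also have "\<dots> = cos (of_int a * t) * integral {-pi..pi} (\<lambda>s. g (cos s) * cos (of_int a * s))
      + sin (of_int a * t) * integral {-pi..pi} (\<lambda>s. g (cos s) * sin (of_int a * s))"
    by (subst integral_add) (auto intro!: integrable_continuous_real continuous_intros c)
  also have "integral {-pi..pi} (\<lambda>s. g (cos s) * sin (of_int a * s)) = 0"
  proof -
    let ?f = "\<lambda>s. g (cos s) * sin (of_int a * s)"
    have f: "(?f has_integral integral {-pi..pi} ?f) {-pi..pi}"
      by (intro integrable_integral integrable_continuous_real continuous_intros c)
    then have "((\<lambda>s. ?f (- s)) has_integral integral {-pi..pi} ?f) {-pi..-(-pi)}"
      by (subst has_integral_reflect_real) simp
    then have "((\<lambda>s. - ?f s) has_integral integral {-pi..pi} ?f) {-pi..pi}" by simp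
    with has_integral_neg[OF f] have "integral {-pi..pi} ?f = - integral {-pi..pi} ?f"
      by (rule has_integral_unique[THEN sym])
    then show ?thesis by linarith
  qed
  finally show ?thesis by simp
qed

text \<open>p is the normalized convolution of g (cos t) with the kernel and does not depend on W or
  K, so the constants are quantified inside. Averaging translates in t preserves Lipschitz
  constants, which gives the second estimate.\<close>

lemma jackson_operator:
  fixes g :: "real \<Rightarrow> real"
  assumes n: "n \<ge> 1" and g: "continuous_on {-1..1} g"
  shows "\<exists>p. degree p \<le> 2 * n \<and>
    (\<forall>W. (\<forall>x\<in>{-1..1}. \<forall>y\<in>{-1..1}. \<bar>g x - g y\<bar> \<le> W * (1 + real n * \<bar>x - y\<bar>)) \<longrightarrow>
        (\<forall>x\<in>{-1..1}. \<bar>g x - poly p x\<bar> \<le> 10000 * W)) \<and>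
    (\<forall>K. (\<forall>x\<in>{-1..1}. \<forall>y\<in>{-1..1}. \<bar>g x - g y\<bar> \<le> K * \<bar>x - y\<bar>) \<longrightarrow>
        (\<forall>s\<in>{0..pi}. \<forall>t\<in>{0..pi}. \<bar>poly p (cos s) - poly p (cos t)\<bar> \<le> K * \<bar>s - t\<bar>))"
proof -
  let ?J = "jackson_kernel n"
  define c where "c = integral {-pi..pi} ?J"
  have c: "real n ^ 3 / 16 \<le> c" unfolding c_def by (rule jackson_mass[OF n])
  have c0: "c > 0" by (rule less_le_trans[OF _ c]) (use n in simp)
  have gc: "continuous_on A (\<lambda>u. g (cos (t - u)))" for A and t :: real
    by (rule continuous_on_compose2[OF g]) (auto intro!: continuous_intros)
  have int1: "(\<lambda>u. g (cos (t - u)) * ?J u) integrable_on {-pi..pi}" for t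
    by (intro integrable_continuous_real continuous_intros gc continuous_on_jackson_kernel)
  define q where "q = (\<lambda>t. integral {-pi..pi} (\<lambda>u. g (cos (t - u)) * ?J u) / c)"
  obtain P :: "(nat \<times> nat) set" and \<alpha> :: "(nat \<times> nat) \<times> (nat \<times> nat) \<Rightarrow> int" and \<beta> where
    P: "finite P" "\<And>x. x \<in> P \<times> P \<Longrightarrow> \<bar>\<alpha> x\<bar> \<le> 2 * int n \<and> \<bar>\<beta> x\<bar> \<le> 2 * int n"
    "\<And>u. ?J u = (\<Sum>x\<in>P \<times> P. cos (of_int (\<alpha> x) * u) / 2 + cos (of_int (\<beta> x) * u) / 2)"
    by (rule jackson_kernel_fourier[of n]) (rule that, assumption, assumption, assumption)
  define I where "I = (\<lambda>a::int. integral {-pi..pi} (\<lambda>s. g (cos s) * cos (of_int a * s)))"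
  define T where "T = (\<lambda>a::int. SOME p::real poly. degree p \<le> nat \<bar>a\<bar> \<and> (\<forall>t. poly p (cos t) = cos (of_int a * t)))"
  have T: "degree (T a) \<le> nat \<bar>a\<bar>" "poly (T a) (cos t) = cos (of_int a * t)" for a t
  proof -
    have "\<exists>p::real poly. degree p \<le> nat \<bar>a\<bar> \<and> (\<forall>t. poly p (cos t) = cos (of_int a * t))"
      using chebyshev_poly_int[of a] by metis
    from someI_ex[OF this] show "degree (T a) \<le> nat \<bar>a\<bar>" "poly (T a) (cos t) = cos (of_int a * t)"
      by (auto simp: T_def)
  qed
  define p where "p = smult (1 / c) (\<Sum>x\<in>P \<times> P. smult (I (\<alpha> x) / 2) (T (\<alpha> x)) + smult (I (\<beta> x) / 2) (T (\<beta> x)))"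
  have pq: "poly p (cos t) = q t" if t: "t \<in> {0..pi}" for t
  proof -
    have ia: "(\<lambda>u. g (cos (t - u)) * (cos (of_int a * u) / 2)) integrable_on {-pi..pi}" for a :: int
      by (intro integrable_continuous_real continuous_intros gc) auto
    have I2: "integral {-pi..pi} (\<lambda>u. g (cos (t - u)) * (cos (of_int a * u) / 2)) = I a / 2 * cos (of_int a * t)" for a
      using convolution_cos[OF g t, of a] by (simp add: I_def)
    have "integral {-pi..pi} (\<lambda>u. g (cos (t - u)) * ?J u)
      = integral {-pi..pi} (\<lambda>u. \<Sum>x\<in>P \<times> P. g (cos (t - u)) * (cos (of_int (\<alpha> x) * u) / 2) + g (cos (t - u)) * (cos (of_int (\<beta> x) * u) / 2))"
      unfolding P(3) sum_distrib_left distrib_left ..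
    also have "\<dots> = (\<Sum>x\<in>P \<times> P. I (\<alpha> x) / 2 * cos (of_int (\<alpha> x) * t) + I (\<beta> x) / 2 * cos (of_int (\<beta> x) * t))"
      by (subst integral_sum)
         (use P(1) in \<open>auto simp only: integral_add[OF ia ia] I2 finite_cartesian_product intro!: integrable_add ia sum.cong\<close>)
    finally show ?thesis
      by (simp add: q_def p_def poly_sum T(2))
  qed
  show ?thesis
  proof (intro exI[of _ p] conjI allI impI ballI)
    have *: "degree (T a) \<le> 2 * n" if "\<bar>a\<bar> \<le> 2 * int n" for a
      using T(1)[of a] that by linarith
    show "degree p \<le> 2 * n"
      unfolding p_def by (intro order.trans[OF degree_smult_le] degree_sum_le degree_add_le *) (use P(1,2) in auto)
  next
    fix W x assume W0: "\<forall>x\<in>{-1..1}. \<forall>y\<in>{-1..1}. \<bar>g x - g y\<bar> \<le> W * (1 + real n * \<bar>x - y\<bar>)"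
      and x: "x \<in> {-1..1::real}"
    have W: "\<bar>g x - g y\<bar> \<le> W * (1 + real n * \<bar>x - y\<bar>)" if "x \<in> {-1..1}" "y \<in> {-1..1}" for x y
      using W0 that by blast
    define t where "t = arccos x"
    have t: "t \<in> {0..pi}" "cos t = x" using x by (auto simp: t_def arccos_lbound arccos_ubound)
    have W0: "W \<ge> 0" using W[of 0 0] by simp
    have "(\<lambda>u. (g x - g (cos (t - u))) * ?J u) = (\<lambda>u. g x * ?J u - g (cos (t - u)) * ?J u)"
      by (simp add: left_diff_distrib)
    then have "c * (g x - q t) = integral {-pi..pi} (\<lambda>u. (g x - g (cos (t - u))) * ?J u)"
      using c0 int1[of t] by (simp add: q_def c_def right_diff_distrib integral_diff
          integrable_continuous_real continuous_on_jackson_kernel integrable_on_mult_right)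
    moreover have "norm (integral {-pi..pi} (\<lambda>u. (g x - g (cos (t - u))) * ?J u))
       \<le> integral {-pi..pi} (\<lambda>u. W * ((1 + real n * \<bar>u\<bar>) * ?J u))"
    proof (rule integral_norm_bound_integral)
      fix u assume "u \<in> {-pi..pi}"
      have "\<bar>x - cos (t - u)\<bar> \<le> \<bar>u\<bar>"
        using abs_cos_diff_le[of t "t - u"] t(2) by simp
      then have "W * (1 + real n * \<bar>x - cos (t - u)\<bar>) \<le> W * (1 + real n * \<bar>u\<bar>)"
        using W0 by (intro mult_left_mono add_left_mono) auto
      then have "\<bar>g x - g (cos (t - u))\<bar> \<le> W * (1 + real n * \<bar>u\<bar>)"
        using W[of x "cos (t - u)"] x by simp
      then show "norm ((g x - g (cos (t - u))) * ?J u) \<le> W * ((1 + real n * \<bar>u\<bar>) * ?J u)"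
        using jackson_kernel_nonneg[of n u] mult_right_mono by (fastforce simp: abs_mult)
    qed (intro integrable_continuous_real continuous_intros gc continuous_on_jackson_kernel)+
    moreover have "\<dots> \<le> W * (625 * real n ^ 3)"
      unfolding integral_mult_right using jackson_moment[OF n] W0 by (intro mult_left_mono)
    \<comment> \<open>The ratio of first moment to mass: 625 divided by 1/16 is 10000.\<close>
    moreover have "W * (625 * real n ^ 3) \<le> 10000 * W * c"
      using mult_left_mono[OF c, of "10000 * W"] W0 by simp
    ultimately have "\<bar>c * (g x - q t)\<bar> \<le> 10000 * W * c" by simp
    then have "c * \<bar>g x - q t\<bar> \<le> c * (10000 * W)" using c0 by (simp add: abs_mult mult_ac)
    then show "\<bar>g x - poly p x\<bar> \<le> 10000 * W"
      using c0 pq[OF t(1)] t(2) by simp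
  next
    fix K s t assume K0: "\<forall>x\<in>{-1..1}. \<forall>y\<in>{-1..1}. \<bar>g x - g y\<bar> \<le> K * \<bar>x - y\<bar>"
      and st: "s \<in> {0..pi}" "t \<in> {0..pi}"
    have K: "\<bar>g x - g y\<bar> \<le> K * \<bar>x - y\<bar>" if "x \<in> {-1..1}" "y \<in> {-1..1}" for x y
      using K0 that by blast
    have K0: "K \<ge> 0" using K[of 0 1] by simp
    have "(\<lambda>u. (g (cos (s - u)) - g (cos (t - u))) * ?J u) = (\<lambda>u. g (cos (s - u)) * ?J u - g (cos (t - u)) * ?J u)"
      by (simp add: left_diff_distrib)
    then have "c * (q s - q t) = integral {-pi..pi} (\<lambda>u. (g (cos (s - u)) - g (cos (t - u))) * ?J u)"
      using c0 int1 by (simp add: q_def right_diff_distrib integral_diff)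
    moreover have "norm (integral {-pi..pi} (\<lambda>u. (g (cos (s - u)) - g (cos (t - u))) * ?J u))
       \<le> integral {-pi..pi} (\<lambda>u. K * \<bar>s - t\<bar> * ?J u)"
    proof (rule integral_norm_bound_integral)
      fix u assume "u \<in> {-pi..pi}"
      have "\<bar>cos (s - u) - cos (t - u)\<bar> \<le> \<bar>s - t\<bar>"
        using abs_cos_diff_le[of "s - u" "t - u"] by simp
      then have "K * \<bar>cos (s - u) - cos (t - u)\<bar> \<le> K * \<bar>s - t\<bar>"
        using K0 by (intro mult_left_mono) auto
      then have "\<bar>g (cos (s - u)) - g (cos (t - u))\<bar> \<le> K * \<bar>s - t\<bar>"
        using K[of "cos (s - u)" "cos (t - u)"] by simp
      then show "norm ((g (cos (s - u)) - g (cos (t - u))) * ?J u) \<le> K * \<bar>s - t\<bar> * ?J u"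
        using jackson_kernel_nonneg[of n u] mult_right_mono by (fastforce simp: abs_mult)
    qed (intro integrable_continuous_real continuous_intros gc continuous_on_jackson_kernel)+
    ultimately have "\<bar>c * (q s - q t)\<bar> \<le> K * \<bar>s - t\<bar> * c" by (simp add: c_def)
    then have "c * \<bar>q s - q t\<bar> \<le> c * (K * \<bar>s - t\<bar>)" using c0 by (simp add: abs_mult mult_ac)
    then show "\<bar>poly p (cos s) - poly p (cos t)\<bar> \<le> K * \<bar>s - t\<bar>"
      using c0 pq st by simp
  qed
qed


subsection \<open>Approximation of smooth functions together with their first derivative\<close>

lemma poly_antiderivative:
  fixes p :: "real poly"
  obtains P where "pderiv P = p" "degree P \<le> Suc (degree p)"
proof -
  define P where "P = (\<Sum>i\<le>degree p. monom (coeff p i / real (Suc i)) (Suc i))"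
  have "pderiv P = (\<Sum>i\<le>degree p. monom (coeff p i) i)"
    unfolding P_def by (simp add: higher_pderiv_sum[of 1, simplified] pderiv_monom del: of_nat_Suc)
  also have "\<dots> = p" by (rule poly_as_sum_of_monoms)
  finally have "pderiv P = p" .
  moreover have "degree P \<le> Suc (degree p)"
    unfolding P_def by (intro degree_sum_le) (auto intro: order.trans[OF degree_monom_le])
  ultimately show ?thesis by (rule that)
qed

text \<open>Subtracting a primitive of the polynomial for F' leaves a function of Lipschitz constant
  E, which the Jackson operator approximates to order E/n. In t the approximant has the same
  Lipschitz constant, so the final error has constant 2 E.\<close>

lemma jackson_step:
  fixes F F' :: "real \<Rightarrow> real"
  assumes n: "n \<ge> 1"
    and F: "\<And>x. x \<in> {-1..1} \<Longrightarrow> (F has_real_derivative F' x) (at x within {-1..1})"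
    and p: "\<And>x. x \<in> {-1..1} \<Longrightarrow> \<bar>F' x - poly p x\<bar> \<le> E" "degree p \<le> d" "2 * n \<le> Suc d"
  obtains r where "degree r \<le> Suc d" "\<And>x. x \<in> {-1..1} \<Longrightarrow> \<bar>F x - poly r x\<bar> \<le> 10000 * (E / real n)"
    "\<And>s t. s \<in> {0..pi} \<Longrightarrow> t \<in> {0..pi} \<Longrightarrow>
       \<bar>(F (cos s) - poly r (cos s)) - (F (cos t) - poly r (cos t))\<bar> \<le> 2 * E * \<bar>s - t\<bar>"
proof -
  obtain P where P: "pderiv P = p" "degree P \<le> Suc (degree p)" by (rule poly_antiderivative)
  define g where "g = (\<lambda>x. F x - poly P x)"
  have E: "E \<ge> 0" using p(1)[of 0] by auto
  have lip: "\<bar>g x - g y\<bar> \<le> E * \<bar>x - y\<bar>" if "x \<in> {-1..1}" "y \<in> {-1..1}" for x y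
  proof -
    have "norm (g x - g y) \<le> E * norm (x - y)"
    proof (rule field_differentiable_bound[of "{-1..1}" g "\<lambda>x. F' x - poly p x"])
      fix x :: real assume "x \<in> {-1..1}"
      then show "(g has_field_derivative F' x - poly p x) (at x within {-1..1})"
        unfolding g_def P(1)[symmetric] by (intro DERIV_diff F DERIV_subset[OF poly_DERIV]) auto
    qed (use p(1) that in auto)
    then show ?thesis by simp
  qed
  have g: "continuous_on {-1..1} g"
    by (rule lipschitz_on_continuous_on[of E]) (use lip E in \<open>auto intro!: lipschitz_onI simp: dist_real_def\<close>)
  from jackson_operator[OF n g] obtain q where q: "degree q \<le> 2 * n"
    "\<forall>W. (\<forall>x\<in>{-1..1}. \<forall>y\<in>{-1..1}. \<bar>g x - g y\<bar> \<le> W * (1 + real n * \<bar>x - y\<bar>)) \<longrightarrow>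
        (\<forall>x\<in>{-1..1}. \<bar>g x - poly q x\<bar> \<le> 10000 * W)"
    "\<forall>K. (\<forall>x\<in>{-1..1}. \<forall>y\<in>{-1..1}. \<bar>g x - g y\<bar> \<le> K * \<bar>x - y\<bar>) \<longrightarrow>
        (\<forall>s\<in>{0..pi}. \<forall>t\<in>{0..pi}. \<bar>poly q (cos s) - poly q (cos t)\<bar> \<le> K * \<bar>s - t\<bar>)"
    by blast
  show ?thesis
  proof (rule that[of "P + q"])
    show "degree (P + q) \<le> Suc d" using P(2) p(2,3) q(1) by (intro degree_add_le) auto
    fix x :: real assume x: "x \<in> {-1..1}"
    \<comment> \<open>A Lipschitz function is admissible with W = E/n.\<close>
    have "\<bar>g y - g z\<bar> \<le> E / real n * (1 + real n * \<bar>y - z\<bar>)" if "y \<in> {-1..1}" "z \<in> {-1..1}" for y z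
    proof -
      have "E / real n * (1 + real n * \<bar>y - z\<bar>) = E / real n + E * \<bar>y - z\<bar>" using n by (simp add: field_simps)
      then show ?thesis using lip[OF that] E by (smt (verit) divide_nonneg_nonneg of_nat_0_le_iff)
    qed
    then have "\<bar>g x - poly q x\<bar> \<le> 10000 * (E / real n)" using q(2) x by blast
    then show "\<bar>F x - poly (P + q) x\<bar> \<le> 10000 * (E / real n)" by (simp add: g_def algebra_simps)
  next
    fix s t assume st: "s \<in> {0..pi}" "t \<in> {0..pi}"
    have "\<bar>g (cos s) - g (cos t)\<bar> \<le> E * \<bar>cos s - cos t\<bar>" by (rule lip) auto
    also have "\<dots> \<le> E * \<bar>s - t\<bar>" using E by (intro mult_left_mono abs_cos_diff_le)
    finally have "\<bar>g (cos s) - g (cos t)\<bar> \<le> E * \<bar>s - t\<bar>" .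
    moreover have "\<bar>poly q (cos s) - poly q (cos t)\<bar> \<le> E * \<bar>s - t\<bar>" using q(3) lip st by blast
    ultimately show "\<bar>(F (cos s) - poly (P + q) (cos s)) - (F (cos t) - poly (P + q) (cos t))\<bar> \<le> 2 * E * \<bar>s - t\<bar>"
      by (simp add: g_def)
  qed
qed

text \<open>From the m-th derivative down to the function, each integration costs a factor 10000 and
  gains 1/n. The last one stands apart because it must also return the Lipschitz bound for the
  error.\<close>

lemma jackson_smooth:
  fixes f :: "nat \<Rightarrow> real \<Rightarrow> real"
  assumes n: "n \<ge> 1" and m: "m \<ge> 1"
    and f: "\<And>k x. k < m \<Longrightarrow> x \<in> {-1..1} \<Longrightarrow> (f k has_real_derivative f (Suc k) x) (at x within {-1..1})"
    and fm: "continuous_on {-1..1} (f m)"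
    and W: "\<And>x y. x \<in> {-1..1} \<Longrightarrow> y \<in> {-1..1} \<Longrightarrow> \<bar>f m x - f m y\<bar> \<le> W * (1 + real n * \<bar>x - y\<bar>)"
  obtains p where "degree p \<le> 2 * n + m"
    "\<And>x. x \<in> {-1..1} \<Longrightarrow> \<bar>f 0 x - poly p x\<bar> \<le> 10000 ^ Suc m * W / real n ^ m"
    "\<And>s t. s \<in> {0..pi} \<Longrightarrow> t \<in> {0..pi} \<Longrightarrow>
       \<bar>(f 0 (cos s) - poly p (cos s)) - (f 0 (cos t) - poly p (cos t))\<bar> \<le> 2 * (10000 ^ m * W / real n ^ (m - 1)) * \<bar>s - t\<bar>"
proof -
  have "\<exists>p. degree p \<le> 2 * n + j \<and> (\<forall>x\<in>{-1..1}. \<bar>f (m - j) x - poly p x\<bar> \<le> 10000 ^ Suc j * W / real n ^ j)"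
    if "j < m" for j
    using that
  proof (induction j)
    case 0
    from jackson_operator[OF n fm] obtain q where q: "degree q \<le> 2 * n"
      "\<forall>V. (\<forall>x\<in>{-1..1}. \<forall>y\<in>{-1..1}. \<bar>f m x - f m y\<bar> \<le> V * (1 + real n * \<bar>x - y\<bar>)) \<longrightarrow>
        (\<forall>x\<in>{-1..1}. \<bar>f m x - poly q x\<bar> \<le> 10000 * V)"
      by blast
    have "\<forall>x\<in>{-1..1}. \<bar>f m x - poly q x\<bar> \<le> 10000 * W" using q(2) W by blast
    then show ?case using q(1) by (intro exI[of _ q]) auto
  next
    case (Suc j)
    then obtain p where p: "degree p \<le> 2 * n + j" "\<And>x. x \<in> {-1..1} \<Longrightarrow> \<bar>f (m - j) x - poly p x\<bar> \<le> 10000 ^ Suc j * W / real n ^ j"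
      by auto
    have e: "m - j = Suc (m - Suc j)" using Suc.prems by simp
    have d: "(f (m - Suc j) has_real_derivative f (m - j) x) (at x within {-1..1})" if "x \<in> {-1..1}" for x
      unfolding e by (rule f) (use Suc.prems that in auto)
    obtain r where "degree r \<le> Suc (2 * n + j)"
      "\<And>x. x \<in> {-1..1} \<Longrightarrow> \<bar>f (m - Suc j) x - poly r x\<bar> \<le> 10000 * ((10000 ^ Suc j * W / real n ^ j) / real n)"
      by (rule jackson_step[OF n d p(2,1)]) (auto intro: that)
    then show ?case by (intro exI[of _ r]) (auto simp: field_simps)
  qed
  from this[of "m - 1"] m obtain p where p: "degree p \<le> 2 * n + (m - 1)"
    "\<And>x. x \<in> {-1..1} \<Longrightarrow> \<bar>f 1 x - poly p x\<bar> \<le> 10000 ^ m * W / real n ^ (m - 1)" by auto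
  have d: "(f 0 has_real_derivative f 1 x) (at x within {-1..1})" if "x \<in> {-1..1}" for x
    using f[of 0 x] m that by simp
  obtain r where r: "degree r \<le> Suc (2 * n + (m - 1))"
    "\<And>x. x \<in> {-1..1} \<Longrightarrow> \<bar>f 0 x - poly r x\<bar> \<le> 10000 * ((10000 ^ m * W / real n ^ (m - 1)) / real n)"
    "\<And>s t. s \<in> {0..pi} \<Longrightarrow> t \<in> {0..pi} \<Longrightarrow>
       \<bar>(f 0 (cos s) - poly r (cos s)) - (f 0 (cos t) - poly r (cos t))\<bar> \<le> 2 * (10000 ^ m * W / real n ^ (m - 1)) * \<bar>s - t\<bar>"
    by (rule jackson_step[OF n d p(2,1)]) (auto intro: that)
  have "10000 * ((10000 ^ m * W / real n ^ (m - 1)) / real n) = 10000 ^ Suc m * W / real n ^ m"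
    using m by (cases m) (auto simp: mult_ac)
  with r m show ?thesis by (intro that[of r]) auto
qed

subsection \<open>Chebyshev polynomials of the four kinds\<close>

definition freq_shift :: "nat \<Rightarrow> nat" where
  "freq_shift i = (if i = 1 then 0 else if i = 2 then 2 else 1)"

text \<open>Kinds 1 and 3 are built from cosines, 2 and 4 from sines. The sign relates the outgoing
  to the reflected wave, and \<open>phase\<close> is half its argument.\<close>

definition parity_sign :: "nat \<Rightarrow> real" where
  "parity_sign i = (if i = 1 \<or> i = 3 then 1 else -1)"

definition phase :: "nat \<Rightarrow> real" where
  "phase i = (if i = 1 \<or> i = 3 then 0 else pi / 2)"

text \<open>Also the reciprocal of \<open>szego_den i 0\<close>, which is how leading coefficients
  match the value of the Szego factor at infinity.\<close>

definition lead_factor :: "nat \<Rightarrow> real" where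
  "lead_factor i = (if i = 1 then 1 / 2 else 1)"

text \<open>Kind \<open>i\<close> is orthogonal for the weight \<open>\<bar>v_poly i x\<bar> / \<surd>(1 - x\<^sup>2)\<close>: for \<open>t\<close> in \<open>[0, \<pi>]\<close>,
  \<open>sqrt_weight i t * cheb i l (cos t) = wscale i * cos ((l + freq_shift i / 2) * t - phase i)\<close>.
  The leading coefficient is \<open>2\<^sup>l * lead_factor i\<close> for \<open>l \<ge> 1\<close> only.\<close>

fun cheb :: "nat \<Rightarrow> nat \<Rightarrow> real poly" where
  "cheb i 0 = 1"
| "cheb i (Suc 0) = (if i = 1 then [:0, 1:] else if i = 2 then [:0, 2:] else if i = 3 then [:-1, 2:] else [:1, 2:])"
| "cheb i (Suc (Suc l)) = [:0, 2:] * cheb i (Suc l) - cheb i l"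

lemma cpoly_simps:
  "cpoly (p - q) = cpoly p - cpoly q" "cpoly (p + q) = cpoly p + cpoly q" "cpoly (p * q) = cpoly p * cpoly q"
  "cpoly 1 = 1" "cpoly (smult c p) = smult (of_real c) (cpoly p)" "cpoly [:a, b:] = [:of_real a, of_real b:]"
proof -
  show "cpoly (p - q) = cpoly p - cpoly q" "cpoly (p + q) = cpoly p + cpoly q"
    by (rule poly_eqI; simp add: coeff_map_poly)+
  show "cpoly (p * q) = cpoly p * cpoly q"
    by (rule poly_eqI) (simp add: coeff_map_poly coeff_mult)
  show "cpoly 1 = 1" by (simp add: map_poly_1)
  show "cpoly (smult c p) = smult (of_real c) (cpoly p)"
    by (rule poly_eqI) (simp add: coeff_map_poly)
  show "cpoly [:a, b:] = [:of_real a, of_real b:]" by (simp add: map_poly_pCons)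
qed

lemma cpoly_sum: "cpoly (\<Sum>k\<in>A. f k) = (\<Sum>k\<in>A. cpoly (f k))"
  by (rule poly_eqI) (simp add: coeff_map_poly coeff_sum)

text \<open>The closed form common to the four kinds. After multiplication by the power of \<zeta>
  the three-term recurrence has coefficients \<open>\<zeta>\<^sup>2 + 1\<close> and
  \<open>\<zeta>\<^sup>2\<close>, whose characteristic roots are 1 and
  \<open>\<zeta>\<^sup>2\<close>.\<close>

lemma cheb_joukowski:
  assumes i: "i \<in> {1,2,3,4}" and \<zeta>: "\<zeta> \<noteq> 0"
  shows "szego_den i \<zeta> * \<zeta> ^ l * poly (cpoly (cheb i l)) (joukowski \<zeta>) = 1 + of_real (parity_sign i) * \<zeta> ^ (2 * l + freq_shift i)"
proof (induction l rule: induct_nat_012)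
  case 0
  show ?case using i by (auto simp: szego_den_def parity_sign_def freq_shift_def cpoly_simps)
next
  case 1
  have J: "\<zeta> * joukowski \<zeta> = (\<zeta>\<^sup>2 + 1) / 2"
    using \<zeta> by (simp add: joukowski_def field_simps power2_eq_square)
  have "poly (cpoly (cheb i (Suc 0))) z = (if i = 1 then z else if i = 2 then 2 * z else if i = 3 then 2 * z - 1 else 2 * z + 1)" for z
    by (simp add: cpoly_simps)
  then have "szego_den i \<zeta> * \<zeta> ^ Suc 0 * poly (cpoly (cheb i (Suc 0))) (joukowski \<zeta>)
     = szego_den i \<zeta> * (if i = 1 then \<zeta> * joukowski \<zeta> else if i = 2 then 2 * (\<zeta> * joukowski \<zeta>)
        else if i = 3 then 2 * (\<zeta> * joukowski \<zeta>) - \<zeta> else 2 * (\<zeta> * joukowski \<zeta>) + \<zeta>)"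
    by (simp add: algebra_simps)
  also have "\<dots> = 1 + of_real (parity_sign i) * \<zeta> ^ (2 * Suc 0 + freq_shift i)"
    unfolding J using i
    by (auto simp: szego_den_def parity_sign_def freq_shift_def field_simps power_numeral_reduce)
  finally show ?case .
next
  case (ge2 l)
  let ?P = "\<lambda>l. szego_den i \<zeta> * \<zeta> ^ l * poly (cpoly (cheb i l)) (joukowski \<zeta>)"
  have J: "2 * (\<zeta> * joukowski \<zeta>) = \<zeta>\<^sup>2 + 1"
    using \<zeta> by (simp add: joukowski_def field_simps power2_eq_square)
  have r: "poly (cpoly (cheb i (Suc (Suc l)))) z = 2 * z * poly (cpoly (cheb i (Suc l))) z - poly (cpoly (cheb i l)) z" for z
    by (simp only: cheb.simps cpoly_simps poly_diff poly_mult) simp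
  have "?P (Suc (Suc l)) = (2 * (\<zeta> * joukowski \<zeta>)) * ?P (Suc l) - \<zeta>\<^sup>2 * ?P l"
    unfolding r by (simp add: algebra_simps power2_eq_square del: cheb.simps)
  also have "\<dots> = 1 + of_real (parity_sign i) * \<zeta> ^ (2 * Suc (Suc l) + freq_shift i)"
    unfolding J ge2 by (simp add: algebra_simps power2_eq_square)
  finally show ?case .
qed

lemma cheb_degree: "degree (cheb i l) \<le> l"
proof (induction i l rule: cheb.induct)
  case (3 i l)
  have "degree ([:0, 2:] * cheb i (Suc l)) \<le> 1 + degree (cheb i (Suc l))"
    using degree_mult_le[of "[:0, 2:]" "cheb i (Suc l)"] by simp
  then show ?case using 3 by (auto intro!: degree_diff_le)
qed auto

lemma cheb_lead: "coeff (cheb i (Suc l)) (Suc l) = 2 ^ Suc l * lead_factor i"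
proof (induction i l rule: cheb.induct)
  case (3 i l)
  have "coeff (cheb i (Suc l)) (Suc (Suc (Suc l))) = 0"
    by (rule coeff_eq_0) (use cheb_degree[of i "Suc l"] in simp)
  moreover have "coeff ([:0, 2:] * cheb i (Suc (Suc l))) (Suc (Suc (Suc l))) = 2 * coeff (cheb i (Suc (Suc l))) (Suc (Suc l))"
    by simp
  ultimately show ?case using 3 by simp
qed (auto simp: lead_factor_def)

text \<open>Weighted polynomials are estimated with one factor of this root each; in products and
  kernels two such factors restore the weight.\<close>

definition sqrt_weight :: "nat \<Rightarrow> real \<Rightarrow> real" where
  "sqrt_weight i t = sqrt \<bar>v_poly i (cos t)\<bar>"

lemma sqrt_weight_square: "(sqrt_weight i t)\<^sup>2 = \<bar>v_poly i (cos t)\<bar>"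
  by (simp add: sqrt_weight_def)

lemma sqrt_weight_nonneg: "sqrt_weight i t \<ge> 0"
  by (simp add: sqrt_weight_def)

lemma continuous_on_sqrt_weight: "continuous_on A (sqrt_weight i)"
  unfolding sqrt_weight_def v_poly_def
  by (cases "i = 1"; cases "i = 2"; cases "i = 3") (auto intro!: continuous_intros)

text \<open>Half-angle formulas. The restriction to [0, \<pi>] makes the half-angle sine and cosine,
  and for kind 2 the sine itself, nonnegative, so that they equal the square roots.\<close>

lemma szego_den_cis:
  assumes i: "i \<in> {1,2,3,4}" and t: "t \<in> {0..pi}"
  shows "szego_den i (cis (- t)) = of_real (2 / wscale i * sqrt_weight i t) * cis (phase i - freq_shift i / 2 * t)"
proof -
  have c2: "cis (- t) = cis (- (t / 2)) * cis (- (t / 2))" by (simp add: cis_mult)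
  have c1: "1 = cis (t / 2) * cis (- (t / 2))" by (simp add: cis_mult)
  have ch: "0 \<le> cos (t / 2)" using t by (intro cos_ge_zero) auto
  have sh: "0 \<le> sin (t / 2)" using t by (intro sin_ge_zero) auto
  have ct: "1 + cos t = 2 * (cos (t / 2))\<^sup>2" "1 - cos t = 2 * (sin (t / 2))\<^sup>2"
    using cos_double_cos[of "t / 2"] cos_double_sin[of "t / 2"] by simp_all
  consider "i = 1" | "i = 2" | "i = 3" | "i = 4" using i by auto
  then show ?thesis
  proof cases
    case 1 then show ?thesis by (simp add: szego_den_def wscale_def sqrt_weight_def v_poly_def phase_def freq_shift_def)
  next
    case 2
    have "(cos t)\<^sup>2 - 1 = - (sin t)\<^sup>2" using sin_cos_squared_add[of t] by linarith
    then have "\<bar>(cos t)\<^sup>2 - 1\<bar> = (sin t)\<^sup>2" by simp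
    then have "sqrt_weight i t = sin t" using t 2 sin_ge_zero[of t] by (simp add: sqrt_weight_def v_poly_def)
    moreover have "1 - (cis (- t))\<^sup>2 = of_real (2 * sin t) * cis (pi / 2 - t)"
      using sin_cos_squared_add[of t]
      by (simp add: complex_eq_iff power2_eq_square cos_diff sin_diff algebra_simps)
    ultimately show ?thesis using 2 by (simp add: szego_den_def wscale_def phase_def freq_shift_def)
  next
    case 3
    have "sqrt_weight i t = sqrt 2 * cos (t / 2)" using 3 ch ct by (simp add: sqrt_weight_def v_poly_def real_sqrt_mult add.commute)
    moreover have "1 + cis (- t) = of_real (2 * cos (t / 2)) * cis (- (t / 2))"
    proof -
      have "1 + cis (- t) = (cis (t / 2) + cis (- (t / 2))) * cis (- (t / 2))"
        by (subst c1, subst c2) (simp add: distrib_right)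
      also have "cis (t / 2) + cis (- (t / 2)) = of_real (2 * cos (t / 2))" by (simp add: complex_eq_iff)
      finally show ?thesis .
    qed
    ultimately show ?thesis using 3 by (simp add: szego_den_def wscale_def phase_def freq_shift_def)
  next
    case 4
    have "\<bar>cos t - 1\<bar> = 1 - cos t" by simp
    then have "sqrt_weight i t = sqrt 2 * sin (t / 2)" using 4 sh ct by (simp add: sqrt_weight_def v_poly_def real_sqrt_mult)
    moreover have "1 - cis (- t) = of_real (2 * sin (t / 2)) * cis (pi / 2 - t / 2)"
    proof -
      have "1 - cis (- t) = (cis (t / 2) - cis (- (t / 2))) * cis (- (t / 2))"
        by (subst c1, subst c2) (simp add: left_diff_distrib)
      also have "cis (t / 2) - cis (- (t / 2)) = of_real (2 * sin (t / 2)) * cis (pi / 2)" by (simp add: complex_eq_iff)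
      finally show ?thesis by (simp only: mult.assoc cis_mult diff_conv_add_uminus)
    qed
    ultimately show ?thesis using 4 by (simp add: szego_den_def wscale_def phase_def freq_shift_def)
  qed
qed

subsection \<open>Bernstein--Szego polynomials\<close>

text \<open>Replaces the power \<zeta>^k of A by a shift of the degree by k. The subtraction n - k
  is meant for degree A \<le> n.\<close>

definition bs :: "nat \<Rightarrow> real poly \<Rightarrow> nat \<Rightarrow> real poly" where
  "bs i A n = (\<Sum>k\<le>degree A. smult (coeff A k) (cheb i (n - k)))"

text \<open>Summing the closed forms with coefficients of A, the outgoing terms combine to
  A(\<zeta>) and the reflected ones to A(1/\<zeta>).\<close>

lemma bs_joukowski:
  assumes i: "i \<in> {1,2,3,4}" and \<zeta>: "\<zeta> \<noteq> 0" and n: "degree A \<le> n"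
  shows "szego_den i \<zeta> * \<zeta> ^ n * poly (cpoly (bs i A n)) (joukowski \<zeta>)
     = poly (cpoly A) \<zeta> + of_real (parity_sign i) * \<zeta> ^ (2 * n + freq_shift i) * poly (cpoly A) (1 / \<zeta>)"
proof -
  have dA: "degree (cpoly A) = degree A" by (simp add: degree_map_poly)
  have "szego_den i \<zeta> * \<zeta> ^ n * poly (cpoly (bs i A n)) (joukowski \<zeta>)
     = (\<Sum>k\<le>degree A. of_real (coeff A k) * (szego_den i \<zeta> * \<zeta> ^ n * poly (cpoly (cheb i (n - k))) (joukowski \<zeta>)))"
    by (simp add: bs_def cpoly_sum cpoly_simps poly_sum sum_distrib_left mult_ac)
  also have "\<dots> = (\<Sum>k\<le>degree A. of_real (coeff A k) * \<zeta> ^ k + of_real (parity_sign i) * \<zeta> ^ (2 * n + freq_shift i) * (of_real (coeff A k) * (1 / \<zeta>) ^ k))"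
  proof (intro sum.cong refl)
    fix k assume "k \<in> {..degree A}"
    then have k: "k \<le> n" using n by auto
    have "\<zeta> ^ n = \<zeta> ^ k * \<zeta> ^ (n - k)" using k by (simp flip: power_add)
    then have "szego_den i \<zeta> * \<zeta> ^ n * poly (cpoly (cheb i (n - k))) (joukowski \<zeta>)
       = \<zeta> ^ k * (1 + of_real (parity_sign i) * \<zeta> ^ (2 * (n - k) + freq_shift i))"
      using cheb_joukowski[OF i \<zeta>, of "n - k"] by (simp add: mult_ac)
    also have "\<dots> = \<zeta> ^ k + of_real (parity_sign i) * (\<zeta> ^ k * \<zeta> ^ (2 * (n - k) + freq_shift i))"
      by (simp add: algebra_simps)
    also have "\<zeta> ^ k * \<zeta> ^ (2 * (n - k) + freq_shift i) = \<zeta> ^ (2 * n + freq_shift i) * (1 / \<zeta>) ^ k"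
    proof -
      have "k + (2 * (n - k) + freq_shift i) + k = 2 * n + freq_shift i" using k by simp
      then have "\<zeta> ^ k * \<zeta> ^ (2 * (n - k) + freq_shift i) * \<zeta> ^ k = \<zeta> ^ (2 * n + freq_shift i)"
        unfolding power_add[symmetric] by (simp only:)
      then show ?thesis using \<zeta> by (simp add: power_one_over field_simps)
    qed
    finally show "of_real (coeff A k) * (szego_den i \<zeta> * \<zeta> ^ n * poly (cpoly (cheb i (n - k))) (joukowski \<zeta>))
      = of_real (coeff A k) * \<zeta> ^ k + of_real (parity_sign i) * \<zeta> ^ (2 * n + freq_shift i) * (of_real (coeff A k) * (1 / \<zeta>) ^ k)"
      by (simp add: algebra_simps)
  qed
  also have "\<dots> = poly (cpoly A) \<zeta> + of_real (parity_sign i) * \<zeta> ^ (2 * n + freq_shift i) * poly (cpoly A) (1 / \<zeta>)"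
    by (simp add: poly_altdef dA coeff_map_poly sum.distrib sum_distrib_left)
  finally show ?thesis .
qed

definition bs_wave :: "nat \<Rightarrow> real poly \<Rightarrow> nat \<Rightarrow> real \<Rightarrow> complex" where
  "bs_wave i A n t = of_real (wscale i) * cis ((n + freq_shift i / 2) * t - phase i) * poly (cpoly A) (cis (- t))"

lemma parity_sign_cis: "of_real (parity_sign i) * cis (- phase i) = cis (phase i)"
  by (simp add: parity_sign_def phase_def complex_eq_iff)

lemma parity_sign_cis2:
  "of_real (parity_sign i) = cis (- phase i) * cis (- phase i)" "of_real (parity_sign i) = cis (phase i) * cis (phase i)"
  by (simp_all add: parity_sign_def phase_def complex_eq_iff)

text \<open>On the circle, rotating by the mean of the two frequencies makes outgoing and reflected
  part complex conjugates of each other.\<close>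

lemma bs_eq_Re_wave:
  assumes i: "i \<in> {1,2,3,4}" and t: "t \<in> {0..pi}" and n: "degree A \<le> n"
  shows "sqrt_weight i t * poly (bs i A n) (cos t) = Re (bs_wave i A n t)"
proof -
  let ?l = "(n + freq_shift i / 2) * t"
  let ?X = "poly (bs i A n) (cos t)"
  have w: "wscale i > 0" using wscale_bounds(1)[of i] by linarith
  have "szego_den i (cis (- t)) * cis (- t) ^ n * of_real ?X
     = poly (cpoly A) (cis (- t)) + of_real (parity_sign i) * cis (- t) ^ (2 * n + freq_shift i) * poly (cpoly A) (cis t)"
    using bs_joukowski[OF i _ n, of "cis (- t)"] cis_inverse[of "- t"] by (simp add: joukowski_cis inverse_eq_divide)
  then have "cis (?l - phase i) * (szego_den i (cis (- t)) * cis (- t) ^ n * of_real ?X)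
     = cis (?l - phase i) * poly (cpoly A) (cis (- t)) + cis (?l - phase i) * (of_real (parity_sign i) * cis (- t) ^ (2 * n + freq_shift i)) * poly (cpoly A) (cis t)"
    by (simp add: algebra_simps)
  \<comment> \<open>The exponent 2 n + freq_shift is twice the frequency of the wave, and the sign
    is absorbed by moving the phase to the other side.\<close>
  moreover have "cis (?l - phase i) * (of_real (parity_sign i) * cis (- t) ^ (2 * n + freq_shift i)) = cis (- (?l - phase i))"
  proof -
    have arg: "?l - phase i + real (2 * n + freq_shift i) * (- t) = - phase i + - ?l"
      by (simp add: algebra_simps)
    have "cis (?l - phase i) * cis (- t) ^ (2 * n + freq_shift i) = cis (- phase i) * cis (- ?l)"
      unfolding Complex.DeMoivre cis_mult arg ..
    then have "cis (?l - phase i) * (of_real (parity_sign i) * cis (- t) ^ (2 * n + freq_shift i))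
      = (of_real (parity_sign i) * cis (- phase i)) * cis (- ?l)"
      by (simp only: mult.left_commute mult.assoc)
    also have "\<dots> = cis (- (?l - phase i))" unfolding parity_sign_cis by (simp add: cis_mult algebra_simps)
    finally show ?thesis .
  qed
  moreover have "cis (?l - phase i) * (szego_den i (cis (- t)) * cis (- t) ^ n * of_real ?X) = of_real (2 / wscale i * sqrt_weight i t * ?X)"
  proof -
    have "cis (?l - phase i) * (cis (phase i - freq_shift i / 2 * t) * cis (- t) ^ n) = 1"
      by (simp add: Complex.DeMoivre cis_mult algebra_simps)
    then show ?thesis
      unfolding szego_den_cis[OF i t] by (simp add: mult_ac)
  qed
  moreover have "cis (- (?l - phase i)) * poly (cpoly A) (cis t) = cnj (cis (?l - phase i) * poly (cpoly A) (cis (- t)))"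
    by (simp add: cis_cnj cnj_cpoly)
  ultimately have "of_real (2 / wscale i * sqrt_weight i t * ?X) = complex_of_real (2 * Re (cis (?l - phase i) * poly (cpoly A) (cis (- t))))"
    by (simp only: complex_add_cnj)
  then have "2 / wscale i * sqrt_weight i t * ?X = 2 * Re (cis (?l - phase i) * poly (cpoly A) (cis (- t)))"
    by (simp only: of_real_eq_iff)
  then have "sqrt_weight i t * ?X = wscale i * Re (cis (?l - phase i) * poly (cpoly A) (cis (- t)))"
    using w by (simp add: field_simps)
  then show ?thesis by (simp add: bs_wave_def mult.assoc)
qed

lemma bs_one: "bs i 1 n = cheb i n"
  by (simp add: bs_def)

lemma bs_degree: "degree (bs i A n) \<le> n"
  unfolding bs_def
  by (intro degree_sum_le order.trans[OF degree_smult_le] order.trans[OF cheb_degree]) auto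

lemma bs_lead:
  assumes "degree A < n"
  shows "coeff (bs i A n) n = coeff A 0 * 2 ^ n * lead_factor i"
proof -
  obtain l where l: "n = Suc l" using assms by (cases n) auto
  have "coeff (bs i A n) n = (\<Sum>k\<le>degree A. if k = 0 then coeff A 0 * coeff (cheb i n) n else 0)"
    unfolding bs_def coeff_sum
  proof (intro sum.cong refl)
    fix k
    have "coeff (cheb i (n - k)) n = 0" if "k \<noteq> 0"
      by (rule coeff_eq_0) (use cheb_degree[of i "n - k"] that assms in linarith)
    then show "coeff (smult (coeff A k) (cheb i (n - k))) n = (if k = 0 then coeff A 0 * coeff (cheb i n) n else 0)"
      by auto
  qed
  also have "\<dots> = coeff A 0 * coeff (cheb i n) n" by simp
  finally show ?thesis by (simp add: l cheb_lead)
qed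

lemma bs_recurrence:
  assumes "degree A < n"
  shows "smult 2 ([:0, 1:] * bs i A n) = bs i A (Suc n) + bs i A (n - 1)"
proof -
  have "smult 2 ([:0, 1:] * bs i A n) = (\<Sum>k\<le>degree A. smult (coeff A k) ([:0, 2:] * cheb i (n - k)))"
  proof -
    have "smult 2 ([:0, 1:] * bs i A n) = [:0, 2:] * bs i A n" by simp
    then show ?thesis by (simp only: bs_def sum_distrib_left mult_smult_right)
  qed
  also have "\<dots> = (\<Sum>k\<le>degree A. smult (coeff A k) (cheb i (Suc n - k)) + smult (coeff A k) (cheb i (n - 1 - k)))"
  proof (intro sum.cong refl)
    fix k assume "k \<in> {..degree A}"
    \<comment> \<open>Strictness makes n - k at least 1, so the recurrence applies to every term of
      the sum.\<close>
    then have "k < n" using assms by auto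
    then obtain l where l: "n = Suc (l + k)" by (metis less_iff_Suc_add add.commute)
    have e: "n - k = Suc l" "Suc n - k = Suc (Suc l)" "n - 1 - k = l" using l by auto
    show "smult (coeff A k) ([:0, 2:] * cheb i (n - k)) = smult (coeff A k) (cheb i (Suc n - k)) + smult (coeff A k) (cheb i (n - 1 - k))"
      unfolding e by (simp flip: smult_add_right)
  qed
  finally show ?thesis by (simp add: bs_def sum.distrib)
qed

text \<open>The cosines and sines of the two waves combine into the boundary values of a function that is
  holomorphic in the disc, so orthogonality is the mean value property.\<close>

lemma bs_cheb_integral:
  assumes i: "i \<in> {1,2,3,4}" and R: "R > 1" "\<And>\<zeta>. \<zeta> \<in> ball 0 R \<Longrightarrow> poly (cpoly A) \<zeta> \<noteq> 0"
    and q: "\<And>t. poly (cpoly A) (cis t) * poly (cpoly A) (cis (- t)) = of_real (q (cos t))"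
    and n: "degree A \<le> n" "1 \<le> n" and l: "l \<le> n"
  shows "integral {0..pi} (\<lambda>t. (sqrt_weight i t * poly (bs i A n) (cos t)) * (sqrt_weight i t * poly (cheb i l) (cos t)) / q (cos t))
    = (if l = n then (wscale i)\<^sup>2 * pi / (2 * coeff A 0) else 0)"
proof -
  let ?w = "wscale i" and ?A = "poly (cpoly A)" and ?s = "complex_of_real (parity_sign i)"
  define H where "H = (\<lambda>z. of_real (?w\<^sup>2 / 4) * (?s * z ^ (n + l + freq_shift i) + z ^ (n - l)) / ?A z)"
  have w: "?w > 0" using wscale_bounds(1)[of i] by linarith
  have Hh: "H holomorphic_on ball 0 R"
    unfolding H_def using R(2) by (intro holomorphic_intros) auto
  have A0: "?A 0 = of_real (coeff A 0)" by (simp add: poly_0_coeff_0 coeff_map_poly)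
  \<comment> \<open>The first power vanishes at 0 because n \<ge> 1; the second survives only for l
    = n.\<close>
  have H0: "H 0 = of_real (if l = n then ?w\<^sup>2 / (4 * coeff A 0) else 0)"
    using n l by (auto simp: H_def A0 power_0_left)
  from circle_mean_value[OF R(1) Hh, of 0]
  have mv: "((\<lambda>t. H (cis t) + H (cis (- t))) has_integral 2 * pi * H 0) {0..pi}" by simp
  let ?f = "\<lambda>t. (sqrt_weight i t * poly (bs i A n) (cos t)) * (sqrt_weight i t * poly (cheb i l) (cos t)) / q (cos t)"
  have "((\<lambda>t. complex_of_real (?f t)) has_integral 2 * pi * H 0) {0..pi}"
  proof (rule has_integral_eq[OF _ mv])
    fix t assume t: "t \<in> {0..pi}"
    let ?c = "\<lambda>m. cis ((m + freq_shift i / 2) * t - phase i)"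
    have inR: "cis t \<in> ball 0 R" "cis (- t) \<in> ball 0 R" using R(1) by auto
    note nz = R(2)[OF inR(1)] R(2)[OF inR(2)]
    have qnz: "complex_of_real (q (cos t)) \<noteq> 0" using q[of t] nz by (metis mult_eq_0_iff)
    have re: "complex_of_real (Re z) = (z + cnj z) / 2" for z by (simp add: complex_add_cnj)
    have cc: "cnj (?c m) = cis (- ((m + freq_shift i / 2) * t - phase i))" for m by (simp add: cis_cnj)
    have B: "complex_of_real (sqrt_weight i t * poly (bs i A n) (cos t)) = ?w * (?c n * ?A (cis (- t)) + cnj (?c n) * ?A (cis t)) / 2"
      unfolding bs_eq_Re_wave[OF i t n(1)] re bs_wave_def by (simp add: cnj_cpoly cis_cnj algebra_simps)
    have C: "complex_of_real (sqrt_weight i t * poly (cheb i l) (cos t)) = ?w * (?c l + cnj (?c l)) / 2"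
    proof -
      have e: "sqrt_weight i t * poly (cheb i l) (cos t) = Re (bs_wave i 1 l t)"
        using bs_eq_Re_wave[OF i t, of 1 l] by (simp add: bs_one)
      show ?thesis unfolding e re bs_wave_def by (simp add: cpoly_simps algebra_simps)
    qed
    \<comment> \<open>Since q is the product of the two boundary values of A, each half keeps one of
      them in its denominator, and is the boundary value of a function holomorphic in a disc of
      radius larger than 1.\<close>
    have D: "(?c n * ?A (cis (- t)) + cnj (?c n) * ?A (cis t)) / of_real (q (cos t)) = ?c n / ?A (cis t) + cnj (?c n) / ?A (cis (- t))"
      unfolding q[symmetric] using nz by (simp add: field_simps)
    have "complex_of_real (?f t) = of_real (?w\<^sup>2 / 4) * ((?c n * ?A (cis (- t)) + cnj (?c n) * ?A (cis t)) / of_real (q (cos t))) * (?c l + cnj (?c l))"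
      unfolding of_real_divide of_real_mult[of "sqrt_weight i t * poly (bs i A n) (cos t)"] B C
      by (simp add: power2_eq_square)
    also have "\<dots> = of_real (?w\<^sup>2 / 4) * ((?c n * ?c l + ?c n * cnj (?c l)) / ?A (cis t)) + of_real (?w\<^sup>2 / 4) * ((cnj (?c n) * cnj (?c l) + cnj (?c n) * ?c l) / ?A (cis (- t)))"
      unfolding D by (simp add: algebra_simps add_divide_distrib)
    also have "?c n * ?c l = ?s * cis t ^ (n + l + freq_shift i)"
      unfolding parity_sign_cis2(1) Complex.DeMoivre cis_mult by (simp add: algebra_simps)
    also have "?c n * cnj (?c l) = cis t ^ (n - l)"
      using l by (simp add: cis_cnj cis_mult Complex.DeMoivre algebra_simps of_nat_diff)
    also have "cnj (?c n) * cnj (?c l) = ?s * cis (- t) ^ (n + l + freq_shift i)"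
      unfolding parity_sign_cis2(2) Complex.DeMoivre cis_cnj cis_mult by (simp add: algebra_simps)
    also have "cnj (?c n) * ?c l = cis (- t) ^ (n - l)"
      using l by (simp add: cis_cnj cis_mult Complex.DeMoivre algebra_simps of_nat_diff)
    finally show "H (cis t) + H (cis (- t)) = complex_of_real (?f t)"
      by (simp add: H_def)
  qed
  from has_integral_linear[OF this bounded_linear_Re]
  have "(?f has_integral Re (2 * pi * H 0)) {0..pi}" by (simp add: o_def)
  then show ?thesis
    by (subst integral_unique) (auto simp: H0 mult.commute)
qed

subsection \<open>A Bernstein-type inequality\<close>

lemma norm_cis_diff_le: "norm (cis a - cis b) \<le> \<bar>a - b\<bar>"
proof -
  have "cis a - cis b = cis a * (1 - cis (b - a))"
    by (simp add: right_diff_distrib cis_mult)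
  then have "norm (cis a - cis b) = 2 * \<bar>sin ((b - a) / 2)\<bar>"
    by (simp add: norm_mult norm_one_minus_cis)
  also have "\<dots> \<le> 2 * \<bar>(b - a) / 2\<bar>" by (intro mult_left_mono abs_sin_x_le_abs_x) auto
  finally show ?thesis by simp
qed

lemma norm_le_on_disc:
  assumes "f holomorphic_on UNIV" "\<And>t. norm (f (cis t)) \<le> K" "norm z \<le> 1"
  shows "norm (f z) \<le> K"
proof (rule maximum_modulus_frontier[of f "cball 0 1"])
  show "f holomorphic_on interior (cball 0 1)" by (rule holomorphic_on_subset[OF assms(1)]) auto
  show "continuous_on (closure (cball 0 1)) f"
    by (rule continuous_on_subset[OF holomorphic_on_imp_continuous_on[OF assms(1)]]) auto
  fix w :: complex assume "w \<in> frontier (cball 0 1)"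
  then have "norm w = 1" by auto
  moreover from this have "w \<noteq> 0" by auto
  ultimately have cw: "cis (Arg w) = w" using cis_Arg[of w] by (simp add: sgn_div_norm)
  show "norm (f w) \<le> K" using assms(2)[of "Arg w"] unfolding cw .
qed (use assms(3) in auto)

text \<open>Outside the disc the maximum principle is applied to the reversed polynomial w^N
  A(1/w).\<close>

lemma poly_growth:
  fixes A :: "complex poly"
  assumes A: "degree A \<le> N" "\<And>t. norm (poly A (cis t)) \<le> K"
  shows "norm (poly A z) \<le> K * max 1 (norm z) ^ N"
proof (cases "norm z \<le> 1")
  case True
  then have "norm (poly A z) \<le> K"
    by (intro norm_le_on_disc[of "poly A" K z]) (use A(2) in \<open>auto intro!: holomorphic_intros\<close>)
  then show ?thesis using True by (simp add: max_def)
next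
  case False
  define B where "B = (\<lambda>w. \<Sum>k\<le>N. coeff A k * w ^ (N - k))"
  have B: "B w = w ^ N * poly A (1 / w)" if "w \<noteq> 0" for w
  proof -
    have e1: "poly A (1 / w) = (\<Sum>k\<le>N. coeff A k * (1 / w) ^ k)"
      unfolding poly_altdef by (rule sum.mono_neutral_left) (use A(1) in \<open>auto simp: coeff_eq_0\<close>)
    have e2: "w ^ N * (coeff A k * (1 / w) ^ k) = coeff A k * w ^ (N - k)" if "k \<le> N" for k
      using that \<open>w \<noteq> 0\<close> by (simp add: power_diff power_one_over field_simps)
    show ?thesis
      unfolding e1 sum_distrib_left B_def by (intro sum.cong refl e2[symmetric]) auto
  qed
  have "norm (B (1 / z)) \<le> K"
  proof (rule norm_le_on_disc[of B K "1 / z"])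
    show "B holomorphic_on UNIV" unfolding B_def by (intro holomorphic_intros)
    show "norm (1 / z) \<le> 1" using False by (simp add: norm_divide divide_le_eq)
    fix t show "norm (B (cis t)) \<le> K"
      using A(2)[of "- t"] cis_inverse[of t] by (simp add: B[OF cis_neq_zero] norm_mult norm_power inverse_eq_divide)
  qed
  moreover have "z \<noteq> 0" using False by auto
  ultimately have "norm (poly A z) / norm z ^ N \<le> K"
    using B[of "1 / z"] by (simp add: norm_mult norm_power norm_divide power_one_over)
  then show ?thesis using False \<open>z \<noteq> 0\<close> by (simp add: max_def pos_divide_le_eq)
qed

text \<open>Cauchy's inequality on circles of radius 1/(N + 1), where the growth factor is at most
  (1 + 1/(N + 1))^N \<le> e \<le> 3.\<close>

lemma poly_cis_lipschitz:
  fixes A :: "complex poly"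
  assumes A: "degree A \<le> N" "\<And>t. norm (poly A (cis t)) \<le> K"
  shows "norm (poly A (cis s) - poly A (cis t)) \<le> 3 * K * (real N + 1) * \<bar>s - t\<bar>"
proof -
  have K: "K \<ge> 0" using A(2)[of 0] norm_ge_zero order_trans by blast
  define r where "r = 1 / (real N + 1)"
  have r: "r > 0" by (simp add: r_def)
  have d: "norm (deriv (poly A) z) \<le> 3 * K * (real N + 1)" if z: "z \<in> cball 0 1" for z
  proof -
    have "norm ((deriv ^^ 1) (poly A) z) \<le> fact 1 * (3 * K) / r ^ 1"
    proof (rule Cauchy_inequality)
      show "poly A holomorphic_on ball z r" "continuous_on (cball z r) (poly A)"
        by (auto intro: holomorphic_intros continuous_intros)
      fix w assume "norm (z - w) = r"
      then have "norm w \<le> 1 + r" using z norm_triangle_ineq4[of z "z - w"] by simp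
      then have "max 1 (norm w) ^ N \<le> (1 + r) ^ N" using r by (intro power_mono) auto
      also have "\<dots> \<le> exp r ^ N" using r by (intro power_mono exp_ge_add_one_self) auto
      also have "\<dots> = exp (real N * r)" by (simp add: exp_of_nat_mult)
      also have "\<dots> \<le> exp 1" by (simp add: r_def)
      also have "\<dots> \<le> 3" by (rule exp_le)
      finally have "K * max 1 (norm w) ^ N \<le> K * 3" using K by (intro mult_left_mono)
      then show "norm (poly A w) \<le> 3 * K" using poly_growth[OF A, of w] by simp
    qed (rule r)
    then show ?thesis by (simp add: r_def)
  qed
  have "norm (poly A (cis s) - poly A (cis t)) \<le> 3 * K * (real N + 1) * norm (cis s - cis t)"
  proof (rule field_differentiable_bound[of "cball 0 1" _ "deriv (poly A)"])
    fix z show "(poly A has_field_derivative deriv (poly A) z) (at z within cball 0 1)"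
      by (rule DERIV_subset[OF DERIV_deriv_iff_field_differentiable[THEN iffD2]])
         (auto intro: poly_DERIV simp: field_differentiable_def)
  qed (use d in auto)
  also have "\<dots> \<le> 3 * K * (real N + 1) * \<bar>s - t\<bar>"
    using K by (intro mult_left_mono norm_cis_diff_le) auto
  finally show ?thesis .
qed

subsection \<open>Reproducing kernel\<close>

text \<open>A family with exact degrees 0, 1, 2, ... is a triangular basis, so it suffices to test
  on it. Used with Chebyshev polynomials and with monomials.\<close>

lemma linear_functional_zero:
  fixes \<Lambda> :: "real poly \<Rightarrow> real"
  assumes add: "\<And>f g. \<Lambda> (f + g) = \<Lambda> f + \<Lambda> g" and smult: "\<And>c f. \<Lambda> (smult c f) = c * \<Lambda> f"
    and z: "\<And>l. l < n \<Longrightarrow> \<Lambda> (c l) = 0"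
    and c: "\<And>l. degree (c l) \<le> l" "\<And>l. coeff (c l) l \<noteq> 0"
    and f: "degree f < n"
  shows "\<Lambda> f = 0"
proof -
  have "degree f \<le> d \<Longrightarrow> d < n \<Longrightarrow> \<Lambda> f = 0" for d f
  proof (induction d arbitrary: f)
    case 0
    then obtain a where f: "f = [:a:]" by (metis degree_eq_zeroE le_zero_eq)
    obtain b where b: "c 0 = [:b:]" using c(1)[of 0] by (metis degree_eq_zeroE le_zero_eq)
    have "b \<noteq> 0" using c(2)[of 0] b by simp
    then have "f = smult (a / b) (c 0)" by (simp add: f b)
    then show ?case using z[of 0] 0 smult by simp
  next
    case (Suc d)
    define k where "k = coeff f (Suc d) / coeff (c (Suc d)) (Suc d)"
    define g where "g = f - smult k (c (Suc d))"
    have "degree g \<le> d"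
    proof (rule degree_le, intro allI impI)
      fix j assume "d < j"
      then consider "j = Suc d" | "Suc d < j" by linarith
      then show "coeff g j = 0"
      proof cases
        case 1 then show ?thesis using c(2)[of "Suc d"] by (simp add: g_def k_def)
      next
        case 2
        then have "coeff f j = 0" "coeff (c (Suc d)) j = 0"
          using Suc.prems(1) c(1)[of "Suc d"] by (auto intro!: coeff_eq_0)
        then show ?thesis by (simp add: g_def)
      qed
    qed
    then have "\<Lambda> g = 0" using Suc by auto
    moreover have "\<Lambda> f = \<Lambda> g + \<Lambda> (smult k (c (Suc d)))"
      using add[of g "smult k (c (Suc d))"] by (simp add: g_def)
    ultimately show ?case using z[of "Suc d"] Suc.prems smult by simp
  qed
  then show ?thesis using f by blast
qed

text \<open>The quotient (P(x) Q(y) - Q(x) P(y)) / (y - x) as a polynomial in y. Synthetic division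
  gives it a meaning at y = x as well.\<close>

definition cd_poly :: "real poly \<Rightarrow> real poly \<Rightarrow> real \<Rightarrow> real poly" where
  "cd_poly P Q x = synthetic_div Q x * P - synthetic_div P x * Q"

lemma cd_poly_mult: "[:- x, 1:] * cd_poly P Q x = smult (poly P x) Q - smult (poly Q x) P"
proof -
  have s: "[:- x, 1:] * synthetic_div P x = P - [:poly P x:]" for P :: "real poly"
    using synthetic_div_correct'[of x P] by (simp add: algebra_simps)
  have "[:- x, 1:] * cd_poly P Q x = ([:- x, 1:] * synthetic_div Q x) * P - ([:- x, 1:] * synthetic_div P x) * Q"
    by (simp only: cd_poly_def right_diff_distrib mult.assoc)
  also have "\<dots> = smult (poly P x) Q - smult (poly Q x) P"
    unfolding s by (simp add: algebra_simps)
  finally show ?thesis .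
qed

lemma degree_mult_linear: "f \<noteq> 0 \<Longrightarrow> degree ([:- x, 1:] * f) = Suc (degree (f :: real poly))"
  by (subst degree_mult_eq) auto

lemma degree_cd_poly:
  assumes "degree P \<le> n" "degree Q \<le> n" "1 \<le> n" shows "degree (cd_poly P Q x) < n"
proof (cases "cd_poly P Q x = 0")
  case False
  have "degree ([:- x, 1:] * cd_poly P Q x) \<le> n"
    unfolding cd_poly_mult using assms
    by (intro degree_diff_le order.trans[OF degree_smult_le]) auto
  then show ?thesis using degree_mult_linear[OF False, of x] by simp
qed (use assms in auto)

lemma coeff_synthetic_div_lead:
  fixes x :: real
  assumes "degree P \<le> Suc n"
  shows "coeff (synthetic_div P x) n = coeff P (Suc n)"
proof -
  have "coeff ([:- x, 1:] * synthetic_div P x + [:poly P x:]) (Suc n) = coeff P (Suc n)"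
    by (simp only: synthetic_div_correct')
  moreover have "coeff (synthetic_div P x) (Suc n) = 0"
    by (rule coeff_eq_0) (use assms in \<open>simp add: degree_synthetic_div\<close>)
  ultimately show ?thesis by simp
qed

text \<open>Write f = f(x) + (y - x) s. Multiplied by y - x, the kernel becomes a combination of P
  and Q, which are orthogonal to s; the constant part needs only the integral of the kernel itself.
  Linearity and orthogonality of the functional are enough.\<close>

lemma christoffel_darboux:
  fixes \<Lambda> :: "real poly \<Rightarrow> real"
  assumes add: "\<And>f g. \<Lambda> (f + g) = \<Lambda> f + \<Lambda> g" and smult: "\<And>c f. \<Lambda> (smult c f) = c * \<Lambda> f"
    and P: "degree P \<le> Suc n" "\<And>f. degree f < Suc n \<Longrightarrow> \<Lambda> (P * f) = 0"
    and Q: "degree Q \<le> n" "\<And>f. degree f < n \<Longrightarrow> \<Lambda> (Q * f) = 0"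
    and lead: "coeff P (Suc n) = k * coeff Q n" and n: "n \<ge> 1"
    and f: "degree f < Suc n"
  shows "\<Lambda> (cd_poly P Q x * f) = - (k * \<Lambda> (Q * Q) * poly f x)"
proof -
  have minus: "\<Lambda> (f - g) = \<Lambda> f - \<Lambda> g" for f g
    using add[of f "smult (-1) g"] smult[of "-1" g] by simp
  let ?D = "cd_poly P Q x" and ?s = "synthetic_div f x"
  have "?D * f = ([:- x, 1:] * ?D) * ?s + smult (poly f x) ?D"
  proof -
    have "f = [:- x, 1:] * ?s + [:poly f x:]" by (rule synthetic_div_correct'[symmetric])
    then have "?D * f = ?D * ([:- x, 1:] * ?s) + ?D * [:poly f x:]" by (metis distrib_left)
    moreover have "?D * ([:- x, 1:] * ?s) = ([:- x, 1:] * ?D) * ?s" by (simp only: mult_ac)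
    moreover have "?D * [:poly f x:] = smult (poly f x) ?D" by simp
    ultimately show ?thesis by (simp only:)
  qed
  then have 1: "\<Lambda> (?D * f) = \<Lambda> (([:- x, 1:] * ?D) * ?s) + poly f x * \<Lambda> ?D"
    by (simp add: add smult)
  have "\<Lambda> (([:- x, 1:] * ?D) * ?s) = poly P x * \<Lambda> (Q * ?s) - poly Q x * \<Lambda> (P * ?s)"
    unfolding cd_poly_mult left_diff_distrib minus by (simp add: smult)
  also have "\<Lambda> (Q * ?s) = 0"
    by (rule Q(2)) (use f n in \<open>simp add: degree_synthetic_div\<close>)
  also have "\<Lambda> (P * ?s) = 0"
    by (rule P(2)) (use f n in \<open>simp add: degree_synthetic_div\<close>)
  finally have 2: "\<Lambda> (([:- x, 1:] * ?D) * ?s) = 0" by simp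
  \<comment> \<open>Leading coefficients cancel, so only k Q survives when this quotient is
    integrated against Q.\<close>
  define g where "g = synthetic_div P x - smult k Q"
  have "degree g \<le> n - 1"
  proof (rule degree_le, intro allI impI)
    fix j assume "n - 1 < j"
    then consider "j = n" | "n < j" by linarith
    then show "coeff g j = 0"
    proof cases
      case 1 then show ?thesis by (simp add: g_def coeff_synthetic_div_lead[OF P(1)] lead)
    next
      case 2
      then show ?thesis using P(1) Q(1) by (simp add: g_def coeff_eq_0 degree_synthetic_div)
    qed
  qed
  then have "\<Lambda> (Q * g) = 0" using n by (intro Q(2)) auto
  moreover have "Q * synthetic_div P x = Q * g + smult k (Q * Q)" by (simp add: g_def right_diff_distrib)
  ultimately have "\<Lambda> (Q * synthetic_div P x) = k * \<Lambda> (Q * Q)" by (simp add: add smult)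
  moreover have "\<Lambda> (P * synthetic_div Q x) = 0"
    by (rule P(2)) (use Q(1) in \<open>simp add: degree_synthetic_div\<close>)
  ultimately have 3: "\<Lambda> ?D = - (k * \<Lambda> (Q * Q))"
    by (simp add: cd_poly_def minus mult.commute)
  show ?thesis unfolding 1 2 3 by simp
qed

text \<open>Adds the bounds c and c a v. The distance v may exceed u, so that the zeros at the
  corners of the square can be measured by the distance to the diagonal.\<close>

lemma min_reciprocal_le:
  fixes a u v :: real
  assumes "0 \<le> x" "x \<le> c" "x \<le> c * a * v" "0 < u" "u \<le> v" "0 < a"
  shows "x / v \<le> 2 * c * (a / (1 + a * u))"
proof -
  have c: "c \<ge> 0" using assms by linarith
  have "a * u \<le> a * v" using assms by (intro mult_left_mono) auto
  then have "x * (1 + a * u) \<le> x * (1 + a * v)" using assms by (intro mult_left_mono) auto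
  also have "\<dots> = x + x * (a * v)" by (simp add: algebra_simps)
  also have "x * (a * v) \<le> c * (a * v)" using assms by (intro mult_right_mono) auto
  finally have "x * (1 + a * u) \<le> 2 * c * a * v" using assms by (simp add: mult.assoc)
  moreover have "0 < 1 + a * u" using assms by (intro add_pos_nonneg) auto
  ultimately show ?thesis using assms by (simp add: field_simps)
qed

text \<open>Throughout, \<open>1 / Q\<close> is the Bernstein--Szego weight with \<open>Q (cos t) = \<bar>A (cis t)\<bar>\<^sup>2\<close>.\<close>

locale bs_weight =
  fixes i :: nat and A Q :: "real poly" and R M :: real
  assumes i: "i \<in> {1,2,3,4}"
    and R: "R > 1" "\<And>\<zeta>. \<zeta> \<in> ball 0 R \<Longrightarrow> poly (cpoly A) \<zeta> \<noteq> 0"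
    and AQ: "\<And>t. poly (cpoly A) (cis t) * poly (cpoly A) (cis (- t)) = of_real (poly Q (cos t))"
    and Q: "\<And>x. x \<in> {-1..1} \<Longrightarrow> 0 < poly Q x" "\<And>x. x \<in> {-1..1} \<Longrightarrow> poly Q x \<le> M"
begin

lemma Q_pos: "0 < poly Q (cos t)" and Q_le: "poly Q (cos t) \<le> M"
  by (rule Q; simp)+

lemma M_pos: "M > 0" using Q_pos[of 0] Q_le[of 0] by linarith

lemma norm_A_cis: "norm (poly (cpoly A) (cis t)) \<le> sqrt M"
proof -
  have "poly (cpoly A) (cis (- t)) = cnj (poly (cpoly A) (cis t))" by (simp add: cnj_cpoly cis_cnj)
  then have "complex_of_real ((norm (poly (cpoly A) (cis t)))\<^sup>2) = of_real (poly Q (cos t))"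
    using AQ[of t] by (simp only: complex_norm_square)
  then have "(norm (poly (cpoly A) (cis t)))\<^sup>2 = poly Q (cos t)" by (simp only: of_real_eq_iff)
  then have "(norm (poly (cpoly A) (cis t)))\<^sup>2 \<le> M" using Q_le by simp
  then show ?thesis by (rule real_le_rsqrt)
qed

lemma A0: "coeff A 0 \<noteq> 0"
  using R(2)[of 0] R(1) by (simp add: poly_0_coeff_0 coeff_map_poly)

definition amp :: real where "amp = wscale i * sqrt M"

lemma amp_pos: "amp > 0"
  using M_pos wscale_bounds(1)[of i] by (simp add: amp_def)

lemma norm_bs_wave: "norm (bs_wave i A n t) \<le> amp"
  using norm_A_cis[of "- t"] wscale_bounds(1)[of i] by (simp add: bs_wave_def amp_def norm_mult mult_left_mono)

text \<open>The half-angle shift writes the waves of \<open>bs i A n\<close> and \<open>bs i A (n - 1)\<close> as the two rotations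
  \<open>hwave n t * cis (\<plusminus> t / 2)\<close> of a single wave.\<close>

definition hwave :: "nat \<Rightarrow> real \<Rightarrow> complex" where
  "hwave n t = bs_wave i A n t * cis (- (t / 2))"

lemma norm_hwave: "norm (hwave n t) \<le> amp"
  using norm_bs_wave by (simp add: hwave_def norm_mult)

lemma hwave_eq:
  "hwave n t = of_real (wscale i) * (cis ((n + freq_shift i / 2 - 1 / 2) * t - phase i) * poly (cpoly A) (cis (- t)))"
proof -
  have "cis ((n + freq_shift i / 2) * t - phase i) * cis (- (t / 2)) = cis ((n + freq_shift i / 2 - 1 / 2) * t - phase i)"
    unfolding cis_mult by (simp add: algebra_simps)
  then show ?thesis by (simp add: hwave_def bs_wave_def mult_ac)
qed

lemma hwave_uminus: "hwave n (- t) = of_real (parity_sign i) * cnj (hwave n t)"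
proof -
  define l where "l = n + freq_shift i / 2 - 1 / 2"
  have "cis (- (l * t) - phase i) = of_real (parity_sign i) * cis (- (l * t) + phase i)"
    unfolding parity_sign_cis2(1) cis_mult by (simp add: minus_diff_commute)
  then show ?thesis
    by (simp add: hwave_eq cnj_cpoly cis_cnj l_def[symmetric] mult_ac add.commute)
qed

text \<open>Twice the frequency is an integer, so a full turn changes the wave by a sign at
  most.\<close>

lemma hwave_periodic: "\<exists>s::real. \<bar>s\<bar> = 1 \<and> (\<forall>t. hwave n (t + 2 * pi) = of_real s * hwave n t)"
proof -
  define k where "k = 2 * int n + int (freq_shift i) - 1"
  have s0: "sin (of_int k * pi) = 0" by (simp add: sin_times_pi_eq_0)
  then have "cis (of_int k * pi) = of_real (cos (of_int k * pi))"
    by (simp add: complex_eq_iff)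
  moreover have "\<bar>cos (of_int k * pi)\<bar> = 1"
    using sin_cos_squared_add[of "of_int k * pi"] s0 by (auto simp: power2_eq_1_iff)
  moreover have "hwave n (t + 2 * pi) = cis (of_int k * pi) * hwave n t" for t
  proof -
    have "(n + freq_shift i / 2 - 1 / 2) * (t + 2 * pi) - phase i = of_int k * pi + ((n + freq_shift i / 2 - 1 / 2) * t - phase i)"
      by (simp add: k_def field_simps)
    moreover have "cis (- (t + 2 * pi)) = cis (- t)"
      by (simp add: complex_eq_iff cos_diff sin_diff)
    ultimately show ?thesis unfolding hwave_eq by (simp only: cis_mult[symmetric] mult_ac)
  qed
  ultimately show ?thesis by (intro exI[of _ "cos (of_int k * pi)"]) auto
qed

text \<open>The polynomial factor contributes 3 n, the exponential its frequency, at most n + 1/2;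
  together they are below 6 n.\<close>

lemma hwave_lipschitz:
  assumes "degree A < n"
  shows "norm (hwave n s - hwave n t) \<le> amp * (6 * real n) * \<bar>s - t\<bar>"
proof -
  define l where "l = n + freq_shift i / 2 - 1 / 2"
  let ?A = "\<lambda>t. poly (cpoly A) (cis (- t))" and ?c = "\<lambda>t. cis (l * t - phase i)"
  have w: "0 \<le> wscale i" using wscale_bounds(1)[of i] by linarith
  have n1: "1 \<le> real n" using assms by (cases n) auto
  have l: "0 \<le> l" "l \<le> n + 1 / 2" using n1 by (auto simp: l_def freq_shift_def)
  have dA: "degree (cpoly A) \<le> n - 1" using assms by (simp add: degree_map_poly)
  have 1: "norm (?A s - ?A t) \<le> 3 * sqrt M * real n * \<bar>s - t\<bar>"
    using poly_cis_lipschitz[OF dA norm_A_cis, of "- s" "- t"] n1 by (simp add: of_nat_diff abs_minus_commute)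
  have 2: "norm (?c s - ?c t) \<le> l * \<bar>s - t\<bar>"
  proof -
    have "l * s - phase i - (l * t - phase i) = l * (s - t)" by (simp add: algebra_simps)
    then show ?thesis using norm_cis_diff_le[of "l * s - phase i" "l * t - phase i"] l by (simp add: abs_mult)
  qed
  have "?c s * ?A s - ?c t * ?A t = ?c s * (?A s - ?A t) + (?c s - ?c t) * ?A t" by (simp add: algebra_simps)
  then have "norm (?c s * ?A s - ?c t * ?A t) \<le> norm (?A s - ?A t) + norm (?c s - ?c t) * norm (?A t)"
    using norm_triangle_ineq[of "?c s * (?A s - ?A t)" "(?c s - ?c t) * ?A t"] by (simp add: norm_mult)
  also have "\<dots> \<le> 3 * sqrt M * real n * \<bar>s - t\<bar> + (l * \<bar>s - t\<bar>) * sqrt M"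
    using 1 2 norm_A_cis[of "- t"] l by (intro add_mono mult_mono) auto
  also have "\<dots> = sqrt M * (3 * n + l) * \<bar>s - t\<bar>" by (simp add: algebra_simps)
  also have "\<dots> \<le> sqrt M * (6 * n) * \<bar>s - t\<bar>"
    using l n1 M_pos by (intro mult_right_mono mult_left_mono) auto
  finally have "norm (?c s * ?A s - ?c t * ?A t) \<le> sqrt M * (6 * n) * \<bar>s - t\<bar>" .
  then have "wscale i * norm (?c s * ?A s - ?c t * ?A t) \<le> wscale i * (sqrt M * (6 * n) * \<bar>s - t\<bar>)"
    using w by (intro mult_left_mono)
  moreover have "hwave n s - hwave n t = of_real (wscale i) * (?c s * ?A s - ?c t * ?A t)"
    unfolding hwave_eq l_def by (simp add: right_diff_distrib)
  ultimately show ?thesis using w by (simp add: norm_mult amp_def mult_ac)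
qed

text \<open>On the diagonal the product is a squared modulus, hence real, so the imaginary part is
  bounded by the Lipschitz constant times \<bar>s - t\<bar>.\<close>

lemma Im_hwave_cnj:
  assumes "degree A < n"
  shows "\<bar>Im (hwave n s * cnj (hwave n t))\<bar> \<le> amp\<^sup>2" "\<bar>Im (hwave n s * cnj (hwave n t))\<bar> \<le> amp\<^sup>2 * (6 * real n) * \<bar>s - t\<bar>"
proof -
  have "\<bar>Im (hwave n s * cnj (hwave n t))\<bar> \<le> norm (hwave n s * cnj (hwave n t))" by (rule abs_Im_le_cmod)
  also have "\<dots> \<le> amp * amp" unfolding norm_mult using norm_hwave amp_pos by (intro mult_mono) auto
  finally show "\<bar>Im (hwave n s * cnj (hwave n t))\<bar> \<le> amp\<^sup>2" by (simp add: power2_eq_square)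
  have "Im (hwave n s * cnj (hwave n t)) = Im ((hwave n s - hwave n t) * cnj (hwave n t))"
    by (simp add: algebra_simps)
  then have "\<bar>Im (hwave n s * cnj (hwave n t))\<bar> \<le> norm ((hwave n s - hwave n t) * cnj (hwave n t))"
    using abs_Im_le_cmod by metis
  also have "\<dots> \<le> (amp * (6 * real n) * \<bar>s - t\<bar>) * amp"
    unfolding norm_mult using hwave_lipschitz[OF assms] norm_hwave amp_pos by (intro mult_mono) auto
  finally show "\<bar>Im (hwave n s * cnj (hwave n t))\<bar> \<le> amp\<^sup>2 * (6 * real n) * \<bar>s - t\<bar>"
    by (simp add: power2_eq_square mult_ac)
qed

text \<open>Reflection and periodicity turn this product, up to sign, into the one with a conjugate
  at -t or 2 \<pi> - t. The imaginary part thus vanishes for s + t = 0 and s + t = 2 \<pi>.\<close>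

lemma Im_hwave_mult:
  assumes "degree A < n"
  shows "\<bar>Im (hwave n s * hwave n t)\<bar> \<le> amp\<^sup>2"
    "\<bar>Im (hwave n s * hwave n t)\<bar> \<le> amp\<^sup>2 * (6 * real n) * \<bar>s + t\<bar>"
    "\<bar>Im (hwave n s * hwave n t)\<bar> \<le> amp\<^sup>2 * (6 * real n) * \<bar>2 * pi - (s + t)\<bar>"
proof -
  have sg: "\<bar>parity_sign i\<bar> = 1" by (simp add: parity_sign_def)
  have im: "Im (complex_of_real r * z) = r * Im z" for r z by simp
  have c1: "cnj (hwave n (- t)) = of_real (parity_sign i) * hwave n t" by (simp add: hwave_uminus)
  have 1: "\<bar>Im (hwave n s * cnj (hwave n (- t)))\<bar> = \<bar>Im (hwave n s * hwave n t)\<bar>"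
  proof -
    have "hwave n s * cnj (hwave n (- t)) = of_real (parity_sign i) * (hwave n s * hwave n t)"
      unfolding c1 by (simp add: mult_ac)
    then show ?thesis by (simp only: im abs_mult sg mult_1_left)
  qed
  obtain r where r: "\<bar>r\<bar> = 1" "\<And>t. hwave n (t + 2 * pi) = of_real r * hwave n t" using hwave_periodic by blast
  have 2: "\<bar>Im (hwave n s * cnj (hwave n (- t + 2 * pi)))\<bar> = \<bar>Im (hwave n s * hwave n t)\<bar>"
  proof -
    have "hwave n s * cnj (hwave n (- t + 2 * pi)) = of_real r * (hwave n s * cnj (hwave n (- t)))"
      unfolding r(2) by (simp add: mult_ac)
    then show ?thesis using 1 by (simp only: im abs_mult r(1) mult_1_left)
  qed
  show "\<bar>Im (hwave n s * hwave n t)\<bar> \<le> amp\<^sup>2"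
    using Im_hwave_cnj(1)[OF assms, of s "- t"] unfolding 1 .
  show "\<bar>Im (hwave n s * hwave n t)\<bar> \<le> amp\<^sup>2 * (6 * real n) * \<bar>s + t\<bar>"
    using Im_hwave_cnj(2)[OF assms, of s "- t"] unfolding 1 by simp
  have "s - (- t + 2 * pi) = - (2 * pi - (s + t))" by simp
  then have "\<bar>s - (- t + 2 * pi)\<bar> = \<bar>2 * pi - (s + t)\<bar>" by (simp only: abs_minus_cancel)
  then show "\<bar>Im (hwave n s * hwave n t)\<bar> \<le> amp\<^sup>2 * (6 * real n) * \<bar>2 * pi - (s + t)\<bar>"
    using Im_hwave_cnj(2)[OF assms, of s "- t + 2 * pi"] unfolding 2 by simp
qed

definition kern :: "nat \<Rightarrow> real \<Rightarrow> real \<Rightarrow> real" where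
  "kern n s t = sqrt_weight i s * sqrt_weight i t * poly (cd_poly (bs i A n) (bs i A (n - 1)) (cos s)) (cos t)"

lemma wave_identity:
  fixes b c :: complex and s t :: real
  shows "Re (b * cis (s / 2)) * Re (c * cis (- (t / 2))) - Re (b * cis (- (s / 2))) * Re (c * cis (t / 2))
    = sin ((t - s) / 2) * Im (b * c) - sin ((t + s) / 2) * Im (b * cnj c)"
  by (simp add: diff_divide_distrib add_divide_distrib sin_diff sin_add algebra_simps)

text \<open>The numerator is sin ((t - s)/2) Im (h(s) h(t)) - sin ((t + s)/2) Im (h(s) cnj (h(t)))
  and the denominator is -2 times the product of the two sines. The quotient has two terms with one
  singularity each, on the diagonal or at the corners s + t = 0 and 2 \<pi>, and the imaginary parts
  vanish exactly there. Waves of degree n and n - 1 occur, hence the bound n - 1 for A.\<close>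

lemma kern_bound:
  assumes n: "degree A < n - 1" and s: "s \<in> {0..pi}" and t: "t \<in> {0..pi}" and st: "s \<noteq> t"
  shows "\<bar>kern n s t\<bar> \<le> 8 * amp\<^sup>2 * (6 * real n / (1 + 6 * real n * \<bar>s - t\<bar>))"
proof -
  let ?P = "bs i A n" and ?Q = "bs i A (n - 1)"
  let ?X = "Im (hwave n s * hwave n t)" and ?Y = "Im (hwave n s * cnj (hwave n t))"
  let ?p = "sin ((t + s) / 2)" and ?m = "sin ((t - s) / 2)"
  have n1: "real n > 0" using n by auto
  have dA: "degree A < n" using n by simp
  have B: "bs_wave i A n r = hwave n r * cis (r / 2)" for r
    unfolding hwave_def by (simp add: mult.assoc cis_mult)
  have B1: "bs_wave i A (n - 1) r = hwave n r * cis (- (r / 2))" for r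
  proof -
    have e: "(real (n - 1) + freq_shift i / 2) * r - phase i = (n + freq_shift i / 2) * r - phase i + (- (r / 2)) + (- (r / 2))"
      using n by (simp add: of_nat_diff algebra_simps)
    show ?thesis unfolding hwave_def bs_wave_def e by (simp only: cis_mult[symmetric] mult_ac)
  qed
  have "poly ([:- cos s, 1:] * cd_poly ?P ?Q (cos s)) (cos t) = poly ?P (cos s) * poly ?Q (cos t) - poly ?Q (cos s) * poly ?P (cos t)"
    unfolding cd_poly_mult by simp
  then have "(cos t - cos s) * poly (cd_poly ?P ?Q (cos s)) (cos t) = poly ?P (cos s) * poly ?Q (cos t) - poly ?Q (cos s) * poly ?P (cos t)"
    by (simp add: algebra_simps)
  then have "(cos t - cos s) * kern n s t = (sqrt_weight i s * poly ?P (cos s)) * (sqrt_weight i t * poly ?Q (cos t)) - (sqrt_weight i s * poly ?Q (cos s)) * (sqrt_weight i t * poly ?P (cos t))"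
    unfolding kern_def by (metis (no_types, opaque_lifting) mult.assoc mult.left_commute right_diff_distrib')
  also have "\<dots> = ?m * ?X - ?p * ?Y"
    using n s t by (simp only: bs_eq_Re_wave[OF i s] bs_eq_Re_wave[OF i t] less_imp_le dA B B1 wave_identity)
  also have "cos t - cos s = - (2 * ?p * ?m)"
  proof -
    have "(s - t) / 2 = - ((t - s) / 2)" by (simp add: field_simps)
    then show ?thesis by (simp only: cos_diff_cos[of t s] sin_minus)
  qed
  finally have K: "2 * ?p * ?m * kern n s t = ?p * ?Y - ?m * ?X" by simp
  have u: "\<bar>s - t\<bar> > 0" using st by simp
  have m: "\<bar>s - t\<bar> / 4 \<le> \<bar>?m\<bar>" 
  proof -
    have "\<bar>t - s\<bar> \<le> pi" using s t by (auto simp: abs_le_iff)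
    from abs_sin_half_ge[OF this] show ?thesis by (simp add: abs_minus_commute)
  qed
  have p0: "?p \<ge> 0" using s t by (intro sin_ge_zero) auto
  \<comment> \<open>Distance of s + t from 0 and 2 \<pi>; on the square it dominates \<bar>s -
    t\<bar>, so both terms obey the same bound.\<close>
  define v where "v = min (s + t) (2 * pi - (s + t))"
  have v: "\<bar>s - t\<bar> \<le> v" using s t by (auto simp: v_def)
  have p: "v / 4 \<le> ?p"
  proof (cases "s + t \<le> pi")
    case True
    then show ?thesis using abs_sin_half_ge[of "t + s"] s t p0 by (simp add: v_def add.commute)
  next
    case False
    have "sin ((2 * pi - (s + t)) / 2) = ?p"
      using sin_pi_minus[of "(t + s) / 2"] by (simp add: diff_divide_distrib add.commute)
    then show ?thesis using abs_sin_half_ge[of "2 * pi - (s + t)"] s t p0 False by (simp add: v_def)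
  qed
  have pp: "?p > 0" and mp: "\<bar>?m\<bar> > 0" using p m v u by auto
  have "kern n s t = ?Y / (2 * ?m) - ?X / (2 * ?p)"
    using K pp mp by (simp add: field_simps)
  then have "\<bar>kern n s t\<bar> \<le> \<bar>?Y\<bar> / (2 * \<bar>?m\<bar>) + \<bar>?X\<bar> / (2 * ?p)"
    using abs_triangle_ineq4[of "?Y / (2 * ?m)" "?X / (2 * ?p)"] pp by (simp add: abs_divide abs_mult)
  also have "\<bar>?Y\<bar> / (2 * \<bar>?m\<bar>) \<le> \<bar>?Y\<bar> / (\<bar>s - t\<bar> / 2)"
    using m u by (intro divide_left_mono mult_pos_pos) auto
  also have "\<bar>?X\<bar> / (2 * ?p) \<le> \<bar>?X\<bar> / (v / 2)"
    using p u v pp by (intro divide_left_mono mult_pos_pos) auto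
  also have "\<bar>?Y\<bar> / (\<bar>s - t\<bar> / 2) = 2 * (\<bar>?Y\<bar> / \<bar>s - t\<bar>)" by simp
  also have "\<bar>?X\<bar> / (v / 2) = 2 * (\<bar>?X\<bar> / v)" by simp
  also have "\<bar>?Y\<bar> / \<bar>s - t\<bar> \<le> 2 * amp\<^sup>2 * (6 * real n / (1 + 6 * real n * \<bar>s - t\<bar>))"
    using Im_hwave_cnj[OF dA, of s t] u n1 by (intro min_reciprocal_le) auto
  also have "\<bar>?X\<bar> / v \<le> 2 * amp\<^sup>2 * (6 * real n / (1 + 6 * real n * \<bar>s - t\<bar>))"
  proof (intro min_reciprocal_le)
    show "\<bar>?X\<bar> \<le> amp\<^sup>2 * (6 * real n) * v"
      using Im_hwave_mult(2,3)[OF dA, of s t] s t by (simp add: v_def min_def)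
  qed (use Im_hwave_mult(1)[OF dA, of s t] u v n1 in auto)
  finally show ?thesis by (simp add: mult_ac)
qed

end

section \<open>Passing from the interval to the exterior\<close>

lemma degree_less_of_coeff:
  "degree g \<le> n \<Longrightarrow> coeff g n = 0 \<Longrightarrow> 1 \<le> n \<Longrightarrow> degree g < n"
  by (metis degree_0 le_neq_implies_less leading_coeff_0_iff less_one linorder_not_less)

text \<open>The modulus alone, but for every angle, as the maximum principle on the whole circle
  requires.\<close>

lemma norm_szego_den_cis:
  assumes i: "i \<in> {1,2,3,4}"
  shows "norm (szego_den i (cis t)) = 2 / wscale i * sqrt_weight i t"
proof -
  have sc: "(sin t)\<^sup>2 = 1 - (cos t)\<^sup>2" by (simp add: sin_squared_eq)
  have v: "\<bar>(cos t)\<^sup>2 - 1\<bar> = 1 - (cos t)\<^sup>2" "\<bar>cos t + 1\<bar> = 1 + cos t" "\<bar>cos t - 1\<bar> = 1 - cos t"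
    using sc zero_le_power2[of "sin t"] cos_ge_minus_one[of t] cos_le_one[of t] by linarith+
  have c2: "cos (2 * t) = 2 * (cos t)\<^sup>2 - 1" by (rule cos_double_cos)
  consider "i = 1" | "i = 2" | "i = 3" | "i = 4" using i by auto
  then have "(norm (szego_den i (cis t)))\<^sup>2 = (2 / wscale i * sqrt_weight i t)\<^sup>2"
  proof cases
    case 1 then show ?thesis by (simp add: szego_den_def wscale_def sqrt_weight_def v_poly_def)
  next
    case 2
    have "(norm (1 - (cis t)\<^sup>2))\<^sup>2 = 4 * (1 - (cos t)\<^sup>2)"
    proof -
      have "(cis t)\<^sup>2 = cis (2 * t)" by (simp add: Complex.DeMoivre)
      then have "(norm (1 - (cis t)\<^sup>2))\<^sup>2 = (1 - cos (2 * t))\<^sup>2 + (sin (2 * t))\<^sup>2" by (simp add: cmod_power2)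
      also have "\<dots> = 2 - 2 * cos (2 * t)" by (simp add: sin_squared_eq power2_diff)
      finally show ?thesis by (simp add: c2)
    qed
    then show ?thesis using 2 by (simp add: szego_den_def wscale_def power_mult_distrib sqrt_weight_square v_poly_def v)
  next
    case 3
    have "(norm (1 + cis t))\<^sup>2 = 2 * (1 + cos t)"
      by (simp add: cmod_power2 power2_sum sc)
    then show ?thesis using 3
      by (simp add: szego_den_def wscale_def power_mult_distrib power_divide sqrt_weight_square v_poly_def v)
  next
    case 4
    have "(norm (1 - cis t))\<^sup>2 = 2 * (1 - cos t)"
      by (simp add: cmod_power2 power2_diff sc)
    then show ?thesis using 4
      by (simp add: szego_den_def wscale_def power_mult_distrib power_divide sqrt_weight_square v_poly_def v)
  qed
  then show ?thesis
    using wscale_bounds(1)[of i] sqrt_weight_nonneg[of i t] by (subst (asm) power2_eq_iff_nonneg) auto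
qed

text \<open>A form of the Bernstein--Walsh inequality: after multiplication by \<open>\<zeta>\<^sup>n\<close> a polynomial of degree at
  most \<open>n\<close> in \<open>joukowski \<zeta>\<close> becomes a polynomial in \<open>\<zeta>\<close>, to which the maximum principle applies.\<close>

lemma bernstein_walsh:
  fixes f :: "real poly"
  assumes i: "i \<in> {1,2,3,4}" and f: "degree f \<le> n"
    and b: "\<And>t. t \<in> {0..pi} \<Longrightarrow> \<bar>sqrt_weight i t * poly f (cos t)\<bar> \<le> \<eta>"
    and \<zeta>: "\<zeta> \<noteq> 0" "norm \<zeta> \<le> 1"
  shows "norm (szego_den i \<zeta> * \<zeta> ^ n * poly (cpoly f) (joukowski \<zeta>)) \<le> 2 * \<eta>"
proof -
  \<comment> \<open>The product with the denominators cleared; unlike the original expression it is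
    defined and holomorphic at 0.\<close>
  define G where "G = (\<lambda>z. szego_den i z * (\<Sum>k\<le>n. of_real (coeff f k) * (z ^ (n - k) * ((z\<^sup>2 + 1) / 2) ^ k)))"
  have G: "G z = szego_den i z * z ^ n * poly (cpoly f) (joukowski z)" if z: "z \<noteq> 0" for z
  proof -
    have "poly (cpoly f) (joukowski z) = (\<Sum>k\<le>n. of_real (coeff f k) * joukowski z ^ k)"
      unfolding poly_altdef by (rule sum.mono_neutral_cong_left) (use f in \<open>auto simp: coeff_map_poly degree_map_poly coeff_eq_0\<close>)
    moreover have "z ^ (n - k) * ((z\<^sup>2 + 1) / 2) ^ k = z ^ n * joukowski z ^ k" if "k \<le> n" for k
    proof -
      have "(z\<^sup>2 + 1) / 2 = z * joukowski z" using z by (simp add: joukowski_def field_simps power2_eq_square)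
      moreover have "z ^ (n - k) * z ^ k = z ^ n" using that by (simp flip: power_add)
      ultimately show ?thesis by (simp add: power_mult_distrib flip: mult.assoc)
    qed
    ultimately show ?thesis by (simp add: G_def sum_distrib_left mult_ac)
  qed
  \<comment> \<open>The weighted polynomial depends on cos t only, so the bound extends from
    [0, \<pi>] to all angles.\<close>
  have gb: "\<bar>sqrt_weight i t * poly f (cos t)\<bar> \<le> \<eta>" for t
  proof -
    have "arccos (cos t) \<in> {0..pi}" by (simp add: arccos_lbound arccos_ubound)
    from b[OF this] show ?thesis by (simp add: sqrt_weight_def)
  qed
  have "norm (G \<zeta>) \<le> 2 * \<eta>"
  proof (rule norm_le_on_disc[of G "2 * \<eta>" \<zeta>])
    have "szego_den i holomorphic_on UNIV"
      unfolding szego_den_def[abs_def] using i by (auto intro!: holomorphic_intros)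
    then show "G holomorphic_on UNIV"
      unfolding G_def by (intro holomorphic_intros) auto
    fix t
    have "norm (G (cis t)) = norm (szego_den i (cis t)) * \<bar>poly f (cos t)\<bar>"
      by (simp add: G[OF cis_neq_zero] norm_mult norm_power joukowski_cis)
    also have "\<dots> = 2 / wscale i * \<bar>sqrt_weight i t * poly f (cos t)\<bar>"
      unfolding norm_szego_den_cis[OF i] using sqrt_weight_nonneg[of i t] by (simp add: abs_mult)
    also have "\<dots> \<le> 2 / 1 * \<eta>"
      using gb[of t] wscale_bounds(1)[of i] by (intro mult_mono divide_left_mono) auto
    finally show "norm (G (cis t)) \<le> 2 * \<eta>" by simp
  qed (rule \<zeta>(2))
  then show ?thesis using G[OF \<zeta>(1)] by simp
qed

section \<open>Comparison of orthogonal with Bernstein-Szego polynomials\<close>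

context bs_weight
begin

definition Lam :: "real poly \<Rightarrow> real" where
  "Lam f = integral {0..pi} (\<lambda>t. (sqrt_weight i t)\<^sup>2 * poly f (cos t) / poly Q (cos t))"

lemma Lam_integrable: "(\<lambda>t. (sqrt_weight i t)\<^sup>2 * poly f (cos t) / poly Q (cos t)) integrable_on {0..pi}"
  using Q_pos
  by (intro integrable_continuous_real continuous_intros continuous_on_sqrt_weight) (auto simp: less_imp_neq[symmetric])

lemma Lam_add: "Lam (f + g) = Lam f + Lam g"
  unfolding Lam_def integral_add[OF Lam_integrable Lam_integrable, symmetric]
  by (simp add: distrib_left add_divide_distrib)

lemma Lam_smult: "Lam (smult c f) = c * Lam f"
  unfolding Lam_def integral_mult_right[symmetric] by (simp add: mult_ac)

lemma Lam_minus: "Lam (f - g) = Lam f - Lam g"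
  using Lam_add[of f "smult (-1) g"] Lam_smult[of "-1" g] by simp

lemma Lam_bs_cheb:
  assumes "degree A \<le> n" "1 \<le> n" "l \<le> n"
  shows "Lam (bs i A n * cheb i l) = (if l = n then (wscale i)\<^sup>2 * pi / (2 * coeff A 0) else 0)"
  using bs_cheb_integral[OF i R AQ assms] by (simp add: Lam_def power2_eq_square mult_ac)

lemma cheb_coeff_nonzero: "coeff (cheb i l) l \<noteq> 0"
  by (cases l) (auto simp: cheb_lead lead_factor_def simp del: cheb.simps(2,3))

lemma Lam_bs_orth:
  assumes "degree A \<le> n" "1 \<le> n" "degree f < n"
  shows "Lam (bs i A n * f) = 0"
proof (rule linear_functional_zero[of "\<lambda>f. Lam (bs i A n * f)" n "cheb i"])
  show "Lam (bs i A n * (f + g)) = Lam (bs i A n * f) + Lam (bs i A n * g)" for f g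
    by (simp add: distrib_left Lam_add)
  show "Lam (bs i A n * smult c f) = c * Lam (bs i A n * f)" for c f
    by (simp add: Lam_smult)
qed (use assms in \<open>auto simp: Lam_bs_cheb cheb_degree cheb_coeff_nonzero\<close>)

text \<open>Up to lower degree the polynomial is its first Chebyshev term, and the factor
  \<open>coeff A 0\<close> cancels. The norm does not depend on A, which keeps the later constants
  uniform.\<close>

lemma Lam_bs_square:
  assumes "degree A < n"
  shows "Lam (bs i A n * bs i A n) = (wscale i)\<^sup>2 * pi / 2"
proof -
  define g where "g = bs i A n - smult (coeff A 0) (cheb i n)"
  have n: "1 \<le> n" "degree A \<le> n" using assms by auto
  have "coeff (cheb i n) n = 2 ^ n * lead_factor i" using n by (cases n) (auto simp: cheb_lead simp del: cheb.simps(2,3))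
  then have "coeff g n = 0" by (simp add: g_def bs_lead[OF assms])
  moreover have "degree g \<le> n"
    unfolding g_def by (intro degree_diff_le bs_degree order.trans[OF degree_smult_le] cheb_degree)
  ultimately have "degree g < n" using n by (intro degree_less_of_coeff)
  then have "Lam (bs i A n * g) = 0" using n by (intro Lam_bs_orth)
  moreover have "bs i A n * bs i A n = bs i A n * g + smult (coeff A 0) (bs i A n * cheb i n)"
    by (simp add: g_def right_diff_distrib)
  ultimately have "Lam (bs i A n * bs i A n) = coeff A 0 * Lam (bs i A n * cheb i n)"
    by (simp add: Lam_add Lam_smult)
  then show ?thesis using Lam_bs_cheb[OF n(2,1), of n] A0 by simp
qed

text \<open>The factor is the ratio 2 of the leading coefficients times the squared norm.\<close>

lemma reproducing:
  assumes n: "degree A < n - 1" and f: "degree f < n"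
  shows "Lam (cd_poly (bs i A n) (bs i A (n - 1)) x * f) = - ((wscale i)\<^sup>2 * pi * poly f x)"
proof -
  obtain k where k: "n = Suc k" using n by (cases n) auto
  have k1: "degree A < k" using n by (simp add: k)
  have "Lam (cd_poly (bs i A (Suc k)) (bs i A k) x * f) = - (2 * Lam (bs i A k * bs i A k) * poly f x)"
  proof (rule christoffel_darboux[OF Lam_add Lam_smult])
    show "coeff (bs i A (Suc k)) (Suc k) = 2 * coeff (bs i A k) k"
      using k1 by (simp add: bs_lead)
  qed (use k1 f k in \<open>auto intro!: bs_degree Lam_bs_orth\<close>)
  then show ?thesis using Lam_bs_square[OF k1] by (simp add: k)
qed

text \<open>The kernel representation of the difference contains P itself, through the maximum X of
  its weighted modulus. By \<open>small\<close> the factor in front of X is at most 1/2; hence X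
  \<le> 2 amp, and this is inserted again. Equal leading coefficients put the difference into the
  space where the kernel reproduces.\<close>

lemma orthogonal_minus_bs_bound:
  fixes P :: "real poly" and \<rho> :: "real \<Rightarrow> real"
  assumes n: "degree A < n - 1" and \<rho>: "continuous_on {-1..1} \<rho>"
    and \<delta>: "\<And>x. x \<in> {-1..1} \<Longrightarrow> \<bar>\<rho> x - 1 / poly Q x\<bar> \<le> \<delta>"
    and P: "degree P \<le> n" "coeff P n = coeff (bs i A n) n"
    and orth: "\<And>g. degree g < n \<Longrightarrow> integral {0..pi} (\<lambda>t. (sqrt_weight i t)\<^sup>2 * poly (P * g) (cos t) * \<rho> (cos t)) = 0"
    and small: "12 * M * \<delta> * ln (1 + 6 * real n * pi) \<le> 1"
    and s: "s \<in> {0..pi}"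
  shows "\<bar>sqrt_weight i s * poly (P - bs i A n) (cos s)\<bar> \<le> 12 * M * amp * \<delta> * ln (1 + 6 * real n * pi)"
proof -
  define L where "L = ln (1 + 6 * real n * pi)"
  define u where "u = (\<lambda>t. sqrt_weight i t * poly P (cos t))"
  have n0: "real n > 0" using n by auto
  have L: "L \<ge> 0" unfolding L_def by (rule ln_ge_zero) simp
  have \<delta>0: "\<delta> \<ge> 0" using \<delta>[of 0] by auto
  have w: "wscale i > 0" using wscale_bounds(1)[of i] by linarith
  have \<rho>c: "continuous_on {0..pi} (\<lambda>t. \<rho> (cos t))" by (rule continuous_on_comp_cos[OF \<rho>])
  have Qc: "continuous_on {0..pi} (\<lambda>t. 1 / poly Q (cos t))"
    using Q_pos by (intro continuous_intros) (auto simp: less_imp_neq[symmetric])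
  have "continuous_on {0..pi} (\<lambda>t. \<bar>u t\<bar>)"
    unfolding u_def by (intro continuous_intros continuous_on_sqrt_weight)
  then obtain t0 where t0: "t0 \<in> {0..pi}" "\<And>t. t \<in> {0..pi} \<Longrightarrow> \<bar>u t\<bar> \<le> \<bar>u t0\<bar>"
    using continuous_attains_sup[of "{0..pi}" "\<lambda>t. \<bar>u t\<bar>"] by auto
  define X where "X = \<bar>u t0\<bar>"
  have X: "X \<ge> 0" by (simp add: X_def)
  have diff: "\<bar>sqrt_weight i s * poly (P - bs i A n) (cos s)\<bar> \<le> 6 * M * \<delta> * X * L" if s: "s \<in> {0..pi}" for s
  proof -
    let ?D = "cd_poly (bs i A n) (bs i A (n - 1)) (cos s)"
    let ?h = "\<lambda>t. sqrt_weight i s * ((sqrt_weight i t)\<^sup>2 * poly (P * ?D) (cos t) * (1 / poly Q (cos t) - \<rho> (cos t)))"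
    have f: "degree (P - bs i A n) < n"
      by (rule degree_less_of_coeff) (use P n bs_degree in \<open>auto intro!: degree_diff_le\<close>)
    have D: "degree ?D < n"
      by (rule degree_cd_poly) (use n bs_degree[of i A] in \<open>auto intro: order.trans[OF bs_degree]\<close>)
    have "Lam (?D * bs i A n) = 0"
      using Lam_bs_orth[OF _ _ D] n by (simp add: mult.commute)
    then have "Lam (?D * (P - bs i A n)) = Lam (P * ?D)"
      by (simp add: left_diff_distrib Lam_minus mult.commute)
    then have "- ((wscale i)\<^sup>2 * pi * poly (P - bs i A n) (cos s)) = Lam (P * ?D)"
      using reproducing[OF n f] by simp
    also have "\<dots> = Lam (P * ?D) - integral {0..pi} (\<lambda>t. (sqrt_weight i t)\<^sup>2 * poly (P * ?D) (cos t) * \<rho> (cos t))"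
      using orth[OF D] by simp
    also have "\<dots> = integral {0..pi} (\<lambda>t. (sqrt_weight i t)\<^sup>2 * poly (P * ?D) (cos t) / poly Q (cos t) - (sqrt_weight i t)\<^sup>2 * poly (P * ?D) (cos t) * \<rho> (cos t))"
      unfolding Lam_def
      by (rule integral_diff[symmetric, OF Lam_integrable])
         (intro integrable_continuous_real continuous_intros continuous_on_sqrt_weight \<rho>c)
    finally have f1: "sqrt_weight i s * - ((wscale i)\<^sup>2 * pi * poly (P - bs i A n) (cos s)) = integral {0..pi} ?h"
      by (simp only: integral_mult_right[symmetric] right_diff_distrib divide_inverse mult_1_left mult.assoc)
    have "\<bar>integral {0..pi} ?h\<bar> \<le> 8 * amp\<^sup>2 * X * \<delta> * (2 * L)"
    proof -
      \<comment> \<open>The kernel bound excludes the diagonal, so the integrand is changed at the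
        single point t = s.\<close>
      let ?h' = "\<lambda>t. if t = s then 0 else ?h t"
      let ?r = "\<lambda>t. 6 * real n / (1 + 6 * real n * \<bar>s - t\<bar>)"
      have hi: "?h integrable_on {0..pi}"
        by (intro integrable_continuous_real continuous_intros continuous_on_sqrt_weight \<rho>c Qc)
      have h'i: "?h' integrable_on {0..pi}"
        by (rule integrable_spike_finite[of "{s}", OF _ _ hi]) auto
      have "integral {0..pi} ?h = integral {0..pi} ?h'"
        by (rule integral_spike[of "{s}"]) auto
      moreover have "norm (integral {0..pi} ?h') \<le> integral {0..pi} (\<lambda>t. 8 * amp\<^sup>2 * X * \<delta> * ?r t)"
      proof (rule integral_norm_bound_integral[OF h'i])
        show "(\<lambda>t. 8 * amp\<^sup>2 * X * \<delta> * ?r t) integrable_on {0..pi}"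
          using reciprocal_kernel_integral(1)[of "6 * real n" s] n0 s
          by (intro has_integral_integrable[OF has_integral_mult_right[OF integrable_integral]]) auto
        fix t assume t: "t \<in> {0..pi}"
        have r0: "?r t \<ge> 0" by (intro divide_nonneg_nonneg add_nonneg_nonneg) auto
        show "norm (?h' t) \<le> 8 * amp\<^sup>2 * X * \<delta> * ?r t"
        proof (cases "t = s")
          case True then show ?thesis using X \<delta>0 r0 by simp
        next
          case False
          have e: "?h t = kern n s t * u t * (1 / poly Q (cos t) - \<rho> (cos t))"
            by (simp add: kern_def u_def power2_eq_square mult_ac)
          have "norm (?h' t) = norm (?h t)" using False by simp
          also have "\<dots> = \<bar>kern n s t\<bar> * \<bar>u t\<bar> * \<bar>\<rho> (cos t) - 1 / poly Q (cos t)\<bar>"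
            unfolding e real_norm_def abs_mult by (simp only: abs_minus_commute)
          also have "\<dots> \<le> (8 * amp\<^sup>2 * ?r t) * X * \<delta>"
            using kern_bound[OF n s t] False t0(2)[OF t] \<delta>[of "cos t"] r0 X
            by (intro mult_mono mult_nonneg_nonneg) (auto simp: X_def)
          finally show ?thesis by (simp add: mult_ac)
        qed
      qed
      moreover have "integral {0..pi} (\<lambda>t. 8 * amp\<^sup>2 * X * \<delta> * ?r t) \<le> 8 * amp\<^sup>2 * X * \<delta> * (2 * L)"
        unfolding integral_mult_right L_def
        using reciprocal_kernel_integral(2)[of "6 * real n" s] n0 s X \<delta>0 by (intro mult_left_mono) (auto simp: mult_ac)
      ultimately show ?thesis by simp
    qed
    moreover have "(wscale i)\<^sup>2 * pi * (sqrt_weight i s * poly (P - bs i A n) (cos s)) = - integral {0..pi} ?h"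
      unfolding f1[symmetric] by simp
    ultimately have "\<bar>(wscale i)\<^sup>2 * pi * (sqrt_weight i s * poly (P - bs i A n) (cos s))\<bar> \<le> 8 * amp\<^sup>2 * X * \<delta> * (2 * L)"
      by (simp only: abs_minus_cancel)
    moreover have "amp\<^sup>2 = (wscale i)\<^sup>2 * M"
      using M_pos by (simp add: amp_def power_mult_distrib)
    ultimately have "(wscale i)\<^sup>2 * (pi * \<bar>sqrt_weight i s * poly (P - bs i A n) (cos s)\<bar>) \<le> (wscale i)\<^sup>2 * (16 * M * X * \<delta> * L)"
      by (simp add: abs_mult mult_ac)
    then have "pi * \<bar>sqrt_weight i s * poly (P - bs i A n) (cos s)\<bar> \<le> 16 * M * X * \<delta> * L"
      using w by simp
    moreover have "3 * \<bar>sqrt_weight i s * poly (P - bs i A n) (cos s)\<bar> \<le> pi * \<bar>sqrt_weight i s * poly (P - bs i A n) (cos s)\<bar>"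
      using pi_gt3 by (intro mult_right_mono) auto
    moreover have "0 \<le> M * X * \<delta> * L" using M_pos X \<delta>0 L by simp
    ultimately show ?thesis by (simp add: mult_ac)
  qed
  have bsb: "\<bar>sqrt_weight i t * poly (bs i A n) (cos t)\<bar> \<le> amp" if "t \<in> {0..pi}" for t
    using bs_eq_Re_wave[OF i that, of A n] n abs_Re_le_cmod[of "bs_wave i A n t"] norm_bs_wave[of n t] by simp
  have "X \<le> amp + 6 * M * \<delta> * X * L"
  proof -
    have "u t0 = sqrt_weight i t0 * poly (P - bs i A n) (cos t0) + sqrt_weight i t0 * poly (bs i A n) (cos t0)"
      by (simp add: u_def algebra_simps)
    then show ?thesis using diff[OF t0(1)] bsb[OF t0(1)] by (simp add: X_def)
  qed
  \<comment> \<open>The absorption: X is at most amp plus half of itself.\<close>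
  also have "6 * M * \<delta> * X * L \<le> X / 2"
    using mult_right_mono[OF small X] by (simp add: L_def mult_ac)
  finally have "X \<le> 2 * amp" by simp
  then have "6 * M * \<delta> * L * X \<le> 6 * M * \<delta> * L * (2 * amp)"
    using M_pos \<delta>0 L by (intro mult_left_mono) auto
  then show ?thesis using diff[OF s] by (simp add: L_def mult_ac)
qed

end

subsection \<open>Functions that are \<open>m\<close> times continuously differentiable\<close>

abbreviation deriv_I :: "(real \<Rightarrow> real) \<Rightarrow> real \<Rightarrow> real" where
  "deriv_I g x \<equiv> vector_derivative g (at x within {-1..1})"

lemma nth_deriv_0 [simp]: "nth_deriv 0 f = f"
  by (simp add: nth_deriv_def)

lemma nth_deriv_Suc: "nth_deriv (Suc k) f = deriv_I (nth_deriv k f)"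
  by (simp add: nth_deriv_def)

lemma nth_deriv_Suc': "nth_deriv (Suc k) f = nth_deriv k (deriv_I f)"
  unfolding nth_deriv_def funpow_Suc_right by simp

lemma deriv_I_eq:
  assumes "(f has_real_derivative d) (at x within {-1..1})" "x \<in> {-1..1}"
  shows "deriv_I f x = d"
  using assms by (intro vector_derivative_within_closed_interval)
    (auto simp: has_real_derivative_iff_has_vector_derivative)

lemma deriv_I_works:
  assumes "f differentiable_on {-1..1}" "x \<in> {-1..1}"
  shows "(f has_real_derivative deriv_I f x) (at x within {-1..1})"
  using assms unfolding has_real_derivative_iff_has_vector_derivative differentiable_on_def
  by (simp add: vector_derivative_works[symmetric])

lemma deriv_I_cong:
  assumes "\<And>x. x \<in> {-1..1} \<Longrightarrow> f x = g x" "x \<in> {-1..1}"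
  shows "deriv_I f x = deriv_I g x"
proof -
  have "(f has_vector_derivative d) (at x within {-1..1}) = (g has_vector_derivative d) (at x within {-1..1})" for d
    using assms has_vector_derivative_transform[of x "{-1..1}" f g d] has_vector_derivative_transform[of x "{-1..1}" g f d]
    by (metis (no_types, lifting))
  then show ?thesis unfolding vector_derivative_def by simp
qed

text \<open>Derivatives are taken within the interval, so values outside it are irrelevant. This
  permits replacing the chosen derivative by any function that agrees with it there.\<close>

lemma nth_deriv_cong:
  assumes "\<And>x. x \<in> {-1..1} \<Longrightarrow> f x = g x" "x \<in> {-1..1}"
  shows "nth_deriv k f x = nth_deriv k g x"
  using assms(2)
proof (induction k arbitrary: x)
  case (Suc k)
  then show ?case unfolding nth_deriv_Suc by (intro deriv_I_cong) auto
qed (use assms(1) in auto)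

lemma differentiable_on_cong_I:
  assumes "\<And>x. x \<in> {-1..1} \<Longrightarrow> f x = g x"
  shows "(f :: real \<Rightarrow> real) differentiable_on {-1..1} \<longleftrightarrow> g differentiable_on {-1..1}"
  unfolding differentiable_on_def differentiable_def
  using assms has_derivative_transform[of _ "{-1..1}" f g] has_derivative_transform[of _ "{-1..1}" g f]
  by (metis (no_types, lifting))

lemma cont_diff_cong:
  assumes "\<And>x. x \<in> {-1..1} \<Longrightarrow> f x = g x" "cont_diff m f"
  shows "cont_diff m g"
proof -
  have "nth_deriv k f x = nth_deriv k g x" if "x \<in> {-1..1}" for k x
    by (rule nth_deriv_cong) (use assms that in auto)
  then show ?thesis
    using assms(2) differentiable_on_cong_I[of "nth_deriv _ f" "nth_deriv _ g"]
      continuous_on_cong[of "{-1..1}" "{-1..1}" "nth_deriv m f" "nth_deriv m g"]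
    unfolding cont_diff_def by blast
qed

lemma cont_diff_0: "cont_diff 0 f \<longleftrightarrow> continuous_on {-1..1} f"
  by (simp add: cont_diff_def)

lemma cont_diff_Suc: "cont_diff (Suc m) f \<longleftrightarrow> f differentiable_on {-1..1} \<and> cont_diff m (deriv_I f)"
proof -
  have "(\<forall>k<Suc m. nth_deriv k f differentiable_on {-1..1}) \<longleftrightarrow>
     f differentiable_on {-1..1} \<and> (\<forall>k<m. nth_deriv k (deriv_I f) differentiable_on {-1..1})"
    unfolding All_less_Suc2 by (simp add: nth_deriv_Suc')
  then show ?thesis unfolding cont_diff_def by (simp add: nth_deriv_Suc')
qed

lemma cont_diff_SucD: "cont_diff (Suc m) f \<Longrightarrow> cont_diff m f"
  unfolding cont_diff_def by (auto intro: differentiable_imp_continuous_on)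

lemma cont_diff_SucI:
  assumes "\<And>x. x \<in> {-1..1} \<Longrightarrow> (f has_real_derivative f' x) (at x within {-1..1})" "cont_diff m f'"
  shows "cont_diff (Suc m) f"
proof -
  have "f differentiable_on {-1..1}"
    unfolding differentiable_on_def differentiable_def
    using assms(1) unfolding has_field_derivative_def by blast
  moreover have "cont_diff m (deriv_I f)"
    by (rule cont_diff_cong[OF _ assms(2)]) (use deriv_I_eq[OF assms(1)] in auto)
  ultimately show ?thesis by (simp add: cont_diff_Suc)
qed

lemma cont_diff_add: "cont_diff m f \<Longrightarrow> cont_diff m g \<Longrightarrow> cont_diff m (\<lambda>x. f x + g x)"
proof (induction m arbitrary: f g)
  case (Suc m)
  show ?case
    by (rule cont_diff_SucI[of _ "\<lambda>x. deriv_I f x + deriv_I g x"])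
       (use Suc in \<open>auto simp: cont_diff_Suc intro!: DERIV_add deriv_I_works\<close>)
qed (auto simp: cont_diff_0 intro: continuous_intros)

lemma cont_diff_mult: "cont_diff m f \<Longrightarrow> cont_diff m g \<Longrightarrow> cont_diff m (\<lambda>x. f x * g x)"
proof (induction m arbitrary: f g)
  case (Suc m)
  have fd: "f differentiable_on {-1..1}" "g differentiable_on {-1..1}" and c: "cont_diff m (deriv_I f)" "cont_diff m (deriv_I g)"
    using Suc.prems by (auto simp: cont_diff_Suc)
  show ?case
  proof (rule cont_diff_SucI[of _ "\<lambda>x. deriv_I f x * g x + deriv_I g x * f x"])
    show "((\<lambda>x. f x * g x) has_real_derivative deriv_I f x * g x + deriv_I g x * f x) (at x within {-1..1})"
      if "x \<in> {-1..1}" for x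
      by (rule DERIV_mult[OF deriv_I_works[OF fd(1) that] deriv_I_works[OF fd(2) that]])
    show "cont_diff m (\<lambda>x. deriv_I f x * g x + deriv_I g x * f x)"
      by (intro cont_diff_add Suc.IH c cont_diff_SucD[OF Suc.prems(1)] cont_diff_SucD[OF Suc.prems(2)])
  qed
qed (auto simp: cont_diff_0 intro: continuous_intros)

lemma cont_diff_const: "cont_diff m (\<lambda>_. c)"
proof (induction m arbitrary: c)
  case (Suc m)
  show ?case by (rule cont_diff_SucI[of _ "\<lambda>_. 0"]) (auto intro: Suc)
qed (simp add: cont_diff_0)

text \<open>The derivative -f'/f^2 contains 1/f only with one order of smoothness less, so the
  induction closes by the product rule.\<close>

lemma cont_diff_inverse:
  assumes "\<And>x. x \<in> {-1..1} \<Longrightarrow> f x \<noteq> 0"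
  shows "cont_diff m f \<Longrightarrow> cont_diff m (\<lambda>x. 1 / f x)"
proof (induction m)
  case 0
  then show ?case using assms by (auto simp: cont_diff_0 intro!: continuous_intros)
next
  case (Suc m)
  have fd: "f differentiable_on {-1..1}" and c: "cont_diff m (deriv_I f)"
    using Suc.prems by (auto simp: cont_diff_Suc)
  have i: "cont_diff m (\<lambda>x. 1 / f x)" by (rule Suc.IH[OF cont_diff_SucD[OF Suc.prems]])
  show ?case
  proof (rule cont_diff_SucI[of _ "\<lambda>x. - 1 * (deriv_I f x * (1 / f x * (1 / f x)))"])
    show "((\<lambda>x. 1 / f x) has_real_derivative - 1 * (deriv_I f x * (1 / f x * (1 / f x)))) (at x within {-1..1})"
      if "x \<in> {-1..1}" for x
      using deriv_I_works[OF fd that] assms[OF that] by (auto intro!: derivative_eq_intros simp: power2_eq_square)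
    show "cont_diff m (\<lambda>x. - 1 * (deriv_I f x * (1 / f x * (1 / f x))))"
      by (intro cont_diff_mult cont_diff_const c i)
  qed
qed

lemma cont_diff_has_derivative:
  assumes "cont_diff m f" "k < m" "x \<in> {-1..1}"
  shows "(nth_deriv k f has_real_derivative nth_deriv (Suc k) f x) (at x within {-1..1})"
  unfolding nth_deriv_Suc using assms by (intro deriv_I_works) (auto simp: cont_diff_def)

lemma cont_diff_continuous: "cont_diff m f \<Longrightarrow> continuous_on {-1..1} f"
  by (induction m) (auto simp: cont_diff_0 dest: cont_diff_SucD)

subsection \<open>The modulus of continuity\<close>

lemma modulus_nonneg: "continuous_on {-1..1} g \<Longrightarrow> h \<ge> 0 \<Longrightarrow> modulus g h \<ge> 0"
  using modulus_attained[of g h] by fastforce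

text \<open>The segment from x to y is cut into k = \<lceil>n \<bar>x - y\<bar>\<rceil> pieces of
  length at most 1/n.\<close>

lemma modulus_bound:
  assumes g: "continuous_on {-1..1} g" and n: "n \<ge> 1" and xy: "x \<in> {-1..1}" "y \<in> {-1..1}"
  shows "\<bar>g x - g y\<bar> \<le> modulus g (1 / real n) * (1 + real n * \<bar>x - y\<bar>)"
proof -
  define W where "W = modulus g (1 / real n)"
  have W: "\<bar>g x - g y\<bar> \<le> W" if "x \<in> {-1..1}" "y \<in> {-1..1}" "\<bar>x - y\<bar> \<le> 1 / real n" for x y
    using modulus_attained[OF g, of "1 / real n"] that by (auto simp: W_def)
  have W0: "W \<ge> 0" unfolding W_def by (rule modulus_nonneg[OF g]) simp
  have *: "\<bar>g x - g y\<bar> \<le> real k * W" if "\<bar>x - y\<bar> \<le> real k / real n" "x \<in> {-1..1}" "y \<in> {-1..1}" for k x y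
    using that
  proof (induction k arbitrary: x)
    case (Suc k)
    define z where "z = x + (y - x) / (real k + 1)"
    have k: "real k + 1 > 0" by simp
    have zx: "x - z = (x - y) / (real k + 1)" unfolding z_def by (simp add: field_simps)
    have zy: "z - y = (x - y) * (real k / (real k + 1))" unfolding z_def by (simp add: field_simps)
    have b: "\<bar>x - y\<bar> / (real k + 1) \<le> 1 / real n"
      using Suc.prems(1) n by (simp add: field_simps)
    have 1: "\<bar>x - z\<bar> \<le> 1 / real n" unfolding zx using b by (simp add: abs_divide)
    have "\<bar>z - y\<bar> = real k * (\<bar>x - y\<bar> / (real k + 1))" unfolding zy by (simp add: abs_mult)
    also have "\<dots> \<le> real k * (1 / real n)" using b by (intro mult_left_mono) auto
    finally have 2: "\<bar>z - y\<bar> \<le> real k / real n" by simp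
    have z: "z \<in> {-1..1}"
    proof -
      have "z = (1 - 1 / (real k + 1)) * x + (1 / (real k + 1)) * y" unfolding z_def by (simp add: algebra_simps diff_divide_distrib)
      moreover have "convex {-1..1::real}" by simp
      ultimately show ?thesis
        using convexD_alt[of "{-1..1::real}" x y "1 / (real k + 1)"] Suc.prems by simp
    qed
    have "\<bar>g x - g y\<bar> \<le> \<bar>g x - g z\<bar> + \<bar>g z - g y\<bar>" by simp
    also have "\<dots> \<le> W + real k * W" using W[OF Suc.prems(2) z 1] Suc.IH[OF 2 z Suc.prems(3)] by simp
    finally show ?case by (simp add: algebra_simps)
  qed auto
  define k where "k = nat \<lceil>real n * \<bar>x - y\<bar>\<rceil>"
  have "real n * \<bar>x - y\<bar> \<le> real k" by (simp add: k_def real_nat_ceiling_ge)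
  then have "\<bar>x - y\<bar> \<le> real k / real n" using n by (simp add: field_simps)
  from *[OF this xy] have "\<bar>g x - g y\<bar> \<le> real k * W" .
  also have "real k \<le> 1 + real n * \<bar>x - y\<bar>"
  proof -
    have "0 \<le> real n * \<bar>x - y\<bar>" by simp
    then show ?thesis unfolding k_def by linarith
  qed
  finally show ?thesis using W0 by (simp add: W_def mult.commute mult_right_mono)
qed

text \<open>The margin 3 in the degree makes the kernels of degrees n - 1, n and n + 1 all
  available: for n - 1 the bound reads degree < n - 2.\<close>

lemma smooth_approximation:
  assumes m: "m \<ge> 1" and f: "cont_diff m f"
  obtains C where "C > 0" "\<And>n. n \<ge> 2 * m + 12 \<Longrightarrow>
    \<exists>q. degree q + 3 \<le> n \<and>
     (\<forall>x\<in>{-1..1}. \<bar>f x - poly q x\<bar> \<le> C * (modulus (nth_deriv m f) (1 / real n) / real n ^ m)) \<and>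
     (\<forall>s\<in>{0..pi}. \<forall>t\<in>{0..pi}. \<bar>(f (cos s) - poly q (cos s)) - (f (cos t) - poly q (cos t))\<bar>
         \<le> C * (modulus (nth_deriv m f) (1 / real n) / real n ^ m) * real n * \<bar>s - t\<bar>)"
proof -
  let ?g = "nth_deriv m f"
  \<comment> \<open>The powers of 10000 come from the Jackson steps and 4^m from n \<le> 4 k; the 8
    covers the factor 4 of the modulus and the doubling in the Lipschitz bound.\<close>
  define C :: real where "C = 8 * 10000 ^ Suc m * 4 ^ m"
  have g: "continuous_on {-1..1} ?g" using f by (simp add: cont_diff_def)
  show ?thesis
  proof (rule that[of C])
    show "C > 0" by (simp add: C_def)
    fix n assume n: "2 * m + 12 \<le> n"
    \<comment> \<open>The largest kernel order for which the degree 2 k + m leaves room for the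
      margin 3.\<close>
    define k where "k = (n - 3 - m) div 2"
    have k: "k \<ge> 1" "n \<le> 4 * k" "2 * k + m + 3 \<le> n" using n by (auto simp: k_def)
    define V where "V = modulus ?g (1 / real n)"
    have V0: "V \<ge> 0" unfolding V_def by (rule modulus_nonneg[OF g]) simp
    have W: "\<bar>?g x - ?g y\<bar> \<le> (4 * V) * (1 + real k * \<bar>x - y\<bar>)" if "x \<in> {-1..1}" "y \<in> {-1..1}" for x y
    proof -
      have "\<bar>?g x - ?g y\<bar> \<le> V * (1 + real n * \<bar>x - y\<bar>)"
        unfolding V_def by (rule modulus_bound[OF g _ that]) (use n in simp)
      also have "\<dots> \<le> V * (4 * (1 + real k * \<bar>x - y\<bar>))"
      proof (rule mult_left_mono[OF _ V0])
        have "real n * \<bar>x - y\<bar> \<le> (4 * real k) * \<bar>x - y\<bar>" using k(2) by (intro mult_right_mono) auto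
        then show "1 + real n * \<bar>x - y\<bar> \<le> 4 * (1 + real k * \<bar>x - y\<bar>)" by simp
      qed
      finally show ?thesis by (simp add: mult_ac)
    qed
    have d: "(nth_deriv j f has_real_derivative nth_deriv (Suc j) f x) (at x within {-1..1})"
      if "j < m" "x \<in> {-1..1}" for j x by (rule cont_diff_has_derivative[OF f that])
    obtain p where p: "degree p \<le> 2 * k + m"
      "\<And>x. x \<in> {-1..1} \<Longrightarrow> \<bar>nth_deriv 0 f x - poly p x\<bar> \<le> 10000 ^ Suc m * (4 * V) / real k ^ m"
      "\<And>s t. s \<in> {0..pi} \<Longrightarrow> t \<in> {0..pi} \<Longrightarrow>
       \<bar>(nth_deriv 0 f (cos s) - poly p (cos s)) - (nth_deriv 0 f (cos t) - poly p (cos t))\<bar> \<le> 2 * (10000 ^ m * (4 * V) / real k ^ (m - 1)) * \<bar>s - t\<bar>"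
      by (rule jackson_smooth[OF k(1) m d g W]) (assumption | rule that)+
    have kn: "real n / 4 \<le> real k" using k(2) by simp
    have b: "1 / real k ^ j \<le> 4 ^ j / real n ^ j" for j
    proof -
      have "(real n / 4) ^ j \<le> real k ^ j" using kn by (intro power_mono) auto
      moreover have "0 < (real n / 4) ^ j" using n by simp
      ultimately have "1 / real k ^ j \<le> 1 / (real n / 4) ^ j" using k(1) n by (intro divide_left_mono mult_pos_pos) auto
      then show ?thesis by (simp add: power_divide)
    qed
    have b1: "10000 ^ Suc m * (4 * V) / real k ^ m \<le> C * (V / real n ^ m)"
    proof -
      have "10000 ^ Suc m * (4 * V) * (1 / real k ^ m) \<le> 10000 ^ Suc m * (4 * V) * (4 ^ m / real n ^ m)"
        using V0 by (intro mult_left_mono b) auto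
      also have "\<dots> \<le> C * (V / real n ^ m)" using V0 by (simp add: C_def divide_right_mono mult_ac)
      finally show ?thesis by simp
    qed
    have b2: "2 * (10000 ^ m * (4 * V) / real k ^ (m - 1)) \<le> C * (V / real n ^ m) * real n"
    proof -
      have "2 * (10000 ^ m * (4 * V)) * (1 / real k ^ (m - 1)) \<le> 2 * (10000 ^ m * (4 * V)) * (4 ^ (m - 1) / real n ^ (m - 1))"
        using V0 by (intro mult_left_mono b) auto
      also have "\<dots> = (8 * 10000 ^ m * 4 ^ (m - 1)) * (V / real n ^ (m - 1))" by simp
      also have "\<dots> \<le> C * (V / real n ^ (m - 1))"
      proof (rule mult_right_mono)
        have "(10000::real) ^ m \<le> 10000 ^ Suc m" "(4::real) ^ (m - 1) \<le> 4 ^ m" by (intro power_increasing; simp)+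
        then show "8 * 10000 ^ m * 4 ^ (m - 1) \<le> C" unfolding C_def by (intro mult_mono) auto
      qed (use V0 in auto)
      also have "V / real n ^ (m - 1) = V / real n ^ m * real n" using m n by (cases m) auto
      finally show ?thesis by simp
    qed
    show "\<exists>q. degree q + 3 \<le> n \<and>
     (\<forall>x\<in>{-1..1}. \<bar>f x - poly q x\<bar> \<le> C * (modulus ?g (1 / real n) / real n ^ m)) \<and>
     (\<forall>s\<in>{0..pi}. \<forall>t\<in>{0..pi}. \<bar>(f (cos s) - poly q (cos s)) - (f (cos t) - poly q (cos t))\<bar>
         \<le> C * (modulus ?g (1 / real n) / real n ^ m) * real n * \<bar>s - t\<bar>)"
      unfolding V_def[symmetric]
    proof (intro exI[of _ p] conjI ballI)
      show "degree p + 3 \<le> n" using p(1) k(3) by simp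
      show "\<bar>f x - poly p x\<bar> \<le> C * (V / real n ^ m)" if "x \<in> {-1..1}" for x
        using p(2)[OF that] b1 by simp
      show "\<bar>(f (cos s) - poly p (cos s)) - (f (cos t) - poly p (cos t))\<bar> \<le> C * (V / real n ^ m) * real n * \<bar>s - t\<bar>"
        if "s \<in> {0..pi}" "t \<in> {0..pi}" for s t
        using p(3)[OF that] mult_right_mono[OF b2, of "\<bar>s - t\<bar>"] by simp
    qed
  qed
qed

subsection \<open>Comparison of \<open>\<rho>\<close> with a Bernstein--Szego weight\<close>

lemma norm_exp_minus_one:
  fixes z :: complex
  assumes "norm z \<le> 1"
  shows "norm (exp z - 1) \<le> 3 * norm z"
proof -
  have "norm (exp z - exp 0) \<le> 3 * norm (z - 0)"
  proof (rule field_differentiable_bound[of "cball 0 1" exp exp])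
    fix w :: complex assume "w \<in> cball 0 1"
    then have "exp (norm w) \<le> exp 1" by simp
    also have "\<dots> \<le> 3" by (rule exp_le)
    finally show "norm (exp w) \<le> 3" using norm_exp[of w] by linarith
  qed (use assms in \<open>auto intro: DERIV_subset[OF DERIV_exp]\<close>)
  then show ?thesis by simp
qed

text \<open>All that the asymptotics need to know about one n, with a single error \<open>e\<close>
  for the logarithm, the phase and the polynomials. The comparison \<open>cmp\<close> covers three
  consecutive degrees with the same A because the recurrence couples them. The bound 1/4 keeps the
  exponents below 1, where the exponential is linearized.\<close>

locale szego_approx =
  fixes \<rho> :: "real \<Rightarrow> real" and A Q :: "real poly" and R c M B e :: real and n :: nat
  assumes \<rho>: "continuous_on {-1..1} \<rho>" "\<And>x. x \<in> {-1..1} \<Longrightarrow> 0 < \<rho> x"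
    "\<And>x. x \<in> {-1..1} \<Longrightarrow> \<rho> x \<le> B\<^sup>2" "\<And>x. x \<in> {-1..1} \<Longrightarrow> \<bar>ln (\<rho> x)\<bar> \<le> B" and B: "B \<ge> 0"
    and degA: "degree A + 3 \<le> n"
    and R: "R > 1" "\<And>\<zeta>. \<zeta> \<in> ball 0 R \<Longrightarrow> poly (cpoly A) \<zeta> \<noteq> 0"
    and AQ: "\<And>t. poly (cpoly A) (cis t) * poly (cpoly A) (cis (- t)) = of_real (poly Q (cos t))"
    and c: "c > 0"
    and Q: "\<And>x. x \<in> {-1..1} \<Longrightarrow> c \<le> poly Q x" "\<And>x. x \<in> {-1..1} \<Longrightarrow> poly Q x \<le> M"
    and Aout: "\<And>\<xi>. norm \<xi> < 1 \<Longrightarrow> poly (cpoly A) \<xi> = exp (outer (\<lambda>t. ln (poly Q (cos t))) \<xi>)"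
    and Abd: "\<And>t. t \<in> {0..pi} \<Longrightarrow> poly (cpoly A) (cis (- t)) =
        of_real (sqrt (poly Q (cos t))) * cis (- conj_fun (\<lambda>t. ln (poly Q (cos t))) t)"
    and e: "0 \<le> e" "e \<le> 1 / 4"
    and lnd: "\<And>x. x \<in> {-1..1} \<Longrightarrow> \<bar>ln (\<rho> x) + ln (poly Q x)\<bar> \<le> e"
    and th: "\<And>t. t \<in> {0..pi} \<Longrightarrow> \<bar>theta \<rho> (cos t) + conj_fun (\<lambda>t. ln (poly Q (cos t))) t\<bar> \<le> e"
    and cmp: "\<And>i k P t. i \<in> {1,2,3,4} \<Longrightarrow> k \<in> {n - 1, n, Suc n} \<Longrightarrow> degree P \<le> k \<Longrightarrow>
        coeff P k = coeff (bs i A k) k \<Longrightarrow>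
        (\<And>g. degree g < k \<Longrightarrow> integral {0..pi} (\<lambda>t. (sqrt_weight i t)\<^sup>2 * poly (P * g) (cos t) * \<rho> (cos t)) = 0) \<Longrightarrow>
        t \<in> {0..pi} \<Longrightarrow> \<bar>sqrt_weight i t * poly (P - bs i A k) (cos t)\<bar> \<le> e"
begin

lemma bs_weight: "i \<in> {1,2,3,4} \<Longrightarrow> bs_weight i A Q R M"
  using R AQ c Q by unfold_locales (auto intro: less_le_trans)

abbreviation F\<rho> where "F\<rho> \<equiv> \<lambda>t. ln (\<rho> (cos t))"
abbreviation FQ where "FQ \<equiv> \<lambda>t. ln (poly Q (cos t))"

lemma F\<rho>_cont: "continuous_on {0..pi} F\<rho>"
  by (rule continuous_on_comp_cos) (use \<rho>(1,2) in \<open>auto intro!: continuous_intros simp: less_imp_neq[symmetric]\<close>)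

lemma Q_pos': "x \<in> {-1..1} \<Longrightarrow> 0 < poly Q x"
  using Q(1) c by (meson less_le_trans)

lemma FQ_cont: "continuous_on {0..pi} FQ"
  by (rule continuous_on_comp_cos) (use Q_pos' in \<open>auto intro!: continuous_intros simp: less_imp_neq[symmetric]\<close>)

lemma outer_sum: "norm \<zeta> < 1 \<Longrightarrow> outer (\<lambda>t. F\<rho> t - (- FQ t)) \<zeta> = outer F\<rho> \<zeta> + outer FQ \<zeta>"
proof -
  assume z: "norm \<zeta> < 1"
  have "outer (\<lambda>t. 0 - FQ t) \<zeta> = outer (\<lambda>t. 0) \<zeta> - outer FQ \<zeta>"
    by (rule outer_diff) (use FQ_cont z in auto)
  then have "outer (\<lambda>t. - FQ t) \<zeta> = - outer FQ \<zeta>" by (simp add: outer_def)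
  moreover have "outer (\<lambda>t. F\<rho> t - (- FQ t)) \<zeta> = outer F\<rho> \<zeta> - outer (\<lambda>t. - FQ t) \<zeta>"
    by (rule outer_diff[OF F\<rho>_cont _ z]) (intro continuous_intros FQ_cont)
  ultimately show ?thesis by simp
qed

lemma norm_outer_sum: "norm \<zeta> < 1 \<Longrightarrow> norm (outer F\<rho> \<zeta> + outer FQ \<zeta>) \<le> e / (1 - norm \<zeta>)\<^sup>2"
  unfolding outer_sum[symmetric]
  by (rule norm_outer_le) (use lnd in \<open>auto intro!: continuous_intros F\<rho>_cont FQ_cont\<close>)

lemma outer_0_real: "outer F 0 = of_real (Re (outer F 0))"
  using cnj_outer_of_real[of F 0] by (simp add: complex_eq_iff)

text \<open>The logarithmic mismatch at infinity between the Szego functions of \<rho> and 1 / Q. It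
  is nonzero in general and enters both asymptotic formulas as the factor exp (-\<gamma>).\<close>

definition \<gamma> :: real where "\<gamma> = Re (outer F\<rho> 0) + Re (outer FQ 0)"

lemma gamma_bound: "\<bar>\<gamma>\<bar> \<le> e"
proof -
  have "\<bar>\<gamma>\<bar> = \<bar>Re (outer F\<rho> 0 + outer FQ 0)\<bar>" by (simp add: \<gamma>_def)
  also have "\<dots> \<le> norm (outer F\<rho> 0 + outer FQ 0)" by (rule abs_Re_le_cmod)
  also have "\<dots> \<le> e" using norm_outer_sum[of 0] by simp
  finally show ?thesis .
qed

lemma A0_eq: "complex_of_real (coeff A 0) = exp (outer FQ 0)"
  using Aout[of 0] by (simp add: poly_0_coeff_0 coeff_map_poly)

lemma SS_inf_A0:
  assumes i: "i \<in> {1,2,3,4}"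
  shows "SS_inf \<rho> i = of_real (2 * lead_factor i / wscale i * exp (- \<gamma>) * coeff A 0)"
proof -
  have "exp (- outer F\<rho> 0) = exp (- of_real \<gamma>) * exp (outer FQ 0)"
    using outer_0_real[of F\<rho>] outer_0_real[of FQ]
    by (simp add: \<gamma>_def exp_add[symmetric])
  moreover have "2 / (wscale i * szego_den i 0) = of_real (2 * lead_factor i / wscale i)"
    by (simp add: szego_den_def lead_factor_def)
  moreover have "SS_inf \<rho> i = 2 / (wscale i * szego_den i 0) * exp (- outer F\<rho> 0)"
    by (rule SS_inf_eq) (use \<rho> i in auto)
  ultimately show ?thesis
    unfolding A0_eq[symmetric] by (simp add: exp_of_real[symmetric])
qed

text \<open>Rescaling that gives a monic polynomial the leading coefficient of its Bernstein-Szego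
  counterpart.\<close>

definition Phat :: "nat \<Rightarrow> nat \<Rightarrow> real poly \<Rightarrow> real poly" where
  "Phat i k p = smult (coeff A 0 * 2 ^ k * lead_factor i) p"

lemma monic_OP_orth:
  assumes p: "is_monic_OP \<rho> i k p" and g: "degree g < k"
  shows "integral {0..pi} (\<lambda>t. (sqrt_weight i t)\<^sup>2 * poly (p * g) (cos t) * \<rho> (cos t)) = 0"
proof -
  have vc: "continuous_on {-1..1} (v_poly i)"
    unfolding v_poly_def[abs_def] by (cases "i = 1"; cases "i = 2"; cases "i = 3") (auto intro!: continuous_intros)
  define \<Lambda> where "\<Lambda> = (\<lambda>f. integral {0..pi} (\<lambda>t. (sqrt_weight i t)\<^sup>2 * poly (p * f) (cos t) * \<rho> (cos t)))"
  have int: "(\<lambda>t. (sqrt_weight i t)\<^sup>2 * poly (p * f) (cos t) * \<rho> (cos t)) integrable_on {0..pi}" for f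
    by (intro integrable_continuous_real continuous_intros continuous_on_sqrt_weight continuous_on_comp_cos \<rho>)
  have "\<Lambda> g = 0"
  proof (rule linear_functional_zero[of \<Lambda> k "\<lambda>l. monom 1 l"])
    show "\<Lambda> (f + g) = \<Lambda> f + \<Lambda> g" for f g
      unfolding \<Lambda>_def integral_add[OF int int, symmetric] by (simp add: algebra_simps)
    show "\<Lambda> (smult a f) = a * \<Lambda> f" for a f
      unfolding \<Lambda>_def integral_mult_right[symmetric] by (simp add: mult_ac)
    fix l assume l: "l < k"
    have "0 = (LINT x:{-1..1}|lborel. x ^ l * poly p x * (\<rho> x * \<bar>v_poly i x\<bar> / sqrt (1 - x\<^sup>2)))"
      using p l by (simp add: is_monic_OP_def)
    also have "\<dots> = (LINT x:{-1..1}|lborel. (x ^ l * poly p x * (\<rho> x * \<bar>v_poly i x\<bar>)) /\<^sub>R sqrt (1 - x\<^sup>2))"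
      by (simp add: divide_inverse mult_ac)
    also have "\<dots> = integral {0..pi} (\<lambda>t. cos t ^ l * poly p (cos t) * (\<rho> (cos t) * \<bar>v_poly i (cos t)\<bar>))"
      by (rule arcsine_substitution_continuous) (intro continuous_intros \<rho>(1) vc)
    also have "\<dots> = \<Lambda> (monom 1 l)"
      unfolding \<Lambda>_def sqrt_weight_square by (simp add: poly_monom mult_ac)
    finally show "\<Lambda> (monom 1 l) = 0" by simp
  qed (use g in \<open>auto simp: degree_monom_eq\<close>)
  then show ?thesis by (simp add: \<Lambda>_def)
qed

lemma Phat_props:
  assumes p: "is_monic_OP \<rho> i k p" and k: "degree A < k"
  shows "degree (Phat i k p) \<le> k" "coeff (Phat i k p) k = coeff (bs i A k) k"
    "\<And>g. degree g < k \<Longrightarrow> integral {0..pi} (\<lambda>t. (sqrt_weight i t)\<^sup>2 * poly (Phat i k p * g) (cos t) * \<rho> (cos t)) = 0"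
proof -
  have d: "degree p = k" "coeff p k = 1" using p by (auto simp: is_monic_OP_def)
  show "degree (Phat i k p) \<le> k" using d degree_smult_le[of _ p] by (simp add: Phat_def)
  show "coeff (Phat i k p) k = coeff (bs i A k) k" using d by (simp add: Phat_def bs_lead[OF k])
  fix g :: "real poly" assume g: "degree g < k"
  have "integral {0..pi} (\<lambda>t. (coeff A 0 * 2 ^ k * lead_factor i) * ((sqrt_weight i t)\<^sup>2 * poly (p * g) (cos t) * \<rho> (cos t))) = 0"
    unfolding integral_mult_right monic_OP_orth[OF p g] by simp
  then show "integral {0..pi} (\<lambda>t. (sqrt_weight i t)\<^sup>2 * poly (Phat i k p * g) (cos t) * \<rho> (cos t)) = 0"
    by (simp add: Phat_def mult_ac)
qed

lemma Phat_close:
  assumes i: "i \<in> {1,2,3,4}" and p: "is_monic_OP \<rho> i k p" and k: "k \<in> {n - 1, n, Suc n}" and t: "t \<in> {0..pi}"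
  shows "\<bar>sqrt_weight i t * poly (Phat i k p - bs i A k) (cos t)\<bar> \<le> e"
proof -
  have "degree A < k" using k degA by auto
  from Phat_props[OF p this] show ?thesis by (intro cmp[OF i k _ _ _ t])
qed

text \<open>Three errors add up: the amplitude exp y differs from 1 by at most 9/2 e, the phase by
  e, and the polynomial remainder contributes 3 B e.\<close>

lemma interval_error:
  assumes i: "i \<in> {1,2,3,4}" and p: "is_monic_OP \<rho> i n p" and x: "x \<in> {-1..1}"
  shows "norm (2 ^ (n - 1) * SS_inf \<rho> i * complex_of_real (sqrt (\<rho> x * \<bar>v_poly i x\<bar>) * poly p x) -
            complex_of_real (cos (real n * arccos x + theta \<rho> x + theta_shift i x))) \<le> (9 + 3 * B) * e"
proof -
  interpret bs_weight i A Q R M by (rule bs_weight[OF i])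
  define t where "t = arccos x"
  have t: "t \<in> {0..pi}" "cos t = x" using x by (auto simp: t_def arccos_lbound arccos_ubound)
  have w: "wscale i \<ge> 1" by (rule wscale_bounds)
  have n1: "n \<ge> 1" "degree A \<le> n" using degA by auto
  let ?cf = "conj_fun FQ t" and ?l = "(n + freq_shift i / 2) * t - phase i"
  define r where "r = sqrt_weight i t * poly (Phat i n p - bs i A n) x"
  have r: "\<bar>r\<bar> \<le> e" using Phat_close[OF i p _ t(1)] by (simp add: r_def t)
  have "sqrt_weight i t * poly (bs i A n) x = Re (bs_wave i A n t)"
    using bs_eq_Re_wave[OF i t(1) n1(2)] t by simp
  also have "\<dots> = wscale i * sqrt (poly Q x) * cos (?l - ?cf)"
  proof -
    have "bs_wave i A n t = of_real (wscale i * sqrt (poly Q x)) * cis (?l - ?cf)"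
    proof -
      have "cis (?l - ?cf) = cis ?l * cis (- ?cf)" by (simp add: cis_mult)
      then show ?thesis
        unfolding bs_wave_def Abd[OF t(1)] t(2) by (simp only: of_real_mult mult_ac)
    qed
    moreover have "Re (complex_of_real a * z) = a * Re z" for a z by simp
    ultimately show ?thesis by (simp only: cis.simps)
  qed
  finally have ph: "sqrt_weight i t * poly (Phat i n p) x = wscale i * sqrt (poly Q x) * cos (?l - ?cf) + r"
    by (simp add: r_def algebra_simps)
  define \<kappa> where "\<kappa> = exp (- \<gamma>)"
  have "2 ^ (n - 1) * SS_inf \<rho> i * complex_of_real (sqrt (\<rho> x * \<bar>v_poly i x\<bar>) * poly p x)
     = of_real (\<kappa> / wscale i * sqrt (\<rho> x) * (sqrt_weight i t * poly (Phat i n p) x))"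
  proof -
    have "(2::real) ^ n = 2 * 2 ^ (n - 1)" using n1 by (cases n) auto
    then have "2 ^ (n - 1) * (2 * lead_factor i / wscale i * exp (- \<gamma>) * coeff A 0) * (sqrt (\<rho> x * \<bar>v_poly i x\<bar>) * poly p x)
      = \<kappa> / wscale i * sqrt (\<rho> x) * (sqrt_weight i t * poly (Phat i n p) x)"
      by (simp add: Phat_def \<kappa>_def sqrt_weight_def t(2) real_sqrt_mult mult_ac)
    then show ?thesis unfolding SS_inf_A0[OF i] by (metis of_real_mult of_real_numeral of_real_power)
  qed
  also have "\<kappa> / wscale i * sqrt (\<rho> x) * (sqrt_weight i t * poly (Phat i n p) x)
     = \<kappa> * (sqrt (\<rho> x) * sqrt (poly Q x)) * cos (?l - ?cf) + \<kappa> * sqrt (\<rho> x) * (r / wscale i)"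
    unfolding ph using w by (simp add: field_simps)
  finally have eq: "2 ^ (n - 1) * SS_inf \<rho> i * complex_of_real (sqrt (\<rho> x * \<bar>v_poly i x\<bar>) * poly p x)
     = of_real (\<kappa> * (sqrt (\<rho> x) * sqrt (poly Q x)) * cos (?l - ?cf) + \<kappa> * sqrt (\<rho> x) * (r / wscale i))" .
  \<comment> \<open>The half frequency shift and the phase of each kind reproduce exactly
    \<open>theta_shift\<close>.\<close>
  have shift: "real n * arccos x + theta \<rho> x + theta_shift i x = ?l + theta \<rho> x"
    using i by (auto simp: theta_shift_def t_def[symmetric] freq_shift_def phase_def algebra_simps)
  \<comment> \<open>The logarithm of the amplitude: \<gamma> contributes e, the mean of the two
    logarithms e/2.\<close>
  define y where "y = - \<gamma> + (ln (\<rho> x) + ln (poly Q x)) / 2"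
  have ys: "\<kappa> * (sqrt (\<rho> x) * sqrt (poly Q x)) = exp y"
  proof -
    have es: "sqrt (\<rho> x) = exp (ln (\<rho> x) / 2)" "sqrt (poly Q x) = exp (ln (poly Q x) / 2)"
      using \<rho>(2)[OF x] Q_pos'[OF x] by (simp_all add: ln_sqrt[symmetric])
    show ?thesis unfolding es \<kappa>_def y_def add_divide_distrib exp_add ..
  qed
  have y: "\<bar>y\<bar> \<le> 3 / 2 * e"
  proof -
    define s where "s = ln (\<rho> x) + ln (poly Q x)"
    have "\<bar>s\<bar> \<le> e" "\<bar>\<gamma>\<bar> \<le> e" using gamma_bound lnd[OF x] by (auto simp: s_def)
    moreover have "y = - \<gamma> + s / 2" by (simp add: y_def s_def)
    ultimately show ?thesis by linarith
  qed
  have ey: "\<bar>exp y - 1\<bar> \<le> 9 / 2 * e"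
  proof -
    have "norm (exp (complex_of_real y) - 1) \<le> 3 * norm (complex_of_real y)"
      by (rule norm_exp_minus_one) (use y e in auto)
    then have "\<bar>exp y - 1\<bar> \<le> 3 * \<bar>y\<bar>"
      by (simp add: exp_of_real) (metis norm_of_real of_real_1 of_real_diff)
    then show ?thesis using y by simp
  qed
  have k3: "0 < \<kappa>" "\<kappa> \<le> 3"
  proof -
    have "\<kappa> \<le> exp 1" using gamma_bound e by (simp add: \<kappa>_def)
    then show "\<kappa> \<le> 3" using exp_le by linarith
  qed (simp add: \<kappa>_def)
  have sB: "0 \<le> sqrt (\<rho> x)" "sqrt (\<rho> x) \<le> B" using \<rho>(2,3)[OF x] B by (auto simp: real_le_lsqrt)
  have cd: "\<bar>cos (?l - ?cf) - cos (?l + theta \<rho> x)\<bar> \<le> e"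
    using abs_cos_diff_le[of "?l - ?cf" "?l + theta \<rho> x"] th[OF t(1)] t(2) by simp
  have "\<bar>\<kappa> * sqrt (\<rho> x) * (r / wscale i)\<bar> = \<kappa> * sqrt (\<rho> x) * (\<bar>r\<bar> / wscale i)"
    using k3 sB w by (simp add: abs_mult abs_divide)
  also have "\<dots> \<le> (3 * B) * (e / 1)"
    using k3 sB w r B by (intro mult_mono frac_le) auto
  finally have 1: "\<bar>\<kappa> * sqrt (\<rho> x) * (r / wscale i)\<bar> \<le> 3 * B * e" by simp
  have 2: "\<bar>exp y * cos (?l - ?cf) - cos (?l + theta \<rho> x)\<bar> \<le> 9 / 2 * e + e"
  proof -
    have "exp y * cos (?l - ?cf) - cos (?l + theta \<rho> x) = (exp y - 1) * cos (?l - ?cf) + (cos (?l - ?cf) - cos (?l + theta \<rho> x))"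
      by (simp add: algebra_simps)
    moreover have "\<bar>(exp y - 1) * cos (?l - ?cf)\<bar> \<le> 9 / 2 * e * 1"
      unfolding abs_mult using ey e by (intro mult_mono) auto
    ultimately show ?thesis using cd by linarith
  qed
  have "norm (complex_of_real (exp y * cos (?l - ?cf) + \<kappa> * sqrt (\<rho> x) * (r / wscale i)) - complex_of_real (cos (?l + theta \<rho> x)))
     = \<bar>exp y * cos (?l - ?cf) + \<kappa> * sqrt (\<rho> x) * (r / wscale i) - cos (?l + theta \<rho> x)\<bar>"
    unfolding of_real_diff[symmetric] norm_of_real ..
  also have "\<dots> \<le> 3 * B * e + (9 / 2 * e + e)" using 1 2 by linarith
  also have "\<dots> \<le> (9 + 3 * B) * e" using e by (simp add: algebra_simps)
  finally show ?thesis unfolding eq ys shift .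
qed

text \<open>The relative error has three sources: the outgoing wave against the Szego function, the
  reflected wave of order r^n, and the polynomial remainder carried inwards by the maximum
  principle. The term r^n remains even when e = 0.\<close>

lemma exterior_error:
  assumes i: "i \<in> {1,2,3,4}" and p: "is_monic_OP \<rho> i n p"
    and \<zeta>: "\<zeta> \<noteq> 0" "norm \<zeta> \<le> r" and r: "r < 1" and small: "e * (1 + 1 / (1 - r)\<^sup>2) \<le> 1"
  shows "norm (poly (cpoly p) (joukowski \<zeta>) / ((SS \<rho> i (joukowski \<zeta>) / SS_inf \<rho> i) * (phi (joukowski \<zeta>) / 2) ^ n) - 1)
    \<le> 3 * (1 + 1 / (1 - r)\<^sup>2) * e + 3 * exp (B / (1 - r)\<^sup>2) * (sqrt M * r ^ n + 2 * e)"
proof -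
  interpret bs_weight i A Q R M by (rule bs_weight[OF i])
  let ?z = "joukowski \<zeta>" and ?d = "szego_den i \<zeta>" and ?A = "poly (cpoly A)"
  have \<zeta>1: "norm \<zeta> < 1" using \<zeta> r by linarith
  have r0: "0 \<le> r" using \<zeta>(2) norm_ge_zero order_trans by blast
  have dn: "?d \<noteq> 0" by (rule szego_den_nonzero[OF \<zeta>1])
  have w: "wscale i > 0" using wscale_bounds(1)[of i] by linarith
  have lf: "lead_factor i > 0" by (simp add: lead_factor_def)
  have A00: "complex_of_real (coeff A 0) \<noteq> 0" using A0 by simp
  have rr: "(1 - r)\<^sup>2 \<le> (1 - norm \<zeta>)\<^sup>2" "0 < (1 - r)\<^sup>2" using \<zeta> r by (auto intro!: power_mono)
  define S where "S = exp (outer F\<rho> \<zeta>)"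
  have SS: "SS \<rho> i ?z = 2 / (wscale i * ?d) * inverse S"
  proof -
    have "SS \<rho> i ?z = 2 / (wscale i * ?d) * exp (- outer F\<rho> \<zeta>)"
      by (rule SS_joukowski) (use \<rho> i \<zeta>(1) \<zeta>1 in auto)
    then show ?thesis by (simp add: S_def exp_minus)
  qed
  have S0: "S \<noteq> 0" by (simp add: S_def)
  define \<kappa> where "\<kappa> = complex_of_real (exp (- \<gamma>))"
  have P: "poly (cpoly p) ?z = poly (cpoly (Phat i n p)) ?z / (of_real (coeff A 0) * 2 ^ n * of_real (lead_factor i))"
    using A00 lf by (simp add: Phat_def cpoly_simps)
  have "poly (cpoly p) ?z / ((SS \<rho> i ?z / SS_inf \<rho> i) * (phi ?z / 2) ^ n) = \<kappa> * S * (?d * \<zeta> ^ n * poly (cpoly (Phat i n p)) ?z)"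
    unfolding P SS SS_inf_A0[OF i] phi_joukowski[OF \<zeta>(1) \<zeta>1] \<kappa>_def
    using A00 lf w dn S0 \<zeta>(1) by (simp add: field_simps)
  also have "Phat i n p = bs i A n + (Phat i n p - bs i A n)" by simp
  also have "?d * \<zeta> ^ n * poly (cpoly (bs i A n + (Phat i n p - bs i A n))) ?z
     = ?d * \<zeta> ^ n * poly (cpoly (bs i A n)) ?z + ?d * \<zeta> ^ n * poly (cpoly (Phat i n p - bs i A n)) ?z"
    unfolding cpoly_simps(2) poly_add by (rule distrib_left)
  also have "?d * \<zeta> ^ n * poly (cpoly (bs i A n)) ?z = ?A \<zeta> + of_real (parity_sign i) * \<zeta> ^ (2 * n + freq_shift i) * ?A (1 / \<zeta>)"
    by (rule bs_joukowski[OF i \<zeta>(1)]) (use degA in simp)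
  finally have eq: "poly (cpoly p) ?z / ((SS \<rho> i ?z / SS_inf \<rho> i) * (phi ?z / 2) ^ n) - 1
     = (\<kappa> * S * ?A \<zeta> - 1) + \<kappa> * S * (of_real (parity_sign i) * \<zeta> ^ (2 * n + freq_shift i) * ?A (1 / \<zeta>) + ?d * \<zeta> ^ n * poly (cpoly (Phat i n p - bs i A n)) ?z)"
    by (simp add: algebra_simps)
  have T1: "norm (\<kappa> * S * ?A \<zeta> - 1) \<le> 3 * (1 + 1 / (1 - r)\<^sup>2) * e"
  proof -
    let ?y = "- of_real \<gamma> + (outer F\<rho> \<zeta> + outer FQ \<zeta>)"
    have "\<kappa> * S * ?A \<zeta> = exp ?y"
      unfolding \<kappa>_def S_def Aout[OF \<zeta>1] exp_add exp_of_real[symmetric] by simp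
    have "norm (outer F\<rho> \<zeta> + outer FQ \<zeta>) \<le> e / (1 - r)\<^sup>2"
      using norm_outer_sum[OF \<zeta>1] divide_left_mono[OF rr(1) e(1)] rr by (smt (verit) mult_pos_pos)
    then have "norm ?y \<le> e + e / (1 - r)\<^sup>2"
      using norm_triangle_ineq[of "- of_real \<gamma>" "outer F\<rho> \<zeta> + outer FQ \<zeta>"] gamma_bound by simp
    then have ny: "norm ?y \<le> e * (1 + 1 / (1 - r)\<^sup>2)" by (simp add: algebra_simps)
    then have "norm (exp ?y - 1) \<le> 3 * norm ?y" using small by (intro norm_exp_minus_one) linarith
    also have "\<dots> \<le> 3 * (e * (1 + 1 / (1 - r)\<^sup>2))" using ny by (intro mult_left_mono) auto
    finally show ?thesis unfolding \<open>\<kappa> * S * ?A \<zeta> = exp ?y\<close> by (simp only: mult_ac)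
  qed
  have nk: "norm \<kappa> \<le> 3"
  proof -
    have "exp (- \<gamma>) \<le> exp 1" using gamma_bound e by simp
    then have "exp (- \<gamma>) \<le> 3" using exp_le by linarith
    then show ?thesis by (simp add: \<kappa>_def)
  qed
  have nS: "norm S \<le> exp (B / (1 - r)\<^sup>2)"
  proof -
    have "norm (outer F\<rho> \<zeta>) \<le> B / (1 - norm \<zeta>)\<^sup>2"
      by (rule norm_outer_le[OF F\<rho>_cont _ \<zeta>1]) (use \<rho>(4) in auto)
    also have "\<dots> \<le> B / (1 - r)\<^sup>2" using rr B by (intro divide_left_mono mult_pos_pos) (auto intro: less_le_trans)
    finally have "exp (norm (outer F\<rho> \<zeta>)) \<le> exp (B / (1 - r)\<^sup>2)" by simp
    then show ?thesis unfolding S_def using norm_exp[of "outer F\<rho> \<zeta>"] by linarith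
  qed
  have T2: "norm (of_real (parity_sign i) * \<zeta> ^ (2 * n + freq_shift i) * ?A (1 / \<zeta>)) \<le> sqrt M * r ^ n"
  proof -
    define s where "s = norm \<zeta>"
    have s: "0 < s" "s < 1" "s \<le> r" using \<zeta> \<zeta>1 by (auto simp: s_def)
    have "norm (?A (1 / \<zeta>)) \<le> sqrt M * max 1 (norm (1 / \<zeta>)) ^ n"
      by (rule poly_growth) (use norm_A_cis degA in \<open>auto simp: degree_map_poly\<close>)
    also have "max 1 (norm (1 / \<zeta>)) = 1 / s" using s by (simp add: s_def norm_divide max_def)
    finally have g: "norm (?A (1 / \<zeta>)) \<le> sqrt M * (1 / s) ^ n" .
    have "norm (of_real (parity_sign i) * \<zeta> ^ (2 * n + freq_shift i) * ?A (1 / \<zeta>)) = s ^ (2 * n + freq_shift i) * norm (?A (1 / \<zeta>))"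
      by (simp add: norm_mult norm_power s_def parity_sign_def)
    \<comment> \<open>The decay of order 2 n in s beats the growth of order n of A(1/\<zeta>),
      leaving s^n.\<close>
    also have "\<dots> \<le> s ^ (2 * n) * (sqrt M * (1 / s) ^ n)"
      using s g M_pos by (intro mult_mono power_decreasing) auto
    also have "\<dots> = sqrt M * s ^ n"
    proof -
      have "s ^ (2 * n) = s ^ n * s ^ n" by (simp add: mult_2 power_add)
      then show ?thesis using s by (simp add: power_one_over)
    qed
    also have "\<dots> \<le> sqrt M * r ^ n" using s M_pos by (intro mult_left_mono power_mono) auto
    finally show ?thesis .
  qed
  have T3: "norm (?d * \<zeta> ^ n * poly (cpoly (Phat i n p - bs i A n)) ?z) \<le> 2 * e"
  proof (rule bernstein_walsh[OF i _ _ \<zeta>(1)])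
    have "degree A < n" using degA by simp
    then show "degree (Phat i n p - bs i A n) \<le> n"
      using Phat_props(1)[OF p] bs_degree by (intro degree_diff_le) auto
    show "\<bar>sqrt_weight i t * poly (Phat i n p - bs i A n) (cos t)\<bar> \<le> e" if "t \<in> {0..pi}" for t
      by (rule Phat_close[OF i p _ that]) simp
  qed (use \<zeta>1 in simp)
  have "norm (\<kappa> * S * (of_real (parity_sign i) * \<zeta> ^ (2 * n + freq_shift i) * ?A (1 / \<zeta>) + ?d * \<zeta> ^ n * poly (cpoly (Phat i n p - bs i A n)) ?z))
     \<le> (3 * exp (B / (1 - r)\<^sup>2)) * (sqrt M * r ^ n + 2 * e)"
    unfolding norm_mult[of "\<kappa> * S"] norm_mult[of \<kappa>]
    using nk nS norm_triangle_mono[OF T2 T3] by (intro mult_mono) auto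
  then show ?thesis unfolding eq using T1 norm_triangle_ineq order_trans by (smt (verit))
qed

lemma Lam_bound:
  assumes i: "i \<in> {1,2,3,4}"
    and X: "\<And>t. t \<in> {0..pi} \<Longrightarrow> \<bar>sqrt_weight i t * poly f (cos t)\<bar> \<le> X"
    and Y: "\<And>t. t \<in> {0..pi} \<Longrightarrow> \<bar>sqrt_weight i t * poly g (cos t)\<bar> \<le> Y"
  shows "\<bar>bs_weight.Lam i Q (f * g)\<bar> \<le> pi * X * Y / c"
proof -
  have Qc: "c \<le> poly Q (cos t)" for t by (rule Q(1)) simp
  interpret bs_weight i A Q R M by (rule bs_weight[OF i])
  have "norm (integral {0..pi} (\<lambda>t. (sqrt_weight i t)\<^sup>2 * poly (f * g) (cos t) / poly Q (cos t))) \<le> integral {0..pi} (\<lambda>_. X * Y / c)"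
  proof (rule integral_norm_bound_integral[OF Lam_integrable])
    fix t assume t: "t \<in> {0..pi}"
    have "(sqrt_weight i t)\<^sup>2 * poly (f * g) (cos t) / poly Q (cos t)
      = (sqrt_weight i t * poly f (cos t)) * (sqrt_weight i t * poly g (cos t)) / poly Q (cos t)"
      by (simp add: power2_eq_square mult_ac)
    then have "norm ((sqrt_weight i t)\<^sup>2 * poly (f * g) (cos t) / poly Q (cos t))
      = \<bar>sqrt_weight i t * poly f (cos t)\<bar> * \<bar>sqrt_weight i t * poly g (cos t)\<bar> / poly Q (cos t)"
      using Q_pos[of t] by (simp only: real_norm_def abs_divide abs_mult abs_of_pos)
    also have "\<dots> \<le> X * Y / c"
      using X[OF t] Y[OF t] Qc[of t] c by (intro frac_le mult_mono mult_nonneg_nonneg) (auto intro: order_trans[OF abs_ge_zero])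
    finally show "norm ((sqrt_weight i t)\<^sup>2 * poly (f * g) (cos t) / poly Q (cos t)) \<le> X * Y / c" .
  qed auto
  then show ?thesis by (simp add: Lam_def mult_ac)
qed

text \<open>\<open>Rr\<close> is the combination of the differences \<open>d\<close> that the
  Bernstein-Szego recurrence suggests, hence of size 2 e. The recurrence for P identifies it with b
  \<open>Ph n\<close> + (2 a^2 - 1/2) \<open>Ph (n - 1)\<close>, and testing against
  \<open>bs\<close> extracts both coefficients.\<close>

lemma recurrence_error:
  assumes i: "i \<in> {1,2,3,4}" and P: "\<And>k. is_monic_OP \<rho> i k (P k)"
    and rec: "[:0, 1:] * P n = P (Suc n) + smult b (P n) + smult (a\<^sup>2) (P (n - 1))" and a: "a \<ge> 0"
  shows "\<bar>b\<bar> \<le> 8 * sqrt M / c * e"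
    and "\<bar>a - 1 / 2\<bar> \<le> (8 * sqrt M / c + 2 * (8 * sqrt M / c) * (2 * sqrt M) * (2 * sqrt M + 1) / c) * e"
proof -
  interpret bs_weight i A Q R M by (rule bs_weight[OF i])
  have w: "1 \<le> wscale i" "wscale i \<le> 2" by (rule wscale_bounds)+
  have w2: "1 \<le> (wscale i)\<^sup>2" using w by (simp add: one_le_power)
  have ampb: "amp \<le> 2 * sqrt M" unfolding amp_def using w M_pos by (intro mult_right_mono) auto
  have dk: "degree A < n - 1" "degree A < n" "degree A < Suc n" and n1: "n \<ge> 2" using degA by auto
  define Ph where "Ph = (\<lambda>k. Phat i k (P k))"
  define d where "d = (\<lambda>k. Ph k - bs i A k)"
  define Rr where "Rr = [:0, 1:] * d n - smult (1/2) (d (Suc n)) - smult (1/2) (d (n - 1))"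
  have dsmall: "\<bar>sqrt_weight i t * poly (d k) (cos t)\<bar> \<le> e" if "k \<in> {n - 1, n, Suc n}" "t \<in> {0..pi}" for k t
    unfolding d_def Ph_def by (rule Phat_close[OF i P that])
  have degd: "degree (d k) < k" if "k \<in> {n - 1, n, Suc n}" for k
  proof -
    have k: "degree A < k" "1 \<le> k" using that dk by auto
    show ?thesis unfolding d_def Ph_def
      using Phat_props(1,2)[OF P k(1)] k(2) by (intro degree_less_of_coeff degree_diff_le bs_degree) auto
  qed
  have Rr: "Rr = smult b (Ph n) + smult (2 * a\<^sup>2 - 1 / 2) (Ph (n - 1))"
  proof -
    have "poly Rr x = poly (smult b (Ph n) + smult (2 * a\<^sup>2 - 1 / 2) (Ph (n - 1))) x" for x
    proof -
      define K where "K = coeff A 0 * lead_factor i"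
      obtain l where l: "n = Suc l" using n1 by (cases n) auto
      have ph: "poly (Ph k) x = K * 2 ^ k * poly (P k) x" for k by (simp add: Ph_def Phat_def K_def mult_ac)
      have r1: "x * poly (P n) x = poly (P (Suc n)) x + b * poly (P n) x + a\<^sup>2 * poly (P (n - 1)) x"
        using arg_cong[OF rec, of "\<lambda>p. poly p x"] by simp
      have "x * poly (Ph n) x = K * 2 ^ n * (x * poly (P n) x)" by (simp add: ph)
      also have "\<dots> = 1 / 2 * poly (Ph (Suc n)) x + b * poly (Ph n) x + 2 * a\<^sup>2 * poly (Ph (n - 1)) x"
        unfolding r1 ph by (simp add: l algebra_simps)
      finally have r2: "x * poly (Ph n) x = 1 / 2 * poly (Ph (Suc n)) x + b * poly (Ph n) x + 2 * a\<^sup>2 * poly (Ph (n - 1)) x" .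
      have r3: "2 * (x * poly (bs i A n) x) = poly (bs i A (Suc n)) x + poly (bs i A (n - 1)) x"
        using arg_cong[OF bs_recurrence[OF dk(2), of i], of "\<lambda>p. poly p x"] by (simp add: mult.left_commute)
      have "poly Rr x = x * poly (Ph n) x - x * poly (bs i A n) x - 1 / 2 * (poly (Ph (Suc n)) x - poly (bs i A (Suc n)) x) - 1 / 2 * (poly (Ph (n - 1)) x - poly (bs i A (n - 1)) x)"
        by (simp add: Rr_def d_def algebra_simps)
      then show ?thesis using r2 r3 by (simp add: algebra_simps)
    qed
    then show ?thesis by (intro poly_eq_poly_eq_iff[THEN iffD1] ext)
  qed
  have Rb: "\<bar>sqrt_weight i t * poly Rr (cos t)\<bar> \<le> 2 * e" if t: "t \<in> {0..pi}" for t
  proof -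
    let ?s = "sqrt_weight i t"
    have "?s * poly Rr (cos t) = cos t * (?s * poly (d n) (cos t)) - 1 / 2 * (?s * poly (d (Suc n)) (cos t)) - 1 / 2 * (?s * poly (d (n - 1)) (cos t))"
      by (simp add: Rr_def algebra_simps)
    moreover have "\<bar>cos t * (?s * poly (d n) (cos t))\<bar> \<le> 1 * e"
      unfolding abs_mult[of "cos t"] using dsmall[of n t] t by (intro mult_mono) auto
    moreover have "\<bar>?s * poly (d (Suc n)) (cos t)\<bar> \<le> e" "\<bar>?s * poly (d (n - 1)) (cos t)\<bar> \<le> e"
      using dsmall[OF _ t] by auto
    ultimately show ?thesis by linarith
  qed
  have bsb: "\<bar>sqrt_weight i t * poly (bs i A k) (cos t)\<bar> \<le> 2 * sqrt M" if "t \<in> {0..pi}" "degree A < k" for t k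
    using bs_eq_Re_wave[OF i that(1), of A k] that(2) abs_Re_le_cmod[of "bs_wave i A k t"] norm_bs_wave[of k t] ampb by simp
  have phb: "\<bar>sqrt_weight i t * poly (Ph n) (cos t)\<bar> \<le> 2 * sqrt M + 1" if t: "t \<in> {0..pi}" for t
  proof -
    have "sqrt_weight i t * poly (Ph n) (cos t) = sqrt_weight i t * poly (d n) (cos t) + sqrt_weight i t * poly (bs i A n) (cos t)"
      by (simp add: d_def algebra_simps)
    then show ?thesis using dsmall[of n t] bsb[OF t dk(2)] t e by simp
  qed
  \<comment> \<open>Exact: the difference \<open>d k\<close> has lower degree and is orthogonal to
    \<open>bs\<close>.\<close>
  have sq: "Lam (bs i A k * Ph k) = (wscale i)\<^sup>2 * pi / 2" if "k \<in> {n - 1, n}" for k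
  proof -
    have k: "degree A < k" "k \<in> {n - 1, n, Suc n}" using that dk by auto
    have "bs i A k * Ph k = bs i A k * bs i A k + bs i A k * d k" by (simp add: d_def right_diff_distrib)
    moreover have "Lam (bs i A k * d k) = 0" using k degd[OF k(2)] by (intro Lam_bs_orth) auto
    ultimately show ?thesis by (simp add: Lam_add Lam_bs_square[OF k(1)])
  qed
  have or: "Lam (bs i A n * Ph (n - 1)) = 0"
    using Phat_props(1)[OF P dk(1)] dk n1 unfolding Ph_def by (intro Lam_bs_orth) auto
  have L1: "Lam (bs i A n * Rr) = b * ((wscale i)\<^sup>2 * pi / 2)"
    unfolding Rr by (simp add: distrib_left Lam_add Lam_smult sq or[unfolded One_nat_def])
  have "\<bar>b\<bar> * ((wscale i)\<^sup>2 * pi / 2) = \<bar>Lam (bs i A n * Rr)\<bar>"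
    unfolding L1 by (simp add: abs_mult)
  also have "\<dots> \<le> pi * (2 * sqrt M) * (2 * e) / c"
    by (rule Lam_bound[OF i bsb[OF _ dk(2)] Rb])
  finally have "\<bar>b\<bar> * ((wscale i)\<^sup>2 * pi / 2) \<le> pi * (2 * sqrt M) * (2 * e) / c" .
  then have "pi * ((wscale i)\<^sup>2 * \<bar>b\<bar>) \<le> pi * (8 * sqrt M / c * e)" by (simp add: field_simps)
  then have "(wscale i)\<^sup>2 * \<bar>b\<bar> \<le> 8 * sqrt M / c * e" by (rule mult_left_le_imp_le) simp
  moreover have "1 * \<bar>b\<bar> \<le> (wscale i)\<^sup>2 * \<bar>b\<bar>" using w2 by (intro mult_right_mono) auto
  ultimately show b: "\<bar>b\<bar> \<le> 8 * sqrt M / c * e" by simp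
  define D where "D = 2 * a\<^sup>2 - 1 / 2"
  \<comment> \<open>In this degree the term with b does not drop out by orthogonality, so the bound
    for b is used; this is where the second, larger constant comes from.\<close>
  have "Lam (bs i A (n - 1) * Rr) = b * Lam (bs i A (n - 1) * Ph n) + D * ((wscale i)\<^sup>2 * pi / 2)"
    unfolding Rr D_def by (simp add: distrib_left Lam_add Lam_smult sq)
  then have "D * ((wscale i)\<^sup>2 * pi / 2) = Lam (bs i A (n - 1) * Rr) - b * Lam (bs i A (n - 1) * Ph n)" by simp
  then have "\<bar>D\<bar> * ((wscale i)\<^sup>2 * pi / 2) = \<bar>Lam (bs i A (n - 1) * Rr) - b * Lam (bs i A (n - 1) * Ph n)\<bar>"
    by (metis (no_types) abs_mult abs_of_nonneg zero_le_power2 mult_nonneg_nonneg pi_ge_zero divide_nonneg_nonneg zero_le_numeral)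
  also have "\<dots> \<le> \<bar>Lam (bs i A (n - 1) * Rr)\<bar> + \<bar>b\<bar> * \<bar>Lam (bs i A (n - 1) * Ph n)\<bar>"
    using abs_triangle_ineq4 by (metis abs_mult)
  also have "\<bar>Lam (bs i A (n - 1) * Rr)\<bar> \<le> pi * (2 * sqrt M) * (2 * e) / c"
    by (rule Lam_bound[OF i bsb[OF _ dk(1)] Rb])
  also have "\<bar>b\<bar> * \<bar>Lam (bs i A (n - 1) * Ph n)\<bar> \<le> (8 * sqrt M / c * e) * (pi * (2 * sqrt M) * (2 * sqrt M + 1) / c)"
    using b Lam_bound[OF i bsb[OF _ dk(1)] phb] e c M_pos by (intro mult_mono) auto
  finally have "\<bar>D\<bar> * ((wscale i)\<^sup>2 * pi / 2) \<le> pi * (2 * sqrt M) * (2 * e) / c + (8 * sqrt M / c * e) * (pi * (2 * sqrt M) * (2 * sqrt M + 1) / c)"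
    by simp
  then have "pi * ((wscale i)\<^sup>2 * \<bar>D\<bar>) \<le> pi * ((8 * sqrt M / c + 2 * (8 * sqrt M / c) * (2 * sqrt M) * (2 * sqrt M + 1) / c) * e)"
    by (simp add: field_simps)
  then have "(wscale i)\<^sup>2 * \<bar>D\<bar> \<le> (8 * sqrt M / c + 2 * (8 * sqrt M / c) * (2 * sqrt M) * (2 * sqrt M + 1) / c) * e"
    by (rule mult_left_le_imp_le) simp
  moreover have "1 * \<bar>D\<bar> \<le> (wscale i)\<^sup>2 * \<bar>D\<bar>" using w2 by (intro mult_right_mono) auto
  \<comment> \<open>D factors as (2 a + 1)(a - 1/2), and a \<ge> 0 makes the first factor at least
    1.\<close>
  moreover have "\<bar>a - 1 / 2\<bar> \<le> \<bar>D\<bar>"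
  proof -
    have "D = 2 * (a + 1 / 2) * (a - 1 / 2)" by (simp add: D_def algebra_simps power2_eq_square)
    then have "\<bar>D\<bar> = (2 * a + 1) * \<bar>a - 1 / 2\<bar>" using a by (simp add: abs_mult)
    moreover have "1 * \<bar>a - 1 / 2\<bar> \<le> (2 * a + 1) * \<bar>a - 1 / 2\<bar>" using a by (intro mult_right_mono) auto
    ultimately show ?thesis by simp
  qed
  ultimately show "\<bar>a - 1 / 2\<bar> \<le> (8 * sqrt M / c + 2 * (8 * sqrt M / c) * (2 * sqrt M) * (2 * sqrt M + 1) / c) * e"
    by linarith
qed

end

subsection \<open>Choice of the approximating polynomial\<close>

lemma eps_alt: "eps m \<rho> n = ln (real n) * (modulus (nth_deriv m (\<lambda>x. 1 / \<rho> x)) (1 / real n) / real n ^ m)"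
  by (simp add: eps_def)

text \<open>For n \<ge> 3 the argument is at most 33 n \<le> n^5. The degree k = n + 1 is included
  for the recurrence.\<close>

lemma ln_kernel_le:
  assumes n: "3 \<le> n" and k: "k \<le> Suc n"
  shows "ln (1 + 6 * real k * pi) \<le> 5 * ln (real n)"
proof -
  have "6 * real k * pi \<le> 6 * real (Suc n) * 4"
    using pi_less_4 k by (intro mult_mono) auto
  then have "1 + 6 * real k * pi \<le> 33 * real n" using n by simp
  also have "\<dots> \<le> real n ^ 4 * real n"
  proof (rule mult_right_mono)
    have "(3::real) ^ 4 \<le> real n ^ 4" using n by (intro power_mono) auto
    then show "33 \<le> real n ^ 4" by simp
  qed simp
  also have "\<dots> = real n ^ 5" by (simp add: power_numeral_reduce)
  finally have "ln (1 + 6 * real k * pi) \<le> ln (real n ^ 5)"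
    by (subst ln_le_cancel_iff) (use n in \<open>auto intro!: add_pos_nonneg\<close>)
  then show ?thesis using n by (simp add: ln_realpow)
qed

locale smooth_weight =
  fixes m :: nat and \<rho> :: "real \<Rightarrow> real"
  assumes m: "m \<ge> 1" and pos: "\<And>x. x \<in> {-1..1} \<Longrightarrow> \<rho> x > 0" and smooth: "cont_diff m \<rho>"
begin

lemma cont_rho: "continuous_on {-1..1} \<rho>"
  by (rule cont_diff_continuous[OF smooth])

lemma smooth_inverse: "cont_diff m (\<lambda>x. 1 / \<rho> x)"
  using pos by (intro cont_diff_inverse smooth) (auto simp: less_imp_neq[symmetric])

abbreviation g where "g \<equiv> nth_deriv m (\<lambda>x. 1 / \<rho> x)"

lemma cont_g: "continuous_on {-1..1} g"
  using smooth_inverse by (simp add: cont_diff_def)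

lemma delta_nonneg: "0 \<le> modulus g (1 / real n) / real n ^ m"
  using modulus_nonneg[OF cont_g, of "1 / real n"] by simp

text \<open>From n = 3 on ln n \<ge> 1, so errors without a logarithm are covered too.\<close>

lemma delta_le_eps: "3 \<le> n \<Longrightarrow> modulus g (1 / real n) / real n ^ m \<le> eps m \<rho> n"
proof -
  assume n: "3 \<le> n"
  have "exp 1 \<le> real n" using exp_le n by linarith
  then have "1 \<le> ln (real n)" using n by (simp add: ln_ge_iff)
  from mult_right_mono[OF this delta_nonneg[of n]] show ?thesis unfolding eps_alt by simp
qed

lemma eps_nonneg: "0 \<le> eps m \<rho> n"
proof (cases "n = 0")
  case False
  then have "0 \<le> ln (real n)" by simp
  then show ?thesis unfolding eps_alt by (rule mult_nonneg_nonneg[OF _ delta_nonneg])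
qed (simp add: eps_def)

lemma eps_tendsto_0: "eps m \<rho> \<longlonglongrightarrow> 0"
proof -
  have "bounded (g ` {-1..1})"
    by (intro compact_imp_bounded compact_continuous_image cont_g) auto
  then obtain G where "\<forall>x\<in>{-1..1}. \<bar>g x\<bar> \<le> G" unfolding bounded_iff by auto
  then have G: "\<bar>g x\<bar> \<le> G" if "x \<in> {-1..1}" for x using that by blast
  have mg: "modulus g (1 / real n) \<le> 2 * G" for n
  proof -
    obtain x y where "x \<in> {-1..1}" "y \<in> {-1..1}" "modulus g (1 / real n) = \<bar>g x - g y\<bar>"
      using modulus_attained[OF cont_g, of "1 / real n"] by auto
    then show ?thesis using G[of x] G[of y] by linarith
  qed
  have "eps m \<rho> n \<le> 2 * G * (ln (real n) / real n)" if n: "n \<ge> 1" for n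
  proof -
    have G0: "0 \<le> G" using G[of 0] by auto
    have "real n ^ 1 \<le> real n ^ m" using m n by (intro power_increasing) auto
    then have "ln (real n) / real n ^ m \<le> ln (real n) / real n" using n by (intro divide_left_mono) auto
    then have "ln (real n) / real n ^ m * modulus g (1 / real n) \<le> ln (real n) / real n * (2 * G)"
      using mg[of n] modulus_nonneg[OF cont_g, of "1 / real n"] n by (intro mult_mono) auto
    then show ?thesis by (simp add: eps_def mult_ac)
  qed
  then have e1: "\<forall>\<^sub>F n in sequentially. norm (eps m \<rho> n) \<le> 2 * G * (ln (real n) / real n)"
    using eps_nonneg by (intro eventually_sequentiallyI[of 1]) simp
  have "(\<lambda>n. 2 * G * (ln (real n) / real n)) \<longlonglongrightarrow> 2 * G * 0"
    by (intro tendsto_intros)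
  then have e2: "(\<lambda>n. 2 * G * (ln (real n) / real n)) \<longlonglongrightarrow> 0" by simp
  show ?thesis by (rule Lim_null_comparison[OF e1 e2])
qed

lemma eventually_eps_small:
  assumes "0 < \<eta>" shows "\<forall>\<^sub>F n in sequentially. K * eps m \<rho> n \<le> \<eta>"
proof -
  have "(\<lambda>n. K * eps m \<rho> n) \<longlonglongrightarrow> K * 0" by (intro tendsto_intros eps_tendsto_0)
  then have "\<forall>\<^sub>F n in sequentially. K * eps m \<rho> n < \<eta>" using assms by (intro order_tendstoD) auto
  then show ?thesis by eventually_elim simp
qed

text \<open>All constants are fixed before n; only \<open>A\<close>, \<open>Q\<close> and
  \<open>R\<close> depend on it. In particular the lower and upper bounds for Q are uniform, which
  makes the O-constants uniform.\<close>

lemma approx_exists: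
  obtains K c M B where "K \<ge> 0" "c > 0" "M > 0" "B \<ge> 0"
    "\<forall>\<^sub>F n in sequentially. \<exists>A Q R. szego_approx \<rho> A Q R c M B (K * eps m \<rho> n) n"
proof -
  obtain c0 where c0: "c0 > 0" "\<And>x. x \<in> {-1..1} \<Longrightarrow> c0 \<le> \<rho> x"
  proof -
    have "\<exists>x\<in>{-1..1::real}. \<forall>y\<in>{-1..1}. \<rho> x \<le> \<rho> y"
      by (rule continuous_attains_inf) (auto intro!: cont_rho)
    then show ?thesis using that pos by metis
  qed
  obtain c1 where c1: "\<And>x. x \<in> {-1..1} \<Longrightarrow> \<rho> x \<le> c1"
  proof -
    have "\<exists>x\<in>{-1..1::real}. \<forall>y\<in>{-1..1}. \<rho> y \<le> \<rho> x"
      by (rule continuous_attains_sup) (auto intro!: cont_rho)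
    then show ?thesis using that by metis
  qed
  have c1p: "c1 > 0" using c0(1) c0(2)[of 0] c1[of 0] by simp
  obtain m' where m': "m = Suc m'" using m by (cases m) auto
  have dcont: "continuous_on {-1..1} (deriv_I \<rho>)" and ddiff: "\<rho> differentiable_on {-1..1}"
    using smooth by (auto simp: m' cont_diff_Suc intro: cont_diff_continuous)
  have "bounded (deriv_I \<rho> ` {-1..1})"
    by (intro compact_imp_bounded compact_continuous_image dcont) auto
  then obtain L1 where L1: "\<forall>x\<in>{-1..1}. \<bar>deriv_I \<rho> x\<bar> \<le> L1" unfolding bounded_iff by auto
  have L1p: "L1 \<ge> 0" using L1 by (metis abs_ge_zero atLeastAtMost_iff le_numeral_extra(1) neg_le_0_iff_le order_trans zero_le_one)
  have lip: "\<bar>\<rho> x - \<rho> y\<bar> \<le> L1 * \<bar>x - y\<bar>" if "x \<in> {-1..1}" "y \<in> {-1..1}" for x y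
  proof -
    have "norm (\<rho> x - \<rho> y) \<le> L1 * norm (x - y)"
      by (rule field_differentiable_bound[of "{-1..1}" \<rho> "deriv_I \<rho>"])
         (use deriv_I_works[OF ddiff] L1 that in auto)
    then show ?thesis by simp
  qed
  obtain C where C: "C > 0" "\<And>n. n \<ge> 2 * m + 12 \<Longrightarrow>
    \<exists>q. degree q + 3 \<le> n \<and>
     (\<forall>x\<in>{-1..1}. \<bar>1 / \<rho> x - poly q x\<bar> \<le> C * (modulus g (1 / real n) / real n ^ m)) \<and>
     (\<forall>s\<in>{0..pi}. \<forall>t\<in>{0..pi}. \<bar>(1 / \<rho> (cos s) - poly q (cos s)) - (1 / \<rho> (cos t) - poly q (cos t))\<bar>
         \<le> C * (modulus g (1 / real n) / real n ^ m) * real n * \<bar>s - t\<bar>)"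
    by (rule smooth_approximation[OF m smooth_inverse]) (rule that, assumption, blast)
  \<comment> \<open>Half the lower bound of 1/\<rho>; Q stays above it once the approximation error
    is at most c.\<close>
  define c where "c = 1 / (2 * c1)"
  define M where "M = 1 / c0 + 1 / (2 * c1)"
  define B where "B = 1 + c1 + \<bar>ln c0\<bar> + \<bar>ln c1\<bar>"
  \<comment> \<open>K1, K2, K3 serve logarithm, phase and polynomials. The factor 60 is 3 * 4 * 5:
    conjugate function, oscillation bound, logarithm. The factor 240 is 2 * 12 * 2 * 5: amplitude,
    comparison, weight, logarithm.\<close>
  define K1 where "K1 = 2 * c1 * C"
  define K2 where "K2 = 60 * (c1 + L1) * C"
  define K3 where "K3 = 240 * M * sqrt M * c1\<^sup>2 * C"
  define K where "K = K1 + K2 + K3"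
  have cp: "c > 0" and Mp: "M > 0" using c0 c1p by (auto simp: c_def M_def intro!: add_pos_pos)
  have Kp: "K1 \<ge> 0" "K2 \<ge> 0" "K3 \<ge> 0" using c1p C Mp L1p by (auto simp: K1_def K2_def K3_def)
  have Bp: "B \<ge> 1" using c1p by (simp add: B_def)
  have ev: "\<forall>\<^sub>F n in sequentially. K * eps m \<rho> n \<le> 1 / 4" "\<forall>\<^sub>F n in sequentially. C * eps m \<rho> n \<le> c"
    "\<forall>\<^sub>F n in sequentially. 120 * M * c1\<^sup>2 * C * eps m \<rho> n \<le> 1"
    by (rule eventually_eps_small; use cp in simp)+
  have "\<forall>\<^sub>F n in sequentially. \<exists>A Q R. szego_approx \<rho> A Q R c M B (K * eps m \<rho> n) n"
    using eventually_ge_at_top[of "2 * m + 12"] ev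
  proof eventually_elim
    case (elim n)
    define \<delta> where "\<delta> = modulus g (1 / real n) / real n ^ m"
    have n3: "n \<ge> 3" using elim(1) by simp
    have \<delta>: "0 \<le> \<delta>" "\<delta> \<le> eps m \<rho> n" unfolding \<delta>_def using delta_nonneg delta_le_eps[OF n3] by auto
    have \<delta>ln: "\<delta> * ln (real n) = eps m \<rho> n" by (simp add: \<delta>_def eps_alt mult.commute)
    from C(2)[OF elim(1)] obtain Q where Q: "degree Q + 3 \<le> n"
      "\<And>x. x \<in> {-1..1} \<Longrightarrow> \<bar>1 / \<rho> x - poly Q x\<bar> \<le> C * \<delta>"
      "\<And>s t. s \<in> {0..pi} \<Longrightarrow> t \<in> {0..pi} \<Longrightarrow> \<bar>(1 / \<rho> (cos s) - poly Q (cos s)) - (1 / \<rho> (cos t) - poly Q (cos t))\<bar>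
         \<le> C * \<delta> * real n * \<bar>s - t\<bar>"
      unfolding \<delta>_def by blast
    have "C * \<delta> \<le> C * eps m \<rho> n" using C(1) \<delta>(2) by (intro mult_left_mono) auto
    then have "C * \<delta> \<le> c" using elim(3) by linarith
    moreover have "0 \<le> C * \<delta>" using C(1) \<delta>(1) by simp
    ultimately have C\<delta>: "C * \<delta> \<le> c" "0 \<le> C * \<delta>" by blast+
    have inv: "1 / c1 \<le> 1 / \<rho> x" "1 / \<rho> x \<le> 1 / c0" if "x \<in> {-1..1}" for x
      using c0 c1[OF that] c0(2)[OF that] pos[OF that] by (auto intro!: divide_left_mono mult_pos_pos c1p)
    have cc: "1 / c1 = 2 * c" using c1p by (simp add: c_def)
    have Qlow: "c \<le> poly Q x" if "x \<in> {-1..1}" for x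
      using Q(2)[OF that] inv(1)[OF that] C\<delta>(1) cc by linarith
    have Qup: "poly Q x \<le> M" if "x \<in> {-1..1}" for x
      using Q(2)[OF that] inv(2)[OF that] C\<delta>(1) unfolding M_def c_def by linarith
    have Qpos: "0 < poly Q x" if "x \<in> {-1..1}" for x using Qlow[OF that] cp by linarith
    have wd: "\<bar>\<rho> x - 1 / poly Q x\<bar> \<le> 2 * c1\<^sup>2 * C * \<delta>" if x: "x \<in> {-1..1}" for x
    proof -
      have "\<rho> x - 1 / poly Q x = \<rho> x * (1 / poly Q x) * (poly Q x - 1 / \<rho> x)"
        using pos[OF x] Qpos[OF x] by (simp add: field_simps)
      then have "\<bar>\<rho> x - 1 / poly Q x\<bar> = \<rho> x * (1 / poly Q x) * \<bar>1 / \<rho> x - poly Q x\<bar>"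
        using pos[OF x] Qpos[OF x] by (simp add: abs_mult abs_minus_commute)
      also have "\<dots> \<le> c1 * (1 / c) * (C * \<delta>)"
        using pos[OF x] Qpos[OF x] Qlow[OF x] c1[OF x] Q(2)[OF x] cp c1p
        by (intro mult_mono divide_left_mono mult_pos_pos mult_nonneg_nonneg) auto
      also have "\<dots> = 2 * c1\<^sup>2 * C * \<delta>" using c1p by (simp add: c_def power2_eq_square)
      finally show ?thesis .
    qed
    have ld: "\<bar>ln (\<rho> x) + ln (poly Q x)\<bar> \<le> K1 * \<delta>" if x: "x \<in> {-1..1}" for x
    proof -
      have "\<bar>ln (poly Q x) - ln (1 / \<rho> x)\<bar> \<le> \<bar>poly Q x - 1 / \<rho> x\<bar> / c"
        by (rule abs_ln_diff_le[OF cp Qlow[OF x]]) (use inv(1)[OF x] cc cp in linarith)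
      also have "\<dots> \<le> (C * \<delta>) / c" using Q(2)[OF x] cp by (intro divide_right_mono) (auto simp: abs_minus_commute)
      also have "\<dots> = K1 * \<delta>" using c1p by (simp add: c_def K1_def)
      finally show ?thesis using pos[OF x] by (simp add: ln_div add.commute)
    qed
    obtain A R where A: "degree A \<le> degree Q" "R > 1" "\<And>\<zeta>. \<zeta> \<in> ball 0 R \<Longrightarrow> poly (cpoly A) \<zeta> \<noteq> 0"
      "\<And>t. poly (cpoly A) (cis t) * poly (cpoly A) (cis (- t)) = of_real (poly Q (cos t))"
      "\<And>\<xi>. norm \<xi> < 1 \<Longrightarrow> poly (cpoly A) \<xi> = exp (outer (\<lambda>t. ln (poly Q (cos t))) \<xi>)"
      "\<And>t. t \<in> {0..pi} \<Longrightarrow> poly (cpoly A) (cis (- t)) =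
        of_real (sqrt (poly Q (cos t))) * cis (- conj_fun (\<lambda>t. ln (poly Q (cos t))) t)"
      by (rule fejer_riesz[OF Qpos]) (assumption | rule that)+
    have eK: "K1 * \<delta> \<le> K * eps m \<rho> n" "K2 * eps m \<rho> n \<le> K * eps m \<rho> n" "K3 * eps m \<rho> n \<le> K * eps m \<rho> n"
    proof -
      show "K1 * \<delta> \<le> K * eps m \<rho> n" using Kp \<delta> by (intro mult_mono) (auto simp: K_def)
    qed (use Kp eps_nonneg in \<open>auto simp: K_def intro!: mult_right_mono\<close>)
    have lnn: "ln (1 + 6 * real k * pi) \<le> 5 * ln (real n)" if "k \<le> Suc n" for k
      by (rule ln_kernel_le[OF n3 that])
    have "szego_approx \<rho> A Q R c M B (K * eps m \<rho> n) n"
    proof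
      show "continuous_on {-1..1} \<rho>" by (rule cont_rho)
      show "0 < \<rho> x" if "x \<in> {-1..1}" for x by (rule pos[OF that])
      show "\<rho> x \<le> B\<^sup>2" if "x \<in> {-1..1}" for x
      proof -
        have "c1 \<le> B" by (simp add: B_def)
        moreover have "B * 1 \<le> B * B" using Bp by (intro mult_left_mono) auto
        ultimately show ?thesis using c1[OF that] by (simp add: power2_eq_square)
      qed
      show "\<bar>ln (\<rho> x)\<bar> \<le> B" if "x \<in> {-1..1}" for x
      proof -
        have "ln c0 \<le> ln (\<rho> x)" "ln (\<rho> x) \<le> ln c1"
          using c0 c0(2)[OF that] c1[OF that] pos[OF that] c1p by (simp_all add: ln_le_cancel_iff)
        then show ?thesis using c1p unfolding B_def by linarith
      qed
      show "0 \<le> B" using Bp by simp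
      show "degree A + 3 \<le> n" using A(1) Q(1) by simp
      show "0 < c" by (rule cp)
      show "0 \<le> K * eps m \<rho> n" using Kp eps_nonneg[of n] by (simp add: K_def)
      show "K * eps m \<rho> n \<le> 1 / 4" by (rule elim(2))
      show "\<bar>ln (\<rho> x) + ln (poly Q x)\<bar> \<le> K * eps m \<rho> n" if "x \<in> {-1..1}" for x
        using ld[OF that] eK(1) by linarith
      show "\<bar>theta \<rho> (cos t) + conj_fun (\<lambda>t. ln (poly Q (cos t))) t\<bar> \<le> K * eps m \<rho> n" if t: "t \<in> {0..pi}" for t
      proof -
        have l1: "\<bar>ln (\<rho> x) - ln (\<rho> y)\<bar> \<le> L1 / c0 * \<bar>x - y\<bar>" if "x \<in> {-1..1}" "y \<in> {-1..1}" for x y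
        proof -
          have "\<bar>ln (\<rho> x) - ln (\<rho> y)\<bar> \<le> \<bar>\<rho> x - \<rho> y\<bar> / c0"
            by (rule abs_ln_diff_le) (use c0 that in auto)
          also have "\<dots> \<le> L1 * \<bar>x - y\<bar> / c0" using lip[OF that] c0(1) by (intro divide_right_mono) auto
          finally show ?thesis by simp
        qed
        obtain LQ where LQ: "\<And>x y. x \<in> {-1..1} \<Longrightarrow> y \<in> {-1..1} \<Longrightarrow> \<bar>poly Q x - poly Q y\<bar> \<le> LQ * \<bar>x - y\<bar>"
          using poly_lipschitz_Icc by blast
        have l2: "\<bar>ln (poly Q x) - ln (poly Q y)\<bar> \<le> LQ / c * \<bar>x - y\<bar>" if "x \<in> {-1..1}" "y \<in> {-1..1}" for x y
        proof -
          have "\<bar>ln (poly Q x) - ln (poly Q y)\<bar> \<le> \<bar>poly Q x - poly Q y\<bar> / c"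
            by (rule abs_ln_diff_le) (use cp Qlow that in auto)
          also have "\<dots> \<le> LQ * \<bar>x - y\<bar> / c" using LQ[OF that] cp by (intro divide_right_mono) auto
          finally show ?thesis by simp
        qed
        let ?h = "\<lambda>x. ln (\<rho> x) - (0 - ln (poly Q x))"
        have l3: "\<bar>(0 - ln (poly Q x)) - (0 - ln (poly Q y))\<bar> \<le> LQ / c * \<bar>x - y\<bar>" if "x \<in> {-1..1}" "y \<in> {-1..1}" for x y
          using l2[OF that] by linarith
        have l4: "\<bar>?h x - ?h y\<bar> \<le> (L1 / c0 + LQ / c) * \<bar>x - y\<bar>" if "x \<in> {-1..1}" "y \<in> {-1..1}" for x y
          using l1[OF that] l2[OF that] by (simp add: distrib_right)
        have z: "conj_fun (\<lambda>t. 0) t = 0" by (simp add: conj_fun_def)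
        have "conj_fun (\<lambda>t. ?h (cos t)) t = conj_fun (\<lambda>t. ln (\<rho> (cos t))) t - conj_fun (\<lambda>t. 0 - ln (poly Q (cos t))) t"
          by (rule conj_fun_diff[of "\<lambda>x. ln (\<rho> x)" "L1 / c0" "\<lambda>x. 0 - ln (poly Q x)" "LQ / c", OF l1 l3])
        also have "conj_fun (\<lambda>t. 0 - ln (poly Q (cos t))) t = conj_fun (\<lambda>t. 0) t - conj_fun (\<lambda>t. ln (poly Q (cos t))) t"
          by (rule conj_fun_diff[of "\<lambda>_. 0" 0 "\<lambda>x. ln (poly Q x)" "LQ / c", OF _ l2]) auto
        also have "conj_fun (\<lambda>t. ln (\<rho> (cos t))) t = theta \<rho> (cos t)"
          by (rule theta_eq_conj_fun[OF l1 t, symmetric])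
        finally have eq: "theta \<rho> (cos t) + conj_fun (\<lambda>t. ln (poly Q (cos t))) t = conj_fun (\<lambda>t. ?h (cos t)) t"
          using z by simp
        define d where "d = 4 * (c1 + L1) * (C * \<delta>)"
        have n0: "real n > 0" using n3 by simp
        have b1: "\<bar>?h (cos \<tau>) - ?h (cos t)\<bar> \<le> d" if "\<tau> \<in> {0..pi}" for \<tau>
        proof -
          have "\<bar>?h (cos \<tau>) - ?h (cos t)\<bar> \<le> K1 * \<delta> + K1 * \<delta>"
            using ld[of "cos \<tau>"] ld[of "cos t"] by simp
          also have "\<dots> = 4 * c1 * (C * \<delta>)" by (simp add: K1_def)
          also have "\<dots> \<le> d" unfolding d_def using C\<delta>(2) L1p by (intro mult_right_mono) auto
          finally show ?thesis .
        qed
        have b2: "\<bar>?h (cos \<tau>) - ?h (cos t)\<bar> \<le> d * real n * \<bar>\<tau> - t\<bar>" if \<tau>: "\<tau> \<in> {0..pi}" for \<tau>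
        proof -
          let ?x = "cos \<tau>" and ?y = "cos t"
          have I: "?x \<in> {-1..1}" "?y \<in> {-1..1}" by auto
          \<comment> \<open>The sum of logarithms is treated as ln (\<rho> Q) with \<rho> Q = 1 -
            \<rho> r and r = 1/\<rho> - Q small. Separate Lipschitz bounds for ln \<rho> and ln Q
            would lose the factor \<delta>.\<close>
          have half: "1 / 2 \<le> \<rho> x * poly Q x" if x: "x \<in> {-1..1}" for x
          proof -
            have "\<rho> x * poly Q x = 1 - \<rho> x * (1 / \<rho> x - poly Q x)" using pos[OF x] by (simp add: algebra_simps)
            moreover have "\<bar>\<rho> x * (1 / \<rho> x - poly Q x)\<bar> \<le> c1 * c"
              unfolding abs_mult using c1[OF x] pos[OF x] Q(2)[OF x] C\<delta>(1) by (intro mult_mono) auto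
            moreover have "c1 * c = 1 / 2" using c1p by (simp add: c_def)
            ultimately show ?thesis by linarith
          qed
          have hl: "?h x = ln (\<rho> x * poly Q x)" if x: "x \<in> {-1..1}" for x
            using pos[OF x] Qpos[OF x] by (simp add: ln_mult_pos)
          define r where "r = (\<lambda>x. 1 / \<rho> x - poly Q x)"
          have rq: "\<rho> x * poly Q x = 1 - \<rho> x * r x" if x: "x \<in> {-1..1}" for x
            using pos[OF x] by (simp add: r_def algebra_simps)
          have "\<bar>?h ?x - ?h ?y\<bar> \<le> \<bar>\<rho> ?x * poly Q ?x - \<rho> ?y * poly Q ?y\<bar> / (1 / 2)"
            unfolding hl[OF I(1)] hl[OF I(2)] by (rule abs_ln_diff_le) (use half I in auto)
          also have "\<rho> ?x * poly Q ?x - \<rho> ?y * poly Q ?y = - (\<rho> ?x * (r ?x - r ?y)) - (\<rho> ?x - \<rho> ?y) * r ?y"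
            unfolding rq[OF I(1)] rq[OF I(2)] by (simp add: algebra_simps)
          also have "\<bar>- (\<rho> ?x * (r ?x - r ?y)) - (\<rho> ?x - \<rho> ?y) * r ?y\<bar> \<le> \<bar>\<rho> ?x * (r ?x - r ?y)\<bar> + \<bar>(\<rho> ?x - \<rho> ?y) * r ?y\<bar>"
            by linarith
          also have "\<bar>\<rho> ?x * (r ?x - r ?y)\<bar> \<le> c1 * (C * \<delta> * real n * \<bar>\<tau> - t\<bar>)"
            unfolding abs_mult r_def using Q(3)[OF \<tau> t] c1[OF I(1)] pos[OF I(1)] c1p by (intro mult_mono) auto
          also have "\<bar>(\<rho> ?x - \<rho> ?y) * r ?y\<bar> \<le> (L1 * (real n * \<bar>\<tau> - t\<bar>)) * (C * \<delta>)"
          proof -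
            have "\<bar>\<rho> ?x - \<rho> ?y\<bar> \<le> L1 * \<bar>?x - ?y\<bar>" by (rule lip[OF I])
            also have "\<dots> \<le> L1 * (real n * \<bar>\<tau> - t\<bar>)"
            proof (rule mult_left_mono[OF _ L1p])
              have "1 * \<bar>\<tau> - t\<bar> \<le> real n * \<bar>\<tau> - t\<bar>" using n3 by (intro mult_right_mono) auto
              then have "\<bar>\<tau> - t\<bar> \<le> real n * \<bar>\<tau> - t\<bar>" by simp
              with abs_cos_diff_le[of \<tau> t] show "\<bar>?x - ?y\<bar> \<le> real n * \<bar>\<tau> - t\<bar>" by (rule order_trans)
            qed
            finally show ?thesis unfolding abs_mult using Q(2)[OF I(2)] L1p by (intro mult_mono) (auto simp: r_def)
          qed
          finally have "\<bar>?h ?x - ?h ?y\<bar> \<le> (c1 * (C * \<delta> * real n * \<bar>\<tau> - t\<bar>) + L1 * (real n * \<bar>\<tau> - t\<bar>) * (C * \<delta>)) / (1 / 2)"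
            by simp
          also have "\<dots> = 2 * (c1 + L1) * (C * \<delta>) * real n * \<bar>\<tau> - t\<bar>" by (simp add: algebra_simps)
          also have "\<dots> \<le> d * real n * \<bar>\<tau> - t\<bar>"
            unfolding d_def using C\<delta>(2) L1p c1p by (intro mult_right_mono) auto
          finally show ?thesis .
        qed
        have "\<bar>conj_fun (\<lambda>t. ?h (cos t)) t\<bar> \<le> 3 * d * ln (1 + real n * pi)"
          by (rule conj_fun_bound[OF l4 t n0 b1 b2])
        also have "\<dots> \<le> 3 * d * (5 * ln (real n))"
        proof (rule mult_left_mono)
          have "ln (1 + real n * pi) \<le> ln (1 + 6 * real n * pi)"
            by (subst ln_le_cancel_iff) (auto intro!: add_pos_nonneg mult_right_mono)
          then show "ln (1 + real n * pi) \<le> 5 * ln (real n)" using lnn[of n] by simp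
          show "0 \<le> 3 * d" using C\<delta>(2) L1p c1p by (simp add: d_def)
        qed
        also have "\<dots> = K2 * (\<delta> * ln (real n))" by (simp add: d_def K2_def)
        also have "\<dots> \<le> K * eps m \<rho> n" unfolding \<delta>ln by (rule eK(2))
        finally show ?thesis unfolding eq .
      qed
      show "\<bar>sqrt_weight i t * poly (P - bs i A k) (cos t)\<bar> \<le> K * eps m \<rho> n"
        if i: "i \<in> {1,2,3,4}" and k: "k \<in> {n - 1, n, Suc n}" and P: "degree P \<le> k" "coeff P k = coeff (bs i A k) k"
          and orth: "\<And>g. degree g < k \<Longrightarrow> integral {0..pi} (\<lambda>t. (sqrt_weight i t)\<^sup>2 * poly (P * g) (cos t) * \<rho> (cos t)) = 0"
          and t: "t \<in> {0..pi}" for i k P t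
      proof -
        have An: "degree A + 3 \<le> n" using A(1) Q(1) by simp
        interpret bs_weight i A Q R M
          by unfold_locales (use i A Qpos Qup in auto)
        let ?d = "2 * c1\<^sup>2 * C * \<delta>"
        have dk: "degree A < k - 1" using k An by auto
        have lk: "ln (1 + 6 * real k * pi) \<le> 5 * ln (real n)" by (rule lnn) (use k in auto)
        have l0: "0 \<le> ln (1 + 6 * real k * pi)" by (rule ln_ge_zero) simp
        have d0: "0 \<le> ?d" using C(1) \<delta>(1) by simp
        have m1: "12 * M * ?d * ln (1 + 6 * real k * pi) \<le> 12 * M * ?d * (5 * ln (real n))"
          by (rule mult_left_mono[OF lk mult_nonneg_nonneg[OF _ d0]]) (use Mp in simp)
        also have "\<dots> = 120 * M * c1\<^sup>2 * C * (\<delta> * ln (real n))" by simp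
        also have "\<dots> \<le> 1" unfolding \<delta>ln by (rule elim(4))
        finally have small: "12 * M * ?d * ln (1 + 6 * real k * pi) \<le> 1" .
        have "\<bar>sqrt_weight i t * poly (P - bs i A k) (cos t)\<bar> \<le> 12 * M * amp * ?d * ln (1 + 6 * real k * pi)"
          by (rule orthogonal_minus_bs_bound[OF dk cont_rho wd P orth small t])
        also have "\<dots> = amp * (12 * M * ?d * ln (1 + 6 * real k * pi))" by (simp add: mult_ac)
        also have "\<dots> \<le> (2 * sqrt M) * (12 * M * ?d * (5 * ln (real n)))"
        proof (rule mult_mono[OF _ m1])
          show "amp \<le> 2 * sqrt M" unfolding amp_def using wscale_bounds(2)[of i] Mp by (intro mult_right_mono) auto
          show "0 \<le> 12 * M * ?d * ln (1 + 6 * real k * pi)"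
            by (rule mult_nonneg_nonneg[OF mult_nonneg_nonneg[OF _ d0] l0]) (use Mp in simp)
        qed (use Mp in simp)
        also have "\<dots> = K3 * (\<delta> * ln (real n))" by (simp add: K3_def mult_ac)
        also have "\<dots> \<le> K * eps m \<rho> n" unfolding \<delta>ln by (rule eK(3))
        finally show ?thesis .
      qed
    qed (use A Qlow Qup in auto)
    then show ?case by blast
  qed
  then show ?thesis
    using that[of K c M B] Kp cp Mp Bp by (simp add: K_def)
qed

section \<open>Vanishing of the error bound and its slowest admissible size\<close>

lemma eps_constant: "g constant_on {-1..1} \<Longrightarrow> eps m \<rho> n = 0"
proof -
  assume "g constant_on {-1..1}"
  then obtain k where k: "\<And>x. x \<in> {-1..1} \<Longrightarrow> g x = k" unfolding constant_on_def by blast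
  obtain x y where "x \<in> {-1..1}" "y \<in> {-1..1}" "modulus g (1 / real n) = \<bar>g x - g y\<bar>"
    using modulus_attained[OF cont_g, of "1 / real n"] by auto
  then have "modulus g (1 / real n) = 0" by (simp add: k)
  then show ?thesis by (simp add: eps_def)
qed

text \<open>A nonconstant continuous function has a modulus of continuity at least of order h, so
  \<epsilon>_n is bounded below by a multiple of n^-(m+1), which dominates every geometric
  sequence.\<close>

lemma geometric_le_eps:
  assumes nc: "\<not> g constant_on {-1..1}" and r: "0 < r" "r < 1"
  shows "\<forall>\<^sub>F n in sequentially. r ^ n \<le> eps m \<rho> n"
proof -
  obtain x y where xy: "x \<in> {-1..1}" "y \<in> {-1..1}" "g x \<noteq> g y"
    using nc unfolding constant_on_def by metis
  define d where "d = \<bar>g x - g y\<bar> / 3"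
  have d: "d > 0" using xy by (simp add: d_def)
  have md: "d / real n \<le> modulus g (1 / real n)" if n: "n \<ge> 1" for n
  proof -
    have W0: "0 \<le> modulus g (1 / real n)" by (rule modulus_nonneg[OF cont_g]) simp
    have "\<bar>x - y\<bar> \<le> 2" using xy by (auto simp: abs_le_iff)
    then have "real n * \<bar>x - y\<bar> \<le> real n * 2" by (intro mult_left_mono) auto
    then have "1 + real n * \<bar>x - y\<bar> \<le> 3 * real n" using of_nat_mono[OF n, where 'a = real] by linarith
    then have "modulus g (1 / real n) * (1 + real n * \<bar>x - y\<bar>) \<le> modulus g (1 / real n) * (3 * real n)"
      using W0 by (intro mult_left_mono)
    then have "3 * d \<le> modulus g (1 / real n) * (3 * real n)"
      using modulus_bound[OF cont_g n xy(1,2)] by (simp add: d_def)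
    then show ?thesis using n by (simp add: field_simps)
  qed
  \<comment> \<open>With this root, n^(m+1) r^n is the (m+1)-st power of n s^n, which tends to
    0.\<close>
  define s where "s = root (Suc m) r"
  have s: "0 \<le> s" "s < 1" "s ^ Suc m = r"
    unfolding s_def by (rule real_root_ge_zero real_root_lt_1_iff[THEN iffD2] real_root_pow_pos2 | use r in simp)+
  have "(\<lambda>n. real n * s ^ n) \<longlonglongrightarrow> 0"
    using powser_times_n_limit_0[of s] s by simp
  then have "(\<lambda>n. (real n * s ^ n) ^ Suc m) \<longlonglongrightarrow> 0 ^ Suc m" by (intro tendsto_intros)
  then have "(\<lambda>n. (real n * s ^ n) ^ Suc m) \<longlonglongrightarrow> 0" by simp
  then have "\<forall>\<^sub>F n in sequentially. (real n * s ^ n) ^ Suc m < d" using d by (rule order_tendstoD)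
  then show ?thesis using eventually_ge_at_top[of 3]
  proof eventually_elim
    case (elim n)
    have n1: "n \<ge> 1" using elim by simp
    have "(real n * s ^ n) ^ Suc m = real n ^ Suc m * r ^ n"
      unfolding power_mult_distrib s(3)[symmetric] by (simp only: power_mult[symmetric] mult.commute)
    then have "real n ^ Suc m * r ^ n \<le> d" using elim(1) by linarith
    then have "r ^ n \<le> d / real n ^ Suc m" using n1 by (simp add: pos_le_divide_eq mult.commute)
    also have "\<dots> = d / real n / real n ^ m" by simp
    also have "\<dots> \<le> modulus g (1 / real n) / real n ^ m" using md[OF n1] by (intro divide_right_mono) auto
    also have "\<dots> \<le> eps m \<rho> n" by (rule delta_le_eps[OF elim(2)])
    finally show ?case .
  qed
qed

end

section \<open>The asymptotic formulas\<close>

text \<open>Off the interval the reflected wave leaves an error r^n beside \<epsilon>_n: it is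
  dominated when the m-th derivative of 1/\<rho> is not constant, and is all that remains when it
  is. On the interval no such term arises. A closed \<open>K\<close> may be unbounded, so uniformity
  reaches infinity.\<close>

theorem theorem1:
  fixes m :: nat and \<rho> :: "real \<Rightarrow> real"
    and P :: "nat \<Rightarrow> nat \<Rightarrow> real poly" and a b :: "nat \<Rightarrow> nat \<Rightarrow> real"
  assumes "m \<ge> 3"
    and "\<And>x. x \<in> {-1..1} \<Longrightarrow> \<rho> x > 0"
    and "cont_diff m \<rho>"
    and "\<And>i n. i \<in> {1, 2, 3, 4} \<Longrightarrow> is_monic_OP \<rho> i n (P i n)"
    and "\<And>i. i \<in> {1, 2, 3, 4} \<Longrightarrow> recurrence_coeffs (P i) (a i) (b i)"
  shows "\<forall>i\<in>{1, 2, 3, 4}.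
    (\<forall>K. closed K \<and> K \<inter> slit = {} \<longrightarrow>
      (\<exists>e. (\<forall>n. \<forall>z\<in>K. poly (map_poly complex_of_real (P i n)) z =
                (1 + e n z) * (SS \<rho> i z / SS_inf \<rho> i) * (phi z / 2) ^ n) \<and>
           (\<not> nth_deriv m (\<lambda>x. 1 / \<rho> x) constant_on {-1..1} \<longrightarrow> uniform_bigo K e (eps m \<rho>)) \<and>
           (nth_deriv m (\<lambda>x. 1 / \<rho> x) constant_on {-1..1} \<longrightarrow>
              (\<exists>q\<in>{0<..<1}. uniform_bigo K e (\<lambda>n. q ^ n))))) \<and>
    (\<exists>e. (\<forall>n\<ge>1. \<forall>x\<in>{-1..1}.
            2 ^ (n - 1) * SS_inf \<rho> i * complex_of_real (sqrt (\<rho> x * \<bar>v_poly i x\<bar>) * poly (P i n) x) =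
            complex_of_real (cos (real n * arccos x + theta \<rho> x + theta_shift i x)) + e n x) \<and>
         uniform_bigo {-1..1} e (eps m \<rho>)) \<and>
    (\<lambda>n. a i n - 1 / 2) \<in> O(eps m \<rho>) \<and>
    b i \<in> O(eps m \<rho>)"
proof (intro ballI conjI)
  interpret smooth_weight m \<rho>
    using assms(1-3) by unfold_locales auto
  obtain \<kappa> c M B where \<kappa>: "\<kappa> \<ge> 0" "c > 0" "M > 0" "B \<ge> 0"
    "\<forall>\<^sub>F n in sequentially. \<exists>A Q R. szego_approx \<rho> A Q R c M B (\<kappa> * eps m \<rho> n) n"
    by (rule approx_exists)
  fix i :: nat assume i: "i \<in> {1, 2, 3, 4}"
  have OP: "is_monic_OP \<rho> i n (P i n)" for n by (rule assms(4)[OF i])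
  have rec: "[:0, 1:] * P i n = P i (Suc n) + smult (b i n) (P i n) + smult ((a i n)\<^sup>2) (P i (n - 1))" "a i n \<ge> 0"
    if "n \<ge> 1" for n
    using assms(5)[OF i] that unfolding recurrence_coeffs_def by (auto dest: spec[of _ n])
  show "b i \<in> O(eps m \<rho>)"
  proof (rule bigoI[of _ "8 * sqrt M / c * \<kappa>"])
    show "\<forall>\<^sub>F n in sequentially. norm (b i n) \<le> 8 * sqrt M / c * \<kappa> * norm (eps m \<rho> n)"
      using \<kappa>(5) eventually_ge_at_top[of 1]
    proof eventually_elim
      case (elim n)
      then obtain A Q R where "szego_approx \<rho> A Q R c M B (\<kappa> * eps m \<rho> n) n" by blast
      from szego_approx.recurrence_error(1)[OF this i OP rec[OF elim(2)]]
      show ?case using eps_nonneg[of n] by (simp add: mult.assoc)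
    qed
  qed
  let ?C = "8 * sqrt M / c + 2 * (8 * sqrt M / c) * (2 * sqrt M) * (2 * sqrt M + 1) / c"
  show "(\<lambda>n. a i n - 1 / 2) \<in> O(eps m \<rho>)"
  proof (rule bigoI[of _ "?C * \<kappa>"])
    show "\<forall>\<^sub>F n in sequentially. norm (a i n - 1 / 2) \<le> ?C * \<kappa> * norm (eps m \<rho> n)"
      using \<kappa>(5) eventually_ge_at_top[of 1]
    proof eventually_elim
      case (elim n)
      then obtain A Q R where "szego_approx \<rho> A Q R c M B (\<kappa> * eps m \<rho> n) n" by blast
      from szego_approx.recurrence_error(2)[OF this i OP rec[OF elim(2)]]
      show ?case using eps_nonneg[of n] by (simp add: mult.assoc)
    qed
  qed
  define e where "e = (\<lambda>n x. 2 ^ (n - 1) * SS_inf \<rho> i * complex_of_real (sqrt (\<rho> x * \<bar>v_poly i x\<bar>) * poly (P i n) x) -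
            complex_of_real (cos (real n * arccos x + theta \<rho> x + theta_shift i x)))"
  show "\<exists>e. (\<forall>n\<ge>1. \<forall>x\<in>{-1..1}.
            2 ^ (n - 1) * SS_inf \<rho> i * complex_of_real (sqrt (\<rho> x * \<bar>v_poly i x\<bar>) * poly (P i n) x) =
            complex_of_real (cos (real n * arccos x + theta \<rho> x + theta_shift i x)) + e n x) \<and>
         uniform_bigo {-1..1} e (eps m \<rho>)"
  proof (intro exI[of _ e] conjI)
    show "uniform_bigo {-1..1} e (eps m \<rho>)"
      unfolding uniform_bigo_def
    proof (intro exI[of _ "(9 + 3 * B) * \<kappa>"])
      show "\<forall>\<^sub>F n in sequentially. \<forall>x\<in>{-1..1}. cmod (e n x) \<le> (9 + 3 * B) * \<kappa> * eps m \<rho> n"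
        using \<kappa>(5)
      proof eventually_elim
        case (elim n)
        then obtain A Q R where "szego_approx \<rho> A Q R c M B (\<kappa> * eps m \<rho> n) n" by blast
        from szego_approx.interval_error[OF this i OP] show ?case by (auto simp: e_def mult.assoc)
      qed
    qed
  qed (simp add: e_def)
next
  interpret smooth_weight m \<rho>
    using assms(1-3) by unfold_locales auto
  obtain \<kappa> c M B where \<kappa>: "\<kappa> \<ge> 0" "c > 0" "M > 0" "B \<ge> 0"
    "\<forall>\<^sub>F n in sequentially. \<exists>A Q R. szego_approx \<rho> A Q R c M B (\<kappa> * eps m \<rho> n) n"
    by (rule approx_exists)
  fix i :: nat assume i: "i \<in> {1, 2, 3, 4}"
  have OP: "is_monic_OP \<rho> i n (P i n)" for n by (rule assms(4)[OF i])
  have SSinf: "SS_inf \<rho> i \<noteq> 0"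
  proof -
    have "SS_inf \<rho> i = 2 / (wscale i * szego_den i 0) * exp (- outer (\<lambda>t. ln (\<rho> (cos t))) 0)"
      by (rule SS_inf_eq) (use cont_rho pos i in auto)
    then show ?thesis using szego_den_nonzero[of 0 i] wscale_bounds(1)[of i] by auto
  qed
  show "\<forall>K. closed K \<and> K \<inter> slit = {} \<longrightarrow>
      (\<exists>e. (\<forall>n. \<forall>z\<in>K. poly (map_poly complex_of_real (P i n)) z =
                (1 + e n z) * (SS \<rho> i z / SS_inf \<rho> i) * (phi z / 2) ^ n) \<and>
           (\<not> g constant_on {-1..1} \<longrightarrow> uniform_bigo K e (eps m \<rho>)) \<and>
           (g constant_on {-1..1} \<longrightarrow>
              (\<exists>q\<in>{0<..<1}. uniform_bigo K e (\<lambda>n. q ^ n))))"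
  proof (intro allI impI)
    fix K :: "complex set" assume "closed K \<and> K \<inter> slit = {}"
    then have K: "closed K" "K \<inter> slit = {}" by auto
    obtain r where r: "0 < r" "r < 1"
      "\<And>\<zeta>. \<zeta> \<noteq> 0 \<Longrightarrow> norm \<zeta> < 1 \<Longrightarrow> joukowski \<zeta> \<in> K \<Longrightarrow> norm \<zeta> \<le> r"
      by (rule joukowski_separated[OF K]) (rule that, assumption, assumption, blast)
    have param: "\<exists>\<zeta>. \<zeta> \<noteq> 0 \<and> norm \<zeta> < 1 \<and> norm \<zeta> \<le> r \<and> z = joukowski \<zeta>" if "z \<in> K" for z
    proof -
      have "z \<notin> slit" using that K(2) by blast
      then obtain \<zeta> where "\<zeta> \<noteq> 0" "norm \<zeta> < 1" "z = joukowski \<zeta>" by (rule joukowski_surj)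
      then show ?thesis using r(3)[of \<zeta>] that by (intro exI[of _ \<zeta>]) auto
    qed
    \<comment> \<open>The relative error, taken for every n; the divisor vanishes nowhere on K, so
      the identity is exact and only the bound is asymptotic.\<close>
    define e where "e = (\<lambda>n z. poly (cpoly (P i n)) z / ((SS \<rho> i z / SS_inf \<rho> i) * (phi z / 2) ^ n) - 1)"
    have eq: "poly (cpoly (P i n)) z = (1 + e n z) * (SS \<rho> i z / SS_inf \<rho> i) * (phi z / 2) ^ n" if z: "z \<in> K" for n z
    proof -
      obtain \<zeta> where \<zeta>: "\<zeta> \<noteq> 0" "norm \<zeta> < 1" "z = joukowski \<zeta>" using param[OF z] by blast
      have "SS \<rho> i z = 2 / (wscale i * szego_den i \<zeta>) * exp (- outer (\<lambda>t. ln (\<rho> (cos t))) \<zeta>)"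
        unfolding \<zeta>(3) by (rule SS_joukowski) (use cont_rho pos i \<zeta> in auto)
      then have "SS \<rho> i z \<noteq> 0" using szego_den_nonzero[OF \<zeta>(2), of i] wscale_bounds(1)[of i] by auto
      moreover have "phi z \<noteq> 0" unfolding \<zeta>(3) phi_joukowski[OF \<zeta>(1,2)] using \<zeta>(1) by simp
      ultimately have "(SS \<rho> i z / SS_inf \<rho> i) * (phi z / 2) ^ n \<noteq> 0" using SSinf by simp
      then show ?thesis by (simp add: e_def mult.assoc)
    qed
    let ?a = "1 + 1 / (1 - r)\<^sup>2" and ?x = "exp (B / (1 - r)\<^sup>2)"
    have small: "\<forall>\<^sub>F n in sequentially. (\<kappa> * ?a) * eps m \<rho> n \<le> 1" by (rule eventually_eps_small) simp
    have bound: "\<forall>\<^sub>F n in sequentially. \<forall>z\<in>K. cmod (e n z) \<le>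
      3 * ?a * (\<kappa> * eps m \<rho> n) + 3 * ?x * (sqrt M * r ^ n + 2 * (\<kappa> * eps m \<rho> n))"
      using \<kappa>(5) small
    proof eventually_elim
      case (elim n)
      then obtain A Q R where S: "szego_approx \<rho> A Q R c M B (\<kappa> * eps m \<rho> n) n" by blast
      have s: "\<kappa> * eps m \<rho> n * ?a \<le> 1" using elim(2) by (simp only: mult_ac)
      show ?case
      proof
        fix z assume "z \<in> K"
        then obtain \<zeta> where \<zeta>: "\<zeta> \<noteq> 0" "norm \<zeta> \<le> r" "z = joukowski \<zeta>" using param by blast
        show "cmod (e n z) \<le> 3 * ?a * (\<kappa> * eps m \<rho> n) + 3 * ?x * (sqrt M * r ^ n + 2 * (\<kappa> * eps m \<rho> n))"
          unfolding e_def \<zeta>(3) by (rule szego_approx.exterior_error[OF S i OP \<zeta>(1,2) r(2) s])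
      qed
    qed
    show "\<exists>e. (\<forall>n. \<forall>z\<in>K. poly (map_poly complex_of_real (P i n)) z =
                (1 + e n z) * (SS \<rho> i z / SS_inf \<rho> i) * (phi z / 2) ^ n) \<and>
           (\<not> g constant_on {-1..1} \<longrightarrow> uniform_bigo K e (eps m \<rho>)) \<and>
           (g constant_on {-1..1} \<longrightarrow>
              (\<exists>q\<in>{0<..<1}. uniform_bigo K e (\<lambda>n. q ^ n)))"
    proof (intro exI[of _ e] conjI impI allI ballI)
      fix n z assume "z \<in> K"
      then show "poly (map_poly complex_of_real (P i n)) z = (1 + e n z) * (SS \<rho> i z / SS_inf \<rho> i) * (phi z / 2) ^ n"
        by (rule eq)
    next
      assume nc: "\<not> g constant_on {-1..1}"
      show "uniform_bigo K e (eps m \<rho>)"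
        unfolding uniform_bigo_def
      proof (intro exI[of _ "3 * ?a * \<kappa> + 3 * ?x * sqrt M + 6 * ?x * \<kappa>"])
        show "\<forall>\<^sub>F n in sequentially. \<forall>z\<in>K. cmod (e n z) \<le> (3 * ?a * \<kappa> + 3 * ?x * sqrt M + 6 * ?x * \<kappa>) * eps m \<rho> n"
          using bound geometric_le_eps[OF nc r(1,2)]
        proof eventually_elim
          case (elim n)
          have "3 * ?x * (sqrt M * r ^ n + 2 * (\<kappa> * eps m \<rho> n)) \<le> 3 * ?x * (sqrt M * eps m \<rho> n + 2 * (\<kappa> * eps m \<rho> n))"
            using elim(2) \<kappa>(3) by (intro mult_left_mono add_right_mono) auto
          then have "3 * ?a * (\<kappa> * eps m \<rho> n) + 3 * ?x * (sqrt M * r ^ n + 2 * (\<kappa> * eps m \<rho> n))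
            \<le> 3 * ?a * (\<kappa> * eps m \<rho> n) + 3 * ?x * (sqrt M * eps m \<rho> n + 2 * (\<kappa> * eps m \<rho> n))"
            by (rule add_left_mono)
          also have "\<dots> = (3 * ?a * \<kappa> + 3 * ?x * sqrt M + 6 * ?x * \<kappa>) * eps m \<rho> n"
          proof -
            have "3 * a * (k * E) + 3 * x * (s * E + 2 * (k * E)) = (3 * a * k + 3 * x * s + 6 * x * k) * E"
              for a k E x s :: real by (simp add: algebra_simps)
            then show ?thesis .
          qed
          finally show ?case using elim(1) by (meson order_trans)
        qed
      qed
    next
      assume const: "g constant_on {-1..1}"
      \<comment> \<open>With \<epsilon>_n = 0 the bound reduces to the reflected wave, and the rate
        is the radius r belonging to K.\<close>
      have "uniform_bigo K e (\<lambda>n. r ^ n)"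
        unfolding uniform_bigo_def
      proof (intro exI[of _ "3 * ?x * sqrt M"])
        show "\<forall>\<^sub>F n in sequentially. \<forall>z\<in>K. cmod (e n z) \<le> 3 * ?x * sqrt M * r ^ n"
          using bound by eventually_elim (simp add: eps_constant[OF const] mult.assoc)
      qed
      then show "\<exists>q\<in>{0<..<1}. uniform_bigo K e (\<lambda>n. q ^ n)" using r by auto
    qed
  qed
qed

end
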